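(* For any subset $J\subseteq[n]$, the following three ideals of $\mathbb{C}[x_1,\dots,x_n]$ are equal: (1) the colon ideal $(I_n:f_J)$; (2) the ideal $(p_{J,1},\dots,p_{J,n})$; (3) the ideal $\mathrm{gr}\,\mathbf{I}(\mathfrak{N}_J)$ attached to the finite locus $\mathfrak{N}_J\subseteq\mathbb{C}^n$ of $J$-Nietzschean permutations, where each $w\in\mathfrak{S}_n$ is regarded as the point $(w(1),\dots,w(n))\in\mathbb{C}^n$. Moreover, if $\mathcal{I}_J$ denotes this common ideal, then $$\mathrm{Hilb}(\mathbb{C}[x_1,\dots,x_n]/\mathcal{I}_J;q)=\prod_{i=1}^n[\mathrm{st}(J)_i]_q.$$
   Context: $[n]=\{1,\dots,n\}$. $I_n\subseteq\mathbb{C}[x_1,\dots,x_n]$ is the ideal generated by symmetric polynomials with zero constant term. For an ideal $\mathfrak{a}$ and polynomial $f$, $(\mathfrak{a}:f)=\{g: gf\in\mathfrak{a}\}$. For $J\subseteq[n]$, $f_J=\prod_{j\in J}x_j\prod_{i=j+1}^n(x_j-x_i)$. For $S\subseteq[n]$, $h_r(S)$ is the complete homogeneous symmetric polynomial of degree $r$ in the variables $\{x_k:k\in S\}$ ($h_0=1$), and $\partial_s=\partial/\partial x_s$. Define $p_{J,i}$ for $1\le i\le n$: if $i<\min(J)$ (always the case if $J=\varnothing$), $p_{J,i}=h_i(\{i,i+1,\dots,n\})$; if $i\ge\min(J)$, $p_{J,i}=\partial_s h_r(J\cup\{i+1,\dots,n\})$ where $s=\max(J\cap\{1,\dots,i\})$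 and $r=n-|J\cup\{i+1,\dots,n\}|+1$. The $J$-staircase $\mathrm{st}(J)=(\mathrm{st}(J)_1,\dots,\mathrm{st}(J)_n)$ is defined by $\mathrm{st}(J)_1=0$ if $1\in J$ and $1$ otherwise, and $\mathrm{st}(J)_{i+1}=\mathrm{st}(J)_i$ if $i+1\in J$ and $\mathrm{st}(J)_i+1$ otherwise. $[m]_q=1+q+\cdots+q^{m-1}$ (so $[0]_q=0$). A permutation $w\in\mathfrak{S}_n$ is $j$-resentful if $w(j)=n$ or $w(j)+1\in\{w(j+1),\dots,w(n)\}$, $j$-Nietzschean otherwise; it is $J$-Nietzschean if it is $j$-Nietzschean for all $j\in J$, and $\mathfrak{N}_J$ is the set of such permutations. For finite $Z\subseteq\mathbb{C}^n$, $\mathbf{I}(Z)$ is the ideal of polynomials vanishing on $Z$; for nonzero $f$, $\tau(f)$ is its top-degree homogeneous component; $\mathrm{gr}\,\mathbf{I}(Z)$ is the ideal generated by $\{\tau(f):0\ne f\in\mathbf{I}(Z)\}$. The Hilbert series of a graded quotient $A$ is $\sum_i\dim A_i\,q^i$. *)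

theory Defs
  imports
    Complex_Main
    "HOL-Library.Poly_Mapping"
    "HOL-Combinatorics.Permutations"
    "HOL-Computational_Algebra.Formal_Power_Series"
    "HOL-Algebra.QuotRing"
    "HOL-Algebra.Embedded_Algebras"
begin

section \<open>The polynomial ring in \<open>x\<^sub>1, \<dots>, x\<^sub>n\<close>\<close>

text \<open>
  An exponent vector is a finitely supported map \<open>nat \<Rightarrow>\<^sub>0 nat\<close>, and a polynomial is a finitely
  supported map from exponent vectors to coefficients. The type has the indeterminates \<open>x\<^sub>i\<close> for
  all naturals \<open>i\<close>; the ring in \<open>x\<^sub>1, \<dots>, x\<^sub>n\<close> is the subring on those polynomials that involve
  indices from \<open>{1..n}\<close> only.
\<close>

type_synonym cpoly = "(nat \<Rightarrow>\<^sub>0 nat) \<Rightarrow>\<^sub>0 complex"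

definition poly_ring :: "nat \<Rightarrow> cpoly ring" where
  "poly_ring n =
     \<lparr>carrier = {f. \<forall>m \<in> Poly_Mapping.keys f. Poly_Mapping.keys m \<subseteq> {1..n}},
      mult = (*), one = 1, zero = 0, add = (+)\<rparr>"

lemma cring_poly_ring: "cring (poly_ring n)"
proof -
  have add_closed: "f + g \<in> carrier (poly_ring n)"
    if fg: "f \<in> carrier (poly_ring n)" "g \<in> carrier (poly_ring n)" for f g
  proof -
    have "Poly_Mapping.keys m \<subseteq> {1..n}" if "m \<in> Poly_Mapping.keys (f + g)" for m
    proof -
      have "m \<in> Poly_Mapping.keys f \<or> m \<in> Poly_Mapping.keys g"
        using Poly_Mapping.keys_add[of f g] that by auto
      then show ?thesis using fg by (auto simp: poly_ring_def)
    qed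
    then show ?thesis by (simp add: poly_ring_def)
  qed
  have mult_closed: "f * g \<in> carrier (poly_ring n)"
    if fg: "f \<in> carrier (poly_ring n)" "g \<in> carrier (poly_ring n)" for f g
  proof -
    have "Poly_Mapping.keys m \<subseteq> {1..n}" if m: "m \<in> Poly_Mapping.keys (f * g)" for m
    proof -
      obtain a b where ab: "a \<in> Poly_Mapping.keys f" "b \<in> Poly_Mapping.keys g" "m = a + b"
        using keys_mult[of f g] m by blast
      have "Poly_Mapping.keys a \<subseteq> {1..n}" "Poly_Mapping.keys b \<subseteq> {1..n}"
        using ab(1,2) fg by (simp_all add: poly_ring_def)
      then show ?thesis
        using Poly_Mapping.keys_add[of a b] ab(3) by blast
    qed
    then show ?thesis by (simp add: poly_ring_def)
  qed
  have "abelian_group (poly_ring n)"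
  proof (rule abelian_groupI, goal_cases)
    case (1 f g)
    have "f \<oplus>\<^bsub>poly_ring n\<^esub> g = f + g" by (simp add: poly_ring_def)
    then show ?case using add_closed[OF 1] by (rule ssubst)
  next
    case 2 show ?case by (simp add: poly_ring_def)
  next
    case 3 show ?case by (simp add: poly_ring_def add.assoc)
  next
    case 4 show ?case by (simp add: poly_ring_def add.commute)
  next
    case 5 show ?case by (simp add: poly_ring_def)
  next
    case (6 f)
    then show ?case by (intro bexI[of _ "- f"]) (simp_all add: poly_ring_def)
  qed
  moreover have "Group.comm_monoid (poly_ring n)"
  proof (rule comm_monoidI, goal_cases)
    case (1 f g)
    have "f \<otimes>\<^bsub>poly_ring n\<^esub> g = f * g" by (simp add: poly_ring_def)
    then show ?case using mult_closed[OF 1] by (rule ssubst)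
  next
    case 2 show ?case by (simp add: poly_ring_def)
  next
    case 3 show ?case by (simp add: poly_ring_def mult.assoc)
  next
    case 4 show ?case by (simp add: poly_ring_def)
  next
    case 5 show ?case by (simp add: poly_ring_def mult.commute)
  qed
  ultimately show ?thesis
    by (rule cringI) (simp add: poly_ring_def distrib_right)
qed

definition var :: "nat \<Rightarrow> cpoly" where
  "var i = Poly_Mapping.single (Poly_Mapping.single i 1) 1"

definition const :: "complex \<Rightarrow> cpoly" where
  "const c = Poly_Mapping.single 0 c"

text \<open>
  \<open>eval_with \<phi> a f\<close> sends \<open>x\<^sub>i\<close> to \<open>a i\<close> and each coefficient \<open>c\<close> to \<open>\<phi> c\<close>. It serves both for
  evaluation at a point (\<open>\<phi> = id\<close>) and for substitution of polynomials (\<open>\<phi> = const\<close>).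
\<close>

definition eval_with :: "(complex \<Rightarrow> 'a::comm_semiring_1) \<Rightarrow> (nat \<Rightarrow> 'a) \<Rightarrow> cpoly \<Rightarrow> 'a" where
  "eval_with \<phi> a f =
     (\<Sum>m \<in> Poly_Mapping.keys f.
        \<phi> (Poly_Mapping.lookup f m) * (\<Prod>i \<in> Poly_Mapping.keys m. a i ^ Poly_Mapping.lookup m i))"

definition mdeg :: "(nat \<Rightarrow>\<^sub>0 nat) \<Rightarrow> nat" where
  "mdeg m = (\<Sum>i \<in> Poly_Mapping.keys m. Poly_Mapping.lookup m i)"

definition homogeneous_polys :: "nat \<Rightarrow> nat \<Rightarrow> cpoly set" where
  "homogeneous_polys n d = {f \<in> carrier (poly_ring n). \<forall>m \<in> Poly_Mapping.keys f. mdeg m = d}"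

definition total_degree :: "cpoly \<Rightarrow> nat" where
  "total_degree f = Max (mdeg ` Poly_Mapping.keys f)"

definition top_component :: "cpoly \<Rightarrow> cpoly" where
  "top_component f =
     (\<Sum>m \<in> {m \<in> Poly_Mapping.keys f. mdeg m = total_degree f}.
        Poly_Mapping.single m (Poly_Mapping.lookup f m))"

text \<open>
  Exponent subtraction truncates at \<open>0\<close>, but only for monomials not involving \<open>x\<^sub>s\<close>, whose
  coefficient is then multiplied by \<open>0\<close>.
\<close>

definition partial_deriv :: "nat \<Rightarrow> cpoly \<Rightarrow> cpoly" where
  "partial_deriv s f =
     (\<Sum>m \<in> Poly_Mapping.keys f. Poly_Mapping.single (m - Poly_Mapping.single s 1)
                       (of_nat (Poly_Mapping.lookup m s) * Poly_Mapping.lookup f m))"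

text \<open>Meant for finite \<open>S\<close>.\<close>

definition complete_homogeneous :: "nat \<Rightarrow> nat set \<Rightarrow> cpoly" where
  "complete_homogeneous r S =
     (\<Sum>m \<in> {m. Poly_Mapping.keys m \<subseteq> S \<and> mdeg m = r}. Poly_Mapping.single m 1)"

section \<open>The three ideals\<close>

definition symmetric_polys :: "nat \<Rightarrow> cpoly set" where
  "symmetric_polys n =
     {f \<in> carrier (poly_ring n).
        \<forall>\<sigma>. \<sigma> permutes {1..n} \<longrightarrow> eval_with const (\<lambda>i. var (\<sigma> i)) f = f}"

definition coinvariant_ideal :: "nat \<Rightarrow> cpoly set" where
  "coinvariant_ideal n = Idl\<^bsub>poly_ring n\<^esub> {f \<in> symmetric_polys n. Poly_Mapping.lookup f 0 = 0}"

definition colon_ideal :: "nat \<Rightarrow> cpoly set \<Rightarrow> cpoly \<Rightarrow> cpoly set" where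
  "colon_ideal n I f = {g \<in> carrier (poly_ring n). g * f \<in> I}"

definition f_poly :: "nat \<Rightarrow> nat set \<Rightarrow> cpoly" where
  "f_poly n J = (\<Prod>j \<in> J. var j * (\<Prod>i \<in> {j+1..n}. var j - var i))"

text \<open>
  For \<open>J \<subseteq> {1..n}\<close> the set \<open>T\<close> below has at most \<open>n\<close> elements, so the subtraction in \<open>n - card T\<close>
  does not truncate.
\<close>

definition p_poly :: "nat \<Rightarrow> nat set \<Rightarrow> nat \<Rightarrow> cpoly" where
  "p_poly n J i =
     (if J = {} \<or> i < Min J then complete_homogeneous i {i..n}
      else let s = Max (J \<inter> {1..i});
               T = J \<union> {i+1..n}
           in partial_deriv s (complete_homogeneous (n - card T + 1) T))"

definition resentful :: "nat \<Rightarrow> (nat \<Rightarrow> nat) \<Rightarrow> nat \<Rightarrow> bool" where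
  "resentful n w j \<longleftrightarrow> w j = n \<or> w j + 1 \<in> w ` {j+1..n}"

definition nietzschean_perms :: "nat \<Rightarrow> nat set \<Rightarrow> (nat \<Rightarrow> nat) set" where
  "nietzschean_perms n J = {w. w permutes {1..n} \<and> (\<forall>j \<in> J. \<not> resentful n w j)}"

text \<open>Points of complex \<open>n\<close>-space are the functions in \<open>{1..n} \<rightarrow>\<^sub>E UNIV\<close>.\<close>

definition perm_point :: "nat \<Rightarrow> (nat \<Rightarrow> nat) \<Rightarrow> (nat \<Rightarrow> complex)" where
  "perm_point n w = (\<lambda>i \<in> {1..n}. of_nat (w i))"

definition nietzschean_locus :: "nat \<Rightarrow> nat set \<Rightarrow> (nat \<Rightarrow> complex) set" where
  "nietzschean_locus n J = perm_point n ` nietzschean_perms n J"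

definition vanishing_ideal :: "nat \<Rightarrow> (nat \<Rightarrow> complex) set \<Rightarrow> cpoly set" where
  "vanishing_ideal n Z = {f \<in> carrier (poly_ring n). \<forall>z \<in> Z. eval_with id z f = 0}"

definition gr_ideal :: "nat \<Rightarrow> cpoly set \<Rightarrow> cpoly set" where
  "gr_ideal n I = Idl\<^bsub>poly_ring n\<^esub> {top_component f | f. f \<in> I \<and> f \<noteq> 0}"

section \<open>Hilbert series and staircases\<close>

text \<open>
  For a homogeneous ideal \<open>I\<close>, the degree-\<open>d\<close> piece of the quotient ring is the image of the
  homogeneous polynomials of degree \<open>d\<close>. Its dimension is taken over the image of the constants.
  If \<open>I\<close> is the whole ring, the quotient is the zero ring and \<open>ring.dim\<close> gives \<open>0\<close> for each piece,
  since \<open>ring.dimension\<close> then only admits \<open>dimension 0 K {0}\<close>.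
\<close>

definition quotient_piece :: "nat \<Rightarrow> cpoly set \<Rightarrow> nat \<Rightarrow> cpoly set set" where
  "quotient_piece n I d = (\<lambda>f. I +>\<^bsub>poly_ring n\<^esub> f) ` homogeneous_polys n d"

definition quotient_scalars :: "nat \<Rightarrow> cpoly set \<Rightarrow> cpoly set set" where
  "quotient_scalars n I = (\<lambda>c. I +>\<^bsub>poly_ring n\<^esub> const c) ` UNIV"

definition hilbert_series :: "nat \<Rightarrow> cpoly set \<Rightarrow> int fps" where
  "hilbert_series n I =
     Abs_fps (\<lambda>d. int (ring.dim (poly_ring n Quot I) (quotient_scalars n I) (quotient_piece n I d)))"

text \<open>The value at \<open>0\<close> is auxiliary: it makes \<open>st(J)\<^sub>1\<close> an instance of the general recursion.\<close>

primrec staircase :: "nat set \<Rightarrow> nat \<Rightarrow> nat" where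
  "staircase J 0 = 0"
| "staircase J (Suc i) = (if Suc i \<in> J then staircase J i else staircase J i + 1)"

definition q_number :: "nat \<Rightarrow> int fps" where
  "q_number m = (\<Sum>k<m. fps_X ^ k)"

end

theory Submission
  imports Defs "HOL-Computational_Algebra.Polynomial"
begin

text \<open>
  Let \<open>u\<^sup>n[M]\<close> be the divided difference of \<open>u\<^sup>n\<close> at a multiset \<open>M\<close> of indeterminates, which is the
  complete homogeneous polynomial of degree \<open>n + 1 - |M|\<close> in \<open>M\<close>. Up to a triangular change of
  generators, \<open>p\<^bsub>J,i\<^esub>\<close> is \<open>u\<^sup>n[J\<^bsub>\<le>i\<^esub> + {i..n}]\<close>.

  Multiplying \<open>f\<^sub>J\<close> by one linear factor \<open>\<ell>\<close> after the other turns an ideal \<open>K\<close> of the chain into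
  \<open>(K : \<ell>)\<close>. By the recurrence of divided differences (and Euler's identity when \<open>\<ell> = x\<^sub>j\<close>), one
  generator of degree \<open>d\<close> is replaced by one of degree \<open>d - 1\<close>, while \<open>K + (\<ell>)\<close> contains generators of
  the same shape in one indeterminate less. With \<open>hilb K \<le> q hilb (K : \<ell>) + hilb (K + (\<ell>))\<close>, an
  induction on the number of indeterminates bounds the Hilbert series modulo the \<open>p\<^bsub>J,i\<^esub>\<close> from above
  by the product formula, and, starting from the known series of the coinvariant ring, the series of
  \<open>(I\<^sub>n : f\<^sub>J)\<close> from below.

  The middle ideal lies between the two. Shifting the nodes in \<open>J\<^bsub>\<le>i\<^esub>\<close> by one and replacing \<open>u\<^sup>n\<close> by
  \<open>(u - 1) \<dots> (u - n)\<close> deforms the generators to polynomials vanishing on the Nietzschean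
  permutations; shifting the factors of \<open>f\<^sub>J\<close> gives a polynomial vanishing on all other permutations,
  which reduces \<open>gr I(\<NN>\<^sub>J) \<subseteq> (I\<^sub>n : f\<^sub>J)\<close> to \<open>gr I(\<SS>\<^sub>n) \<subseteq> I\<^sub>n\<close>.
\<close>

text \<open>The estimate for one linear factor is only an inequality, so the estimates are
  telescoped. A chain of m factors with product F gives hilb K <= q^m hilb (K : F) + (S - q^m S'),
  where S and S' are the products expected before and after. Read with an upper bound on hilb (K :
  F), it bounds hilb K from above; read with a lower bound on hilb K, it bounds hilb (K : F) from
  below. One computation thus serves both directions. The class of ideals must be closed under
  adjoining the factors. Adjoining x_j - x_c turns x_c into a further copy of x_j, hence a
  multiplicity l; adjoining x_j deletes these copies and lowers the exponent of u, hence a variable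
  exponent N. The order of the factors is forced, since each division consumes a generator that the
  preceding one has produced. No element of the colon ideal is ever written in terms of the p_{J,i}:
  the last inclusion comes from the comparison of series alone.\<close>

abbreviation (input) keys where "keys \<equiv> Poly_Mapping.keys"
abbreviation (input) lookup where "lookup \<equiv> Poly_Mapping.lookup"
abbreviation (input) single where "single \<equiv> Poly_Mapping.single"

section \<open>Homogeneous components\<close>

definition hcomp :: "nat \<Rightarrow> cpoly \<Rightarrow> cpoly" where
  "hcomp d f = (\<Sum>m \<in> {m \<in> keys f. mdeg m = d}.
     single m (lookup f m))"

definition homog :: "nat \<Rightarrow> cpoly set" where
  "homog d = {f. \<forall>m \<in> keys f. mdeg m = d}"

lemma lookup_hcomp:
  "lookup (hcomp d f) m = (if mdeg m = d then lookup f m else 0)"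
  unfolding hcomp_def lookup_sum lookup_single when_def
  by (auto simp: in_keys_iff)

lemma mdeg_superset:
  assumes "finite S" "keys m \<subseteq> S"
  shows "mdeg m = (\<Sum>i\<in>S. lookup m i)"
  unfolding mdeg_def using assms
  by (intro sum.mono_neutral_left) (auto simp: in_keys_iff)

lemma mdeg_add: "mdeg (a + b) = mdeg a + mdeg b"
proof -
  let ?S = "keys a \<union> keys b"
  have "mdeg (a + b) = (\<Sum>i\<in>?S. lookup (a + b) i)"
    using Poly_Mapping.keys_add[of a b] by (intro mdeg_superset) auto
  also have "\<dots> = mdeg a + mdeg b"
    by (simp add: lookup_add sum.distrib mdeg_superset[of ?S a] mdeg_superset[of ?S b])
  finally show ?thesis .
qed

lemma mdeg_0 [simp]: "mdeg 0 = 0"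
  by (simp add: mdeg_def)

lemma mdeg_single [simp]: "mdeg (single i k) = k"
  by (simp add: mdeg_def)

lemma mdeg_eq_0 [simp]: "mdeg m = 0 \<longleftrightarrow> m = 0"
  by (auto simp: mdeg_def in_keys_iff intro!: poly_mapping_eqI)

lemma finite_mdeg: "finite S \<Longrightarrow> finite {m. keys m \<subseteq> S \<and> mdeg m = d}"
proof -
  assume S: "finite S"
  have "lookup ` {m. keys m \<subseteq> S \<and> mdeg m = d}
     \<subseteq> {f. \<forall>i. (i \<in> S \<longrightarrow> f i \<in> {..d}) \<and> (i \<notin> S \<longrightarrow> f i = 0)}"
  proof (rule image_subsetI)
    fix m assume "m \<in> {m. keys m \<subseteq> S \<and> mdeg m = d}"
    then have m: "keys m \<subseteq> S" "mdeg m = d" by simp_all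
    have "lookup m i \<le> d" if "i \<in> S" for i
      unfolding m(2)[symmetric] mdeg_superset[OF S m(1)] using S that by (intro member_le_sum) auto
    moreover have "lookup m i = 0" if "i \<notin> S" for i
      using m(1) that by (auto simp: in_keys_iff)
    ultimately show "lookup m \<in>
        {f. \<forall>i. (i \<in> S \<longrightarrow> f i \<in> {..d}) \<and> (i \<notin> S \<longrightarrow> f i = 0)}" by simp
  qed
  then have "finite (lookup ` {m. keys m \<subseteq> S \<and> mdeg m = d})"
    by (rule finite_subset) (rule finite_set_of_finite_funs[OF S finite_atMost])
  moreover have "inj_on lookup {m. keys m \<subseteq> S \<and> mdeg m = d}"
    by (meson inj_onI lookup_inject)
  ultimately show ?thesis by (rule finite_imageD)
qed

lemma hcomp_in_homog [simp, intro]: "hcomp d f \<in> homog d"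
  by (auto simp: homog_def in_keys_iff lookup_hcomp split: if_splits)

lemma hcomp_add [simp]: "hcomp d (f + g) = hcomp d f + hcomp d g"
  by (rule poly_mapping_eqI) (simp add: lookup_hcomp lookup_add)

lemma hcomp_diff [simp]: "hcomp d (f - g) = hcomp d f - hcomp d g"
  by (rule poly_mapping_eqI) (simp add: lookup_hcomp lookup_minus)

lemma hcomp_0 [simp]: "hcomp d 0 = 0"
  by (rule poly_mapping_eqI) (simp add: lookup_hcomp)

lemma hcomp_sum: "hcomp d (\<Sum>i\<in>A. f i) = (\<Sum>i\<in>A. hcomp d (f i))"
  by (induction A rule: infinite_finite_induct) auto

lemma homog_0 [simp]: "0 \<in> homog d"
  by (simp add: homog_def)

lemma homog_add [intro]: "f \<in> homog d \<Longrightarrow> g \<in> homog d \<Longrightarrow> f + g \<in> homog d"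
  using Poly_Mapping.keys_add[of f g] by (auto simp: homog_def)

lemma homog_uminus [intro]: "f \<in> homog d \<Longrightarrow> - f \<in> homog d"
  by (auto simp: homog_def)

lemma homog_diff [intro]: "f \<in> homog d \<Longrightarrow> g \<in> homog d \<Longrightarrow> f - g \<in> homog d"
  using homog_add[of f d "-g"] by auto

lemma homog_mult: "f \<in> homog d \<Longrightarrow> g \<in> homog e \<Longrightarrow> f * g \<in> homog (d + e)"
  using keys_mult[of f g] by (fastforce simp: homog_def mdeg_add)

lemma homog_single: "mdeg m = d \<Longrightarrow> single m c \<in> homog d"
  by (auto simp: homog_def)

lemma homog_const [simp]: "const c \<in> homog 0"
  by (simp add: const_def homog_single)

lemma homog_1 [simp]: "1 \<in> homog 0"
  by (simp add: homog_def)

lemma homog_var [simp]: "var i \<in> homog 1" "var i \<in> homog (Suc 0)"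
  by (simp_all add: var_def homog_single)

lemma homog_const_mult: "f \<in> homog d \<Longrightarrow> const c * f \<in> homog d"
  using homog_mult[of "const c" 0 f d] by simp

lemma homog_prod: "(\<And>i. i \<in> A \<Longrightarrow> f i \<in> homog (d i)) \<Longrightarrow> (\<Prod>i\<in>A. f i) \<in> homog (\<Sum>i\<in>A. d i)"
  by (induction A rule: infinite_finite_induct) (auto intro: homog_mult)

lemma hcomp_homog [simp]: "f \<in> homog d \<Longrightarrow> hcomp e f = (if e = d then f else 0)"
  by (rule poly_mapping_eqI) (auto simp: lookup_hcomp homog_def in_keys_iff)

lemma sum_hcomp:
  assumes "\<And>m. m \<in> keys f \<Longrightarrow> mdeg m \<le> D"
  shows "(\<Sum>d\<le>D. hcomp d f) = f"
  using assms by (intro poly_mapping_eqI) (auto simp: lookup_sum lookup_hcomp in_keys_iff)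

lemma ex_degree_bound: obtains D where "\<And>m. m \<in> keys f \<Longrightarrow> mdeg m \<le> D"
  using finite_keys[of f] by (metis Max_ge finite_imageI imageI)

lemma hcomp_mult:
  assumes "p \<in> homog e"
  shows "hcomp d (p * g) = (if e \<le> d then p * hcomp (d - e) g else 0)"
proof -
  obtain D where D: "\<And>m. m \<in> keys g \<Longrightarrow> mdeg m \<le> D"
    using ex_degree_bound by blast
  have "hcomp d (p * g) = hcomp d (p * (\<Sum>k\<le>D. hcomp k g))"
    by (simp add: sum_hcomp[OF D])
  also have "\<dots> = (\<Sum>k\<le>D. hcomp d (p * hcomp k g))"
    by (simp add: sum_distrib_left hcomp_sum)
  also have "\<dots> = (\<Sum>k\<le>D. if d = e + k then p * hcomp k g else 0)"
    by (intro sum.cong refl hcomp_homog homog_mult assms hcomp_in_homog)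
  also have "\<dots> = (if e \<le> d \<and> d - e \<le> D then p * hcomp (d - e) g else 0)"
  proof (cases "e \<le> d")
    case True
    then have "(d = e + k) = (k = d - e)" for k by auto
    then show ?thesis using True by (simp add: sum.delta)
  qed auto
  also have "\<dots> = (if e \<le> d then p * hcomp (d - e) g else 0)"
  proof -
    have "hcomp (d - e) g = 0" if "\<not> d - e \<le> D"
      using D that by (intro poly_mapping_eqI) (metis in_keys_iff lookup_hcomp lookup_zero)
    then show ?thesis by simp
  qed
  finally show ?thesis .
qed

section \<open>Constants, monomials and the complex vector space of polynomials\<close>

lemma const_add: "const (a + b) = const a + const b"
  by (simp add: const_def single_add)
lemma const_mult: "const (a * b) = const a * const b"
  by (simp add: const_def mult_single)
lemma const_0 [simp]: "const 0 = 0"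
  by (simp add: const_def)
lemma const_1 [simp]: "const 1 = 1"
  by (simp add: const_def)
lemma const_uminus: "const (- a) = - const a"
  by (simp add: const_def single_uminus)
lemma const_of_nat: "const (of_nat k) = of_nat k"
  by (simp add: const_def)
lemma lookup_const_mult: "lookup (const c * f) m = c * lookup f m"
  unfolding const_def mult_map_scale_conv_mult[symmetric]
  by (simp add: Poly_Mapping.map.rep_eq when_def)

abbreviation mon :: "(nat \<Rightarrow>\<^sub>0 nat) \<Rightarrow> cpoly" where "mon m \<equiv> single m 1"

lemma mon_add: "mon (a + b) = mon a * mon b"
  by (simp add: mult_single)

lemma poly_eq_sum_mon: "f = (\<Sum>m\<in>keys f. const (lookup f m) * mon m)"
proof (rule poly_mapping_eqI)
  fix k
  have "lookup (\<Sum>m\<in>keys f. const (lookup f m) * mon m) k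
    = (\<Sum>m\<in>keys f. if m = k then lookup f m else 0)"
    unfolding lookup_sum lookup_const_mult lookup_single by (intro sum.cong) (auto simp: when_def)
  also have "\<dots> = lookup f k"
    by (simp add: in_keys_iff)
  finally show "lookup f k
    = lookup (\<Sum>m\<in>keys f. const (lookup f m) * mon m) k" ..
qed

text \<open>Multiplication by constants is the scalar action, which makes spans, independence and
  the exchange bound of linear algebra available for polynomials.\<close>

global_interpretation cp: vector_space "\<lambda>c f. const c * f"
  by unfold_locales (auto simp: const_add const_mult algebra_simps)

lemma span_homog: "B \<subseteq> homog d \<Longrightarrow> cp.span B \<subseteq> homog d"
  by (rule cp.span_minimal) (auto simp: cp.subspace_def homog_const_mult)

section \<open>Homogeneous ideals and the Hilbert function\<close>

text \<open>Ideals live in the ring of all indeterminates; those outside \<open>{1..n}\<close> are required to be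
  zero in the quotient, so that no membership in a subring has to be tracked.\<close>

definition hideal :: "nat \<Rightarrow> cpoly set \<Rightarrow> bool" where
  "hideal n I \<longleftrightarrow> 0 \<in> I \<and> (\<forall>f\<in>I. \<forall>g\<in>I. f + g \<in> I) \<and> (\<forall>f\<in>I. \<forall>r. r * f \<in> I)
     \<and> (\<forall>f\<in>I. \<forall>d. hcomp d f \<in> I) \<and> (\<forall>v. v \<notin> {1..n} \<longrightarrow> var v \<in> I)"

context
  fixes n I
  assumes I: "hideal n I"
begin

lemma hideal_0: "0 \<in> I"
  using I by (simp add: hideal_def)
lemma hideal_add: "f \<in> I \<Longrightarrow> g \<in> I \<Longrightarrow> f + g \<in> I"
  using I by (simp add: hideal_def)
lemma hideal_mult: "f \<in> I \<Longrightarrow> r * f \<in> I"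
  using I by (simp add: hideal_def)
lemma hideal_mult_right: "f \<in> I \<Longrightarrow> f * r \<in> I"
  using hideal_mult[of f r] by (simp add: mult.commute)
lemma hideal_uminus: "f \<in> I \<Longrightarrow> - f \<in> I"
  using hideal_mult[of f "-1"] by simp
lemma hideal_diff: "f \<in> I \<Longrightarrow> g \<in> I \<Longrightarrow> f - g \<in> I"
  using hideal_add[of f "-g"] hideal_uminus[of g] by simp
lemma hideal_hcomp: "f \<in> I \<Longrightarrow> hcomp d f \<in> I"
  using I by (simp add: hideal_def)
lemma hideal_var: "v \<notin> {1..n} \<Longrightarrow> var v \<in> I"
  using I by (simp add: hideal_def)
lemma hideal_sum: "(\<And>i. i \<in> A \<Longrightarrow> f i \<in> I) \<Longrightarrow> (\<Sum>i\<in>A. f i) \<in> I"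
  by (induction A rule: infinite_finite_induct) (auto intro: hideal_0 hideal_add)
lemma hideal_cong: "f - g \<in> I \<Longrightarrow> f \<in> I \<longleftrightarrow> g \<in> I"
  using hideal_diff[of f "f - g"] hideal_add[of "f - g" g] by auto
lemma hideal_const_mult_iff: "c \<noteq> 0 \<Longrightarrow> const c * f \<in> I \<longleftrightarrow> f \<in> I"
  using hideal_mult[of "const c * f" "const (inverse c)"] hideal_mult[of f "const c"]
  by (auto simp: mult.assoc[symmetric] const_mult[symmetric])

end

section \<open>Colon ideals and ideals enlarged by one form\<close>

definition colon :: "cpoly set \<Rightarrow> cpoly \<Rightarrow> cpoly set" where
  "colon I p = {g. p * g \<in> I}"

text \<open>The ideal sum I + (p), as the set of polynomials congruent to a multiple of p.\<close>

definition adjoin :: "cpoly set \<Rightarrow> cpoly \<Rightarrow> cpoly set" where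
  "adjoin I p = {f. \<exists>g. f - p * g \<in> I}"

lemma hideal_colon:
  assumes I: "hideal n I" and p: "p \<in> homog e"
  shows "hideal n (colon I p)"
proof -
  have "p * hcomp d f \<in> I" if "p * f \<in> I" for d f
    using hideal_hcomp[OF I that, of "d + e"] by (simp add: hcomp_mult[OF p])
  then show ?thesis
    using I hideal_add[OF I] hideal_mult[OF I] hideal_0[OF I] hideal_var[OF I]
    unfolding hideal_def[of n "colon I p"]
    by (auto simp: colon_def distrib_left mult.left_commute)
qed

lemma hideal_adjoin:
  assumes I: "hideal n I" and p: "p \<in> homog e"
  shows "hideal n (adjoin I p)"
proof -
  have 1: "\<exists>g. hcomp d f - p * g \<in> I" if "f - p * g \<in> I" for d f g
    using hideal_hcomp[OF I that, of d]
    by (auto simp: hcomp_mult[OF p] split: if_splits intro: exI[of _ 0] exI[of _ "hcomp (d - e) g"])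
  have 2: "\<exists>k. f + f' - p * k \<in> I" if "f - p * g \<in> I" "f' - p * g' \<in> I" for f f' g g'
    using hideal_add[OF I that] by (intro exI[of _ "g + g'"]) (simp add: algebra_simps)
  have 3: "\<exists>k. r * f - p * k \<in> I" if "f - p * g \<in> I" for r f g
    using hideal_mult[OF I that, of r] by (intro exI[of _ "r * g"]) (simp add: algebra_simps)
  have 4: "\<exists>g. f - p * g \<in> I" if "f \<in> I" for f
    using that by (intro exI[of _ 0]) simp
  show ?thesis
    unfolding hideal_def adjoin_def using 1 2 3 4 hideal_var[OF I] hideal_0[OF I] by blast
qed

lemma subset_colon: "hideal n I \<Longrightarrow> I \<subseteq> colon I p"
  by (auto simp: colon_def hideal_mult)

lemma subset_adjoin: "I \<subseteq> adjoin I p"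
  by (auto simp: adjoin_def intro!: exI[of _ 0])

lemma in_adjoin: "hideal n I \<Longrightarrow> p * g \<in> adjoin I p"
  by (auto simp: adjoin_def hideal_0 intro!: exI[of _ g])

lemma colon_colon: "colon (colon I p) q = colon I (p * q)"
  by (simp add: colon_def mult.assoc)

lemma colon_1 [simp]: "colon I 1 = I"
  by (simp add: colon_def)

lemma hideal_mon:
  assumes "hideal n I" "\<not> keys m \<subseteq> {1..n}"
  shows "mon m \<in> I"
proof -
  obtain v where v: "v \<in> keys m" "v \<notin> {1..n}"
    using assms by blast
  have "m = single v 1 + (m - single v 1)"
    using v by (intro poly_mapping_eqI) (auto simp: lookup_add lookup_minus lookup_single when_def in_keys_iff)
  then have "mon m = var v * mon (m - single v 1)"
    by (metis mon_add var_def)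
  then show ?thesis
    using hideal_mult_right[OF assms(1) hideal_var[OF assms(1) v(2)]] by simp
qed

section \<open>Dimensions of the graded pieces of a quotient\<close>

definition spans :: "cpoly set \<Rightarrow> nat \<Rightarrow> cpoly set \<Rightarrow> bool" where
  "spans I d B \<longleftrightarrow> finite B \<and> B \<subseteq> homog d \<and> (\<forall>f\<in>homog d. \<exists>b\<in>cp.span B. f - b \<in> I)"

text \<open>The dimension of the degree-d piece modulo I, encoded as the least size of a spanning
  set: any spanning set then gives an upper bound. For a \<open>hideal\<close> the minimum is
  attained, since the finitely many monomials in x_1, ..., x_n span.\<close>

definition qdim :: "cpoly set \<Rightarrow> nat \<Rightarrow> nat" where
  "qdim I d = (LEAST m. \<exists>B. spans I d B \<and> card B = m)"

lemma spans_if_mon: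
  assumes I: "hideal n I" and B: "finite B" "B \<subseteq> homog d"
    and mon: "\<And>m. mdeg m = d \<Longrightarrow> \<exists>b\<in>cp.span B. mon m - b \<in> I"
  shows "spans I d B"
  unfolding spans_def
proof (intro conjI ballI B)
  fix f assume f: "f \<in> homog d"
  have "\<exists>b. \<forall>m\<in>keys f. b m \<in> cp.span B \<and> mon m - b m \<in> I"
    using f mon by (intro bchoice) (auto simp: homog_def)
  then obtain b where b: "\<And>m. m \<in> keys f \<Longrightarrow> b m \<in> cp.span B"
    "\<And>m. m \<in> keys f \<Longrightarrow> mon m - b m \<in> I" by blast
  let ?b = "\<Sum>m\<in>keys f. const (lookup f m) * b m"
  have "f - ?b = (\<Sum>m\<in>keys f. const (lookup f m) * (mon m - b m))"
    by (subst (1) poly_eq_sum_mon) (simp add: sum_subtractf right_diff_distrib)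
  also have "\<dots> \<in> I"
    using b by (intro hideal_sum[OF I] hideal_mult[OF I])
  finally have "f - ?b \<in> I" .
  moreover have "?b \<in> cp.span B"
    using b by (intro cp.span_sum cp.span_scale)
  ultimately show "\<exists>b\<in>cp.span B. f - b \<in> I" by blast
qed

lemma spans_monomials:
  assumes I: "hideal n I"
  shows "spans I d (mon ` {m. keys m \<subseteq> {1..n} \<and> mdeg m = d})" (is "spans _ _ ?B")
proof (rule spans_if_mon[OF I])
  show "finite ?B" by (simp add: finite_mdeg)
  show "?B \<subseteq> homog d" by (auto intro: homog_single)
  fix m assume m: "mdeg m = d"
  have "mon m \<in> cp.span ?B" if "keys m \<subseteq> {1..n}"
    by (intro cp.span_base imageI CollectI conjI that m)
  moreover have "mon m - 0 \<in> I" if "\<not> keys m \<subseteq> {1..n}"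
    using hideal_mon[OF I that] by simp
  moreover have "mon m - mon m \<in> I" using hideal_0[OF I] by simp
  moreover have "0 \<in> cp.span ?B" by (rule cp.span_zero)
  ultimately show "\<exists>b\<in>cp.span ?B. mon m - b \<in> I"
    by meson
qed

lemma ex_qdim:
  assumes "hideal n I"
  obtains B where "spans I d B" "card B = qdim I d"
  using LeastI_ex[of "\<lambda>m. \<exists>B. spans I d B \<and> card B = m"] spans_monomials[OF assms, of d]
  unfolding qdim_def by blast

lemma qdim_le: "spans I d B \<Longrightarrow> qdim I d \<le> card B"
  unfolding qdim_def by (rule Least_le) blast

text \<open>Multiplication by p maps the quotient by (I : p) in degree d onto the kernel of the
  passage from I to I + (p) in degree d + 1. So p times a spanning set for the former, together with
  a spanning set for the latter, spans modulo I.\<close>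

lemma qdim_colon_adjoin:
  assumes I: "hideal n I" and p: "p \<in> homog 1"
  shows "qdim I (Suc d) \<le> qdim (colon I p) d + qdim (adjoin I p) (Suc d)"
proof -
  obtain B where B: "spans (colon I p) d B" "card B = qdim (colon I p) d"
    using ex_qdim[OF hideal_colon[OF I p]] .
  obtain C where C: "spans (adjoin I p) (Suc d) C" "card C = qdim (adjoin I p) (Suc d)"
    using ex_qdim[OF hideal_adjoin[OF I p]] .
  have "spans I (Suc d) ((*) p ` B \<union> C)"
    unfolding spans_def
  proof (intro conjI ballI)
    show "finite ((*) p ` B \<union> C)" "(*) p ` B \<union> C \<subseteq> homog (Suc d)"
      using B C homog_mult[OF p] by (auto simp: spans_def)
    fix f assume f: "f \<in> homog (Suc d)"
    then obtain c where c: "c \<in> cp.span C" "f - c \<in> adjoin I p"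
      using C by (auto simp: spans_def)
    then obtain g where g: "f - c - p * g \<in> I" by (auto simp: adjoin_def)
    have cH: "c \<in> homog (Suc d)"
      using c C span_homog by (auto simp: spans_def)
    \<comment> \<open>Comparing components of degree d + 1 replaces the cofactor g by its degree-d
      part, which can then be reduced modulo the colon ideal.\<close>
    have 1: "f - c - p * hcomp d g \<in> I"
      using hideal_hcomp[OF I g, of "Suc d"] f cH hcomp_mult[OF p, of "Suc d" g] by simp
    obtain b where b: "b \<in> cp.span B" "hcomp d g - b \<in> colon I p"
      using B(1) hcomp_in_homog[of d g] unfolding spans_def by blast
    have "f - c - p * hcomp d g + p * (hcomp d g - b) \<in> I"
      using b 1 by (intro hideal_add[OF I]) (auto simp: colon_def)
    then have "f - (c + p * b) \<in> I" by (simp add: algebra_simps)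
    moreover have "p * b \<in> cp.span ((*) p ` B)"
      using b(1)
    proof (induction rule: cp.span_induct_alt)
      case (step c x y)
      then have "const c * (p * x) + p * y \<in> cp.span ((*) p ` B)"
        using step by (intro cp.span_add cp.span_scale[OF cp.span_base]) auto
      then show ?case
        by (simp add: distrib_left mult.left_commute[of p])
    qed (simp add: cp.span_zero)
    then have "c + p * b \<in> cp.span ((*) p ` B \<union> C)"
      using c(1) by (intro cp.span_add) (auto intro: cp.span_mono[THEN subsetD, rotated])
    ultimately show "\<exists>b\<in>cp.span ((*) p ` B \<union> C). f - b \<in> I" by blast
  qed
  then have "qdim I (Suc d) \<le> card ((*) p ` B \<union> C)" by (rule qdim_le)
  also have "\<dots> \<le> card B + card C"
    using B by (intro order.trans[OF card_Un_le] add_mono card_image_le) (auto simp: spans_def)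
  finally show ?thesis using B C by simp
qed

lemma qdim_0_adjoin:
  assumes I: "hideal n I" and p: "p \<in> homog 1"
  shows "qdim I 0 \<le> qdim (adjoin I p) 0"
proof -
  obtain C where C: "spans (adjoin I p) 0 C" "card C = qdim (adjoin I p) 0"
    using ex_qdim[OF hideal_adjoin[OF I p]] .
  have "spans I 0 C"
    unfolding spans_def
  proof (intro conjI ballI)
    show "finite C" "C \<subseteq> homog 0" using C by (auto simp: spans_def)
    fix f assume f: "f \<in> homog 0"
    then obtain c where c: "c \<in> cp.span C" "f - c \<in> adjoin I p"
      using C by (auto simp: spans_def)
    then obtain g where g: "f - c - p * g \<in> I" by (auto simp: adjoin_def)
    have cH: "c \<in> homog 0"
      using c C span_homog by (auto simp: spans_def)
    show "\<exists>b\<in>cp.span C. f - b \<in> I"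
      using hideal_hcomp[OF I g, of 0] f cH hcomp_mult[OF p, of 0 g] c by auto
  qed
  then show ?thesis using qdim_le C by metis
qed

lemma hideal_eqI:
  assumes I: "hideal n I" and I': "hideal n I'" and sub: "I \<subseteq> I'"
    and le: "\<And>d. qdim I d \<le> qdim I' d"
  shows "I = I'"
proof -
  have *: "g \<in> I" if g: "g \<in> I'" "g \<in> homog d" for g d
  proof (rule ccontr)
    assume gI: "g \<notin> I"
    obtain B where B: "spans I d B" "card B = qdim I d"
      using ex_qdim[OF I] .
    have fin: "finite B" using B by (simp add: spans_def)
    obtain y where y: "y \<in> cp.span B" "g - y \<in> I"
      using B(1) g by (auto simp: spans_def)
    then obtain u where u: "y = (\<Sum>v\<in>B. const (u v) * v)"
      using cp.span_finite[OF fin] by auto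
    have "y \<in> I'"
      using g y sub hideal_cong[OF I', of g y] by auto
    have "y \<noteq> 0" using y gI by auto
    then obtain b where b: "b \<in> B" "u b \<noteq> 0"
      using u by (metis (no_types, lifting) const_0 mult_zero_left sum.neutral)
    let ?z = "\<Sum>v\<in>B - {b}. const (u v) * v"
    have z: "?z \<in> cp.span (B - {b})"
      by (intro cp.span_sum cp.span_scale cp.span_base) auto
    have yz: "y = const (u b) * b + ?z"
      using u b fin by (simp add: sum.remove)
    have "spans I' d (B - {b})"
      unfolding spans_def
    proof (intro conjI ballI)
      show "finite (B - {b})" "B - {b} \<subseteq> homog d" using B by (auto simp: spans_def)
      fix f assume "f \<in> homog d"
      then obtain x where x: "x \<in> cp.span B" "f - x \<in> I"
        using B(1) by (auto simp: spans_def)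
      obtain k where k: "x - const k * b \<in> cp.span (B - {b})"
        using cp.span_breakdown[OF b(1) x(1)] by auto
      have "const (k / u b) * y \<in> I'"
        using \<open>y \<in> I'\<close> by (rule hideal_mult[OF I'])
      moreover have "const (k / u b) * y = const k * b + const (k / u b) * ?z"
        using b(2) by (simp add: yz distrib_left mult.assoc[symmetric] const_mult[symmetric])
      ultimately have "f - x + (const k * b + const (k / u b) * ?z) \<in> I'"
        using x(2) sub hideal_add[OF I'] by auto
      moreover have "(x - const k * b) - const (k / u b) * ?z \<in> cp.span (B - {b})"
        by (rule cp.span_diff[OF k cp.span_scale[OF z]])
      ultimately show "\<exists>b\<in>cp.span (B - {b}). f - b \<in> I'"
        by (intro bexI[of _ "x - const k * b - const (k / u b) * ?z"]) (simp_all add: algebra_simps)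
    qed
    then have "qdim I' d \<le> card (B - {b})" by (rule qdim_le)
    also have "\<dots> < card B" by (rule card_Diff1_less[OF fin b(1)])
    finally show False using le[of d] B(2) by simp
  qed
  have "f \<in> I" if f: "f \<in> I'" for f
  proof -
    obtain D where D: "\<And>m. m \<in> keys f \<Longrightarrow> mdeg m \<le> D"
      using ex_degree_bound by blast
    have "(\<Sum>d\<le>D. hcomp d f) \<in> I"
      by (intro hideal_sum[OF I] *[OF hideal_hcomp[OF I' f] hcomp_in_homog])
    then show ?thesis by (simp add: sum_hcomp[OF D])
  qed
  then show ?thesis using sub by blast
qed

section \<open>Hilbert series and their coefficientwise order\<close>

definition hser :: "cpoly set \<Rightarrow> int fps" where
  "hser I = Abs_fps (\<lambda>d. int (qdim I d))"

definition fps_le :: "int fps \<Rightarrow> int fps \<Rightarrow> bool" (infix "\<preceq>" 50) where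
  "F \<preceq> G \<longleftrightarrow> (\<forall>d. fps_nth F d \<le> fps_nth G d)"

lemma fps_le_refl [simp]: "F \<preceq> F"
  by (simp add: fps_le_def)
lemma fps_le_trans [trans]: "F \<preceq> G \<Longrightarrow> G \<preceq> H \<Longrightarrow> F \<preceq> H"
  unfolding fps_le_def by (meson order_trans)
lemma fps_le_antisym: "F \<preceq> G \<Longrightarrow> G \<preceq> F \<Longrightarrow> F = G"
  by (auto simp: fps_le_def fps_eq_iff intro: order.antisym)
lemma fps_le_add: "F \<preceq> G \<Longrightarrow> F' \<preceq> G' \<Longrightarrow> F + F' \<preceq> G + G'"
  by (simp add: fps_le_def add_mono)
lemma fps_le_X_mult: "F \<preceq> G \<Longrightarrow> fps_X * F \<preceq> fps_X * G"
  by (auto simp: fps_le_def)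
lemma fps_le_mult: "0 \<preceq> F \<Longrightarrow> 0 \<preceq> G \<Longrightarrow> 0 \<preceq> F * G"
  by (auto simp: fps_le_def fps_mult_nth intro!: sum_nonneg)
lemma fps_le_sum_0: "(\<And>i. i \<in> A \<Longrightarrow> 0 \<preceq> f i) \<Longrightarrow> 0 \<preceq> (\<Sum>i\<in>A. f i)"
  by (auto simp: fps_le_def fps_sum_nth intro!: sum_nonneg)
lemma fps_le_prod_0: "(\<And>i. i \<in> A \<Longrightarrow> 0 \<preceq> f i) \<Longrightarrow> 0 \<preceq> (\<Prod>i\<in>A. f i)"
proof (induction A rule: infinite_finite_induct)
  case empty then show ?case by (auto simp: fps_le_def fps_one_nth)
qed (auto intro: fps_le_mult, auto simp: fps_le_def fps_one_nth)
lemma fps_le_X_power: "0 \<preceq> fps_X ^ k"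
  by (auto simp: fps_le_def)
lemma fps_le_q_number: "0 \<preceq> q_number k"
  unfolding q_number_def by (intro fps_le_sum_0 fps_le_X_power)

lemma hser_colon_adjoin:
  assumes "hideal n I" "p \<in> homog 1"
  shows "hser I \<preceq> fps_X * hser (colon I p) + hser (adjoin I p)"
  unfolding fps_le_def
proof
  fix d show "fps_nth (hser I) d \<le> fps_nth (fps_X * hser (colon I p) + hser (adjoin I p)) d"
    using qdim_colon_adjoin[OF assms] qdim_0_adjoin[OF assms]
    by (cases d) (auto simp: hser_def simp flip: of_nat_add)
qed

lemma hser_eq_0:
  assumes "hideal n I" "1 \<in> I"
  shows "hser I = 0"
proof -
  have "f \<in> I" for f using hideal_mult[OF assms, of f] by simp
  then have "spans I d {}" for d
    by (auto simp: spans_def)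
  then have "qdim I d = 0" for d
    using qdim_le[of I d "{}"] by simp
  then show ?thesis by (simp add: hser_def fps_eq_iff)
qed

lemma q_number_Suc: "q_number (Suc k) = 1 + fps_X * q_number k"
  by (simp add: q_number_def sum.lessThan_Suc_shift sum_distrib_left del: sum.lessThan_Suc)

section \<open>Complete homogeneous polynomials as divided differences\<close>

definition geom :: "'a::comm_ring_1 \<Rightarrow> 'a fps" where
  "geom y = Abs_fps (\<lambda>k. y ^ k)"

text \<open>The complete homogeneous polynomial, read off from its generating function, the product
  of the series 1 / (1 - y X). The arguments are a multiset of ring elements because nodes will be
  repeated, shifted by constants and evaluated.\<close>

definition hc :: "nat \<Rightarrow> 'a::comm_ring_1 multiset \<Rightarrow> 'a" where
  "hc d M = fps_nth (\<Prod>y\<in>#M. geom y) d"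

lemma geom_mult: "geom y * (1 - fps_const y * fps_X) = 1"
proof -
  have "geom y = 1 + fps_X * (fps_const y * geom y)"
  proof (rule fps_ext)
    fix k show "fps_nth (geom y) k = fps_nth (1 + fps_X * (fps_const y * geom y)) k"
      by (cases k) (simp_all add: geom_def)
  qed
  then show ?thesis by (simp add: algebra_simps)
qed

lemma hc_0 [simp]: "hc 0 M = 1"
  by (induction M) (simp_all add: hc_def fps_mult_nth geom_def)

lemma hc_empty [simp]: "hc (Suc d) {#} = 0"
  by (simp add: hc_def)

text \<open>Multiplication by 1 - y X cancels the factor of y in the generating function.\<close>

lemma hc_Suc_add: "hc (Suc d) (add_mset y M) = hc (Suc d) M + y * hc d (add_mset y M)"
proof -
  let ?P = "\<Prod>y\<in>#M. geom y" and ?Q = "\<Prod>y\<in>#add_mset y M. geom y"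
  have "?Q * (1 - fps_const y * fps_X) = ?P * (geom y * (1 - fps_const y * fps_X))"
    by (simp add: algebra_simps)
  then have "?P = ?Q - fps_const y * (fps_X * ?Q)"
    unfolding geom_mult by (simp add: algebra_simps)
  then have "fps_nth ?P (Suc d) = fps_nth ?Q (Suc d) - y * fps_nth ?Q d"
    by (metis fps_mult_left_const_nth fps_sub_nth fps_X_mult_nth nat.distinct(1) diff_Suc_1)
  then show ?thesis by (simp add: hc_def)
qed

lemma hc_single [simp]: "hc d {#y#} = y ^ d"
  by (induction d) (simp_all add: hc_Suc_add)

text \<open>Expand h_{d+1} of a, b and M once at a and once at b, and equate the results. This is
  the recurrence of divided differences.\<close>

lemma hc_diff:
  "hc (Suc d) (add_mset a M) - hc (Suc d) (add_mset b M) = (a - b) * hc d (add_mset a (add_mset b M))"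
  using hc_Suc_add[of d a "add_mset b M"] hc_Suc_add[of d b "add_mset a M"]
  by (simp add: algebra_simps add_mset_commute)

lemma fps_deriv_geom: "fps_deriv (geom y) = fps_const y * (geom y * geom y)"
proof -
  let ?u = "1 - fps_const y * fps_X"
  have "0 = fps_deriv (geom y * ?u)" by (simp only: geom_mult fps_deriv_1)
  also have "\<dots> = fps_deriv (geom y) * ?u - fps_const y * geom y"
    by (simp add: algebra_simps)
  finally have "fps_deriv (geom y) * ?u = fps_const y * geom y" by simp
  then have "geom y * (fps_deriv (geom y) * ?u) = geom y * (fps_const y * geom y)" by simp
  then have "fps_deriv (geom y) * (geom y * ?u) = fps_const y * (geom y * geom y)"
    by (simp only: ac_simps)
  then show ?thesis unfolding geom_mult by simp
qed

text \<open>Differentiate the generating function in its own variable X: the logarithmic derivative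
  of 1 / (1 - y X) is y / (1 - y X). Since h_d with y repeated once more is the derivative of
  h_{d+1} by the indeterminate y, this is Euler's identity for a homogeneous polynomial.\<close>

lemma hc_Euler: "of_nat (Suc d) * hc (Suc d) M = (\<Sum>y\<in>#M. y * hc d (add_mset y M))"
proof -
  have "fps_deriv (\<Prod>y\<in>#M. geom y) = (\<Sum>y\<in>#M. fps_const y * geom y) * (\<Prod>y\<in>#M. geom y)"
    by (induction M) (simp_all add: fps_deriv_geom algebra_simps)
  also have "\<dots> = (\<Sum>y\<in>#M. fps_const y * (\<Prod>y\<in>#add_mset y M. geom y))"
    by (simp add: sum_mset_distrib_right mult.assoc)
  finally have "fps_nth (fps_deriv (\<Prod>y\<in>#M. geom y)) d
      = fps_nth (\<Sum>y\<in>#M. fps_const y * (\<Prod>y\<in>#add_mset y M. geom y)) d" by simp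
  also have "fps_nth (\<Sum>y\<in>#N. fps_const y * (\<Prod>y\<in>#add_mset y M. geom y)) d
      = (\<Sum>y\<in>#N. y * hc d (add_mset y M))" for N
    by (induction N) (simp_all add: hc_def)
  finally show ?thesis by (simp add: hc_def)
qed

text \<open>\<open>dd N M\<close> is the divided difference of \<open>u\<^sup>N\<close> at the nodes \<open>M\<close>.\<close>

definition dd :: "nat \<Rightarrow> 'a::comm_ring_1 multiset \<Rightarrow> 'a" where
  "dd N M = (if size M \<le> N + 1 then hc (N + 1 - size M) M else 0)"

lemma dd_diff:
  "dd N (add_mset a M) - dd N (add_mset b M) = (a - b) * dd N (add_mset a (add_mset b M))"
proof (cases "size M < N")
  case True
  then have "N - size M = Suc (N - Suc (size M))" by simp
  then show ?thesis using True hc_diff[of "N - Suc (size M)" a M b]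
    by (simp add: dd_def)
qed (simp add: dd_def)

lemma dd_Suc: "dd (Suc N) (add_mset a M) = dd N M + a * dd N (add_mset a M)"
proof (cases "size M \<le> N")
  case True
  then have "Suc N - size M = Suc (N - size M)" by simp
  then show ?thesis using True hc_Suc_add[of "N - size M" a M]
    by (simp add: dd_def)
qed (auto simp: dd_def not_le Suc_le_eq le_Suc_eq)

lemma dd_Euler: "of_nat (N + 1 - size M) * dd N M = (\<Sum>y\<in>#M. y * dd N (add_mset y M))"
proof (cases "size M \<le> N")
  case True
  then have "N + 1 - size M = Suc (N - size M)" by simp
  then show ?thesis using True hc_Euler[of "N - size M" M]
    by (simp add: dd_def)
qed (auto simp: dd_def)

lemma dd_eq_1: "size M = N + 1 \<Longrightarrow> dd N M = 1"
  by (simp add: dd_def)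

lemma dd_single: "dd N {#a#} = a ^ N"
  by (simp add: dd_def)

text \<open>By \<open>dd_Suc\<close>, modulo a, deleting one node a amounts to lowering the exponent
  by one. This describes what setting x_j = 0 does to the generators.\<close>

lemma dd_replicate:
  assumes "k \<le> N"
  shows "\<exists>g. dd N (replicate_mset k a + M) = dd (N - k) M + a * g"
  using assms
proof (induction k arbitrary: N)
  case 0 then show ?case by (auto intro!: exI[of _ 0])
next
  case (Suc k)
  then obtain N' where N': "N = Suc N'" by (cases N) auto
  obtain g where g: "dd N' (replicate_mset k a + M) = dd (N' - k) M + a * g"
    using Suc.IH[of N'] Suc.prems N' by auto
  show ?case
    using dd_Suc[of N' a "replicate_mset k a + M"] g N'
    by (intro exI[of _ "g + dd N' (add_mset a (replicate_mset k a + M))"]) (simp add: algebra_simps)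
qed

lemma hc_homog: "(\<And>y. y \<in># M \<Longrightarrow> y \<in> homog 1) \<Longrightarrow> hc d M \<in> homog d"
proof (induction M arbitrary: d)
  case empty then show ?case by (cases d) auto
next
  case (add y M)
  show ?case
  proof (induction d)
    case (Suc d)
    have "y * hc d (add_mset y M) \<in> homog (1 + d)"
      using add.prems Suc by (intro homog_mult) auto
    then show ?case using add by (auto simp: hc_Suc_add)
  qed simp
qed

lemma dd_homog: "(\<And>y. y \<in># M \<Longrightarrow> y \<in> homog 1) \<Longrightarrow> dd N M \<in> homog (N + 1 - size M)"
  by (simp add: dd_def hc_homog)

section \<open>The generators attached to a subset\<close>

text \<open>The node set at position k. In its use j is the minimum of V, lies outside B, and k is
  at least j; so x_j itself is counted by l only.\<close>

definition nodes :: "nat \<Rightarrow> nat \<Rightarrow> nat set \<Rightarrow> nat set \<Rightarrow> nat \<Rightarrow> cpoly multiset" where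
  "nodes l j B V k = replicate_mset l (var j) + image_mset var (mset_set {v\<in>V. k < v \<or> v \<in> B})"

lemma nodes_Suc [simp]: "nodes (Suc l) j B V k = add_mset (var j) (nodes l j B V k)"
  by (simp add: nodes_def)

lemma nodes_cong:
  "{v\<in>V. k < v \<or> v \<in> B} = {v\<in>V'. k' < v \<or> v \<in> B'} \<Longrightarrow> nodes l j B V k = nodes l j B' V' k'"
  by (simp add: nodes_def)

lemma nodes_remove:
  assumes "finite V" "c \<in> V" "k < c \<or> c \<in> B"
  shows "nodes l j B V k = add_mset (var c) (nodes l j (B - {c}) (V - {c}) k)"
proof -
  have "{v\<in>V. k < v \<or> v \<in> B} = insert c {v\<in>V - {c}. k < v \<or> v \<in> B - {c}}"
    using assms by auto
  then show ?thesis using assms by (simp add: nodes_def)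
qed

lemma nodes_remove':
  assumes "finite V" "c \<in> V" "k < c" "c \<notin> B"
  shows "nodes l j B V k = add_mset (var c) (nodes l j B (V - {c}) k)"
  using nodes_remove[of V c k B l j] assms by simp

lemma nodes_step_in:
  assumes "finite V" "Suc k \<in> V" "Suc k \<notin> B"
  shows "nodes l j B V k = add_mset (var (Suc k)) (nodes l j B V (Suc k))"
proof -
  have "{v\<in>V. k < v \<or> v \<in> B} = insert (Suc k) {v\<in>V. Suc k < v \<or> v \<in> B}"
    using assms by auto
  then show ?thesis using assms by (simp add: nodes_def)
qed

lemma nodes_step_out:
  assumes "Suc k \<notin> V \<or> Suc k \<in> B"
  shows "nodes l j B V (Suc k) = nodes l j B V k"
  using assms by (intro nodes_cong) (metis Suc_lessD Suc_lessI)

lemma dd_mod: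
  assumes "hideal n I" "a - b \<in> I"
  shows "dd N (add_mset a M) \<in> I \<longleftrightarrow> dd N (add_mset b M) \<in> I"
  by (rule hideal_cong[OF assms(1)]) (simp add: dd_diff hideal_mult_right[OF assms(1,2)])

text \<open>By the recurrence, a node b can be traded for a as soon as the divided difference with
  both nodes is available.\<close>

lemma dd_exchange:
  assumes I: "hideal n I" and "dd N (add_mset b M) \<in> I" "dd N (add_mset a (add_mset b M)) \<in> I"
  shows "dd N (add_mset a M) \<in> I"
proof -
  have "dd N (add_mset a M) - dd N (add_mset b M) \<in> I"
    unfolding dd_diff using assms by (intro hideal_mult)
  then show ?thesis using hideal_cong[OF I] assms(2) by blast
qed

text \<open>The recurrence exhibits a - b as a factor of the difference. Every degree drop comes
  from here, except the one caused by x_j.\<close>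

lemma dd_colon:
  assumes I: "hideal n I" and "dd N (add_mset a M) \<in> I" "dd N (add_mset b M) \<in> I"
  shows "dd N (add_mset a (add_mset b M)) \<in> colon I (a - b)"
  unfolding colon_def using hideal_diff[OF I assms(2,3)] by (simp add: dd_diff)

text \<open>\<open>V\<close> is the set of the surviving indeterminates, the smallest of which, \<open>x\<^sub>j\<close>, has collected
  some multiplicity \<open>l\<close> on the way. The positions in \<open>D\<close> are those whose generator has already been
  divided by a linear form.\<close>

definition state :: "nat \<Rightarrow> nat \<Rightarrow> nat \<Rightarrow> nat set \<Rightarrow> nat set \<Rightarrow> nat set \<Rightarrow> cpoly set \<Rightarrow> bool" where
  "state N l j B V D I \<longleftrightarrow>
     (\<forall>k\<in>V - B. dd N (nodes (if k \<in> D then Suc (Suc l) else Suc l) j B V k) \<in> I) \<and>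
     (\<forall>t\<in>B. dd N (add_mset (var t) (nodes (if t \<in> D then Suc l else l) j B V t)) \<in> I)"

lemma state_q: "state N l j B V D I \<Longrightarrow> k \<in> V \<Longrightarrow> k \<notin> B \<Longrightarrow> k \<notin> D \<Longrightarrow> dd N (nodes (Suc l) j B V k) \<in> I"
  and state_q': "state N l j B V D I \<Longrightarrow> k \<in> V \<Longrightarrow> k \<notin> B \<Longrightarrow> k \<in> D \<Longrightarrow> dd N (nodes (Suc (Suc l)) j B V k) \<in> I"
  and state_r: "state N l j B V D I \<Longrightarrow> t \<in> B \<Longrightarrow> t \<notin> D \<Longrightarrow> dd N (add_mset (var t) (nodes l j B V t)) \<in> I"
  and state_r': "state N l j B V D I \<Longrightarrow> t \<in> B \<Longrightarrow> t \<in> D \<Longrightarrow> dd N (add_mset (var t) (nodes (Suc l) j B V t)) \<in> I"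
  unfolding state_def by (metis DiffI)+

lemma stateI:
  assumes "\<And>k. k \<in> V \<Longrightarrow> k \<notin> B \<Longrightarrow> k \<notin> D \<Longrightarrow> dd N (nodes (Suc l) j B V k) \<in> I"
    and "\<And>k. k \<in> V \<Longrightarrow> k \<notin> B \<Longrightarrow> k \<in> D \<Longrightarrow> dd N (nodes (Suc (Suc l)) j B V k) \<in> I"
    and "\<And>t. t \<in> B \<Longrightarrow> t \<notin> D \<Longrightarrow> dd N (add_mset (var t) (nodes l j B V t)) \<in> I"
    and "\<And>t. t \<in> B \<Longrightarrow> t \<in> D \<Longrightarrow> dd N (add_mset (var t) (nodes (Suc l) j B V t)) \<in> I"
  shows "state N l j B V D I"
  unfolding state_def using assms by simp

lemma state_insert_q:
  assumes "state N l j B V D I" "I \<subseteq> I'" "dd N (nodes (Suc (Suc l)) j B V k) \<in> I'" "k \<notin> B"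
  shows "state N l j B V (insert k D) I'"
  using assms(2,3,4) by (intro stateI) (metis assms(1) insert_iff state_q state_q' state_r state_r' subsetD)+

lemma state_insert_r:
  assumes "state N l j B V D I" "I \<subseteq> I'" "dd N (add_mset (var t) (nodes (Suc l) j B V t)) \<in> I'" "t \<in> B"
  shows "state N l j B V (insert t D) I'"
  using assms(2,3,4) by (intro stateI) (metis assms(1) insert_iff state_q state_q' state_r state_r' subsetD)+

text \<open>Having divided every position once is the same as having one more copy of x_j and no
  position divided. This is how a finished round of divisions becomes the start of the next.\<close>

lemma state_V: "B \<subseteq> V \<Longrightarrow> state N l j B V V I \<longleftrightarrow> state N (Suc l) j B V {} I"
  by (auto simp: state_def)

text \<open>The generator at position j has l + card V nodes; the size condition says that its
  degree N + 1 - l - card V is computed without truncation.\<close>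

locale config =
  fixes V :: "nat set" and l N :: nat and B :: "nat set" and j :: nat
  assumes finV: "finite V" and jV: "j \<in> V" and j_le: "\<And>v. v \<in> V \<Longrightarrow> j \<le> v"
    and BV: "B \<subseteq> V - {j}" and size: "l + card V \<le> N + 1"
begin

lemma finB: "finite B"
  using finite_subset[OF BV] finV by simp

lemma card_pos: "0 < card V"
  using finV jV by (auto simp: card_gt_0_iff)

text \<open>The node set does not change when k passes an index outside V - B, so the generator of
  the last position of V - B is inherited. The condition on D means that no position of V - B has
  been divided yet.\<close>

lemma dd_nodes_in:
  assumes st: "state N l j B V D I" "D \<subseteq> B" and k: "j \<le> k"
  shows "dd N (nodes (Suc l) j B V k) \<in> I"
  using k
proof (induction k rule: dec_induct)
  case base
  have "j \<notin> B" "j \<notin> D" using BV st by auto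
  then show ?case by (rule state_q[OF st(1) jV])
next
  case (step k)
  show ?case
  proof (cases "Suc k \<in> V - B")
    case True
    then show ?thesis using st by (intro state_q[OF st(1)]) auto
  next
    case False
    then show ?thesis using step.IH nodes_step_out[of k V B "Suc l" j] by auto
  qed
qed

subsection \<open>Dividing by a difference with an index of \<open>B\<close>\<close>

text \<open>At c the divided difference is available with the extra node x_c and, by inheritance,
  with x_j in its place; their difference yields the quotient by x_j - x_c. Modulo x_j - x_c, the
  node x_c, which is present at every position, becomes another x_j: c leaves V and B, and l rises
  by one everywhere.\<close>

lemma divide_in_B:
  assumes I: "hideal n I" and st: "state N l j B V D I" "D \<subseteq> B" and c: "c \<in> B" "c \<notin> D"
  shows "state N l j B V (insert c D) (colon I (var j - var c))"
    and "state N (Suc l) j (B - {c}) (V - {c}) D (adjoin I (var j - var c))"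
    and "config (V - {c}) (Suc l) N (B - {c}) j"
proof -
  let ?I = "adjoin I (var j - var c)"
  have cV: "c \<in> V" "c \<noteq> j" "j < c" using c BV j_le[of c] by auto
  have "dd N (add_mset (var j) (nodes l j B V c)) \<in> I"
    using dd_nodes_in[OF st, of c] cV by simp
  moreover have "dd N (add_mset (var c) (nodes l j B V c)) \<in> I"
    by (rule state_r[OF st(1) c])
  ultimately have "dd N (add_mset (var j) (add_mset (var c) (nodes l j B V c)))
      \<in> colon I (var j - var c)"
    by (rule dd_colon[OF I])
  then have "dd N (add_mset (var c) (nodes (Suc l) j B V c)) \<in> colon I (var j - var c)"
    by (simp add: add_mset_commute)
  then show "state N l j B V (insert c D) (colon I (var j - var c))"
    by (rule state_insert_r[OF st(1) subset_colon[OF I] _ c(1)])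
  have I': "hideal n ?I" using I by (rule hideal_adjoin[of _ _ _ 1]) (auto intro: homog_diff)
  have l: "var c - var j \<in> ?I"
    using hideal_uminus[OF I' in_adjoin[OF I, of "var j - var c" 1]] by simp
  have sub: "I \<subseteq> ?I" by (rule subset_adjoin)
  have *: "dd N (nodes (Suc m) j (B - {c}) (V - {c}) k + M) \<in> ?I"
    if "dd N (nodes m j B V k + M) \<in> I" for m k M
    using that sub dd_mod[OF I' l, of N "nodes m j (B - {c}) (V - {c}) k + M"]
      nodes_remove[OF finV cV(1), of k B m j] c(1) by auto
  show "state N (Suc l) j (B - {c}) (V - {c}) D ?I"
    using *[of "Suc l" _ "{#}"] *[of "Suc l" t "{#var t#}" for t] *[of l t "{#var t#}" for t]
      state_q[OF st(1)] state_r[OF st(1)] state_r'[OF st(1)] st(2)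
    by (intro stateI) auto
  show "config (V - {c}) (Suc l) N (B - {c}) j"
    using finV jV j_le BV size cV card_pos by unfold_locales (auto simp: card_Diff_singleton)
qed

subsection \<open>Dividing by \<open>x\<^sub>j\<close>\<close>

lemma nodes_all_B:
  assumes "\<And>v. v \<in> V - B \<Longrightarrow> v \<le> k"
  shows "nodes m j B V k = replicate_mset m (var j) + image_mset var (mset_set B)"
proof -
  have "{v\<in>V. k < v \<or> v \<in> B} = B" using assms BV by force
  then show ?thesis by (simp add: nodes_def)
qed

text \<open>The extra node x_t is carried from position t past later elements of V - B by
  \<open>dd_exchange\<close>. The aim is a position beyond all of V - B, where Euler's identity
  applies.\<close>

lemma dd_nodes_B_in:
  assumes I: "hideal n I" and st: "state N l j B V B I" and t: "t \<in> B" "t \<le> k"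
  shows "dd N (add_mset (var t) (nodes (Suc l) j B V k)) \<in> I"
  using t(2)
proof (induction k rule: dec_induct)
  case base
  then show ?case using st t by (intro state_r'[OF st]) auto
next
  case (step k)
  have jt: "j \<le> t" using j_le[of t] t BV by auto
  show ?case
  proof (cases "Suc k \<in> V - B")
    case True
    then have eq: "nodes (Suc l) j B V k = add_mset (var (Suc k)) (nodes (Suc l) j B V (Suc k))"
      using nodes_step_in[OF finV] by blast
    show ?thesis
    proof (rule dd_exchange[OF I])
      show "dd N (add_mset (var (Suc k)) (nodes (Suc l) j B V (Suc k))) \<in> I"
        unfolding eq[symmetric] using step.hyps jt by (intro dd_nodes_in[OF st order.refl]) simp
      show "dd N (add_mset (var t) (add_mset (var (Suc k)) (nodes (Suc l) j B V (Suc k)))) \<in> I"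
        using step.IH unfolding eq .
    qed
  next
    case False
    then show ?thesis using step.IH nodes_step_out[of k V B "Suc l" j] by auto
  qed
qed

text \<open>Beyond V - B the nodes are l + 1 copies of x_j and the elements of B. Euler's identity
  writes a multiple of the generator as (l + 1) x_j times the wanted one plus terms for t in B,
  which lie in I because B is divided. The factor l + 1 is invertible over the complex
  numbers.\<close>

lemma divide_var_colon:
  assumes I: "hideal n I" and st: "state N l j B V B I"
  defines "z \<equiv> Max (V - B)"
  shows "state N l j B V (insert z B) (colon I (var j))"
proof -
  have ne: "V - B \<noteq> {}" "finite (V - B)" using jV BV finV by auto
  have z: "z \<in> V - B" using Max_in[OF ne(2,1)] by (simp add: z_def)
  have z_ge: "v \<le> z" if "v \<in> V - B" for v
    using Max_ge[OF ne(2) that] by (simp add: z_def)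
  \<comment> \<open>An element of B may exceed z, so the terms for t in B are collected at the
    maximum of V; the nodes there are the same as at z.\<close>
  define K where "K = Max V"
  have K: "v \<le> K" if "v \<in> V" for v using finV that by (simp add: K_def)
  let ?M = "replicate_mset (Suc l) (var j) + image_mset var (mset_set B)"
  have eq: "nodes (Suc l) j B V z = ?M" "nodes (Suc l) j B V K = ?M"
    using z_ge K by (auto intro!: nodes_all_B)
  have q: "dd N ?M \<in> I" using dd_nodes_in[OF st order.refl, of z] j_le z eq by auto
  have E: "dd N (add_mset (var t) ?M) \<in> I" if "t \<in> B" for t
    using dd_nodes_B_in[OF I st that, of K] K[of t] that BV eq by auto
  have "(\<Sum>y\<in>#?M. y * dd N (add_mset y ?M)) \<in> I"
    using hideal_mult[OF I q, of "of_nat (N + 1 - size ?M)"] dd_Euler[of N ?M] by simp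
  moreover have "(\<Sum>y\<in>#?M. y * dd N (add_mset y ?M)) =
      of_nat (Suc l) * (var j * dd N (add_mset (var j) ?M))
      + (\<Sum>t\<in>B. var t * dd N (add_mset (var t) ?M))"
    by (simp add: sum_unfold_sum_mset image_mset.compositionality o_def distrib_right)
  moreover have "(\<Sum>t\<in>B. var t * dd N (add_mset (var t) ?M)) \<in> I"
    using E by (intro hideal_sum[OF I] hideal_mult[OF I])
  ultimately have "of_nat (Suc l) * (var j * dd N (add_mset (var j) ?M)) \<in> I"
    using hideal_diff[OF I] by fastforce
  then have "var j * dd N (add_mset (var j) ?M) \<in> I"
    using hideal_const_mult_iff[OF I, of "of_nat (Suc l)"] by (simp add: const_of_nat del: of_nat_Suc)
  then have "dd N (nodes (Suc (Suc l)) j B V z) \<in> colon I (var j)"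
    unfolding colon_def nodes_Suc[of "Suc l"] eq by simp
  then show ?thesis
    using z by (intro state_insert_q[OF st subset_colon[OF I]]) auto
qed

text \<open>Setting x_j = 0 removes its l + 1 copies and lowers the exponent by l + 1; the next
  index j' becomes the minimum. If j' belongs to B, it is already a node at every position and
  starts with multiplicity 1, otherwise with 0.\<close>

lemma divide_var_adjoin:
  assumes I: "hideal n I" and st: "state N l j B V B I" and ne: "V - {j} \<noteq> {}" and pos: "l + card V \<le> N"
  defines "j' \<equiv> Min (V - {j})"
  shows "state (N - Suc l) (of_bool (j' \<in> B)) j' (B - {j'}) (V - {j}) {} (adjoin I (var j))"
    and "config (V - {j}) (of_bool (j' \<in> B)) (N - Suc l) (B - {j'}) j'"
proof -
  let ?I = "adjoin I (var j)" and ?N = "N - Suc l"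
  have j': "j' \<in> V" "j' \<noteq> j" "j < j'"
    using Min_in[OF _ ne] finV j_le[of j'] by (auto simp: j'_def)
  have j'_le: "j' \<le> v" if "v \<in> V" "v \<noteq> j" for v
    using finV that by (simp add: j'_def)
  have "card V \<ge> 2" using ne jV finV
    by (metis Suc_1 Suc_leI card_0_eq card_Diff_singleton card_gt_0_iff finite_Diff neq0_conv zero_less_diff)
  then have lN: "Suc l \<le> N" using pos by simp
  have I': "hideal n ?I" using I by (rule hideal_adjoin[of _ _ _ 1]) simp
  have xj: "var j * g \<in> ?I" for g using in_adjoin[OF I] .
  have sub: "I \<subseteq> ?I" by (rule subset_adjoin)
  define R where "R k = image_mset var (mset_set {v\<in>V. k < v \<or> v \<in> B})" for k
  have red: "dd ?N M \<in> ?I" if M: "dd N (replicate_mset (Suc l) (var j) + M) \<in> I" for M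
  proof -
    obtain g where "dd N (replicate_mset (Suc l) (var j) + M) = dd ?N M + var j * g"
      using dd_replicate[OF lN] by blast
    then have "dd ?N M + var j * g \<in> ?I" using M sub by auto
    then show ?thesis using hideal_diff[OF I' _ xj[of g]] by fastforce
  qed
  have q: "dd ?N (R k) \<in> ?I" if "j \<le> k" for k
    using red[of "R k"] dd_nodes_in[OF st order.refl that] by (simp add: nodes_def R_def)
  have r: "dd ?N (add_mset (var t) (R t)) \<in> ?I" if "t \<in> B" for t
    using red[of "add_mset (var t) (R t)"] state_r'[OF st that that] by (simp add: nodes_def R_def)
  have R_in: "R k = add_mset (var (Suc k)) (R (Suc k))" if "Suc k \<in> V - B" for k
    using nodes_step_in[OF finV, of k B 0 j] that by (simp add: nodes_def R_def)
  have R_out: "R (Suc k) = R k" if "Suc k \<notin> V - B" for k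
    using nodes_step_out[of k V B 0 j] that by (simp add: nodes_def R_def)
  have q': "dd ?N (add_mset (var j') (R k)) \<in> ?I" if "j' \<le> k" for k
    using that
  proof (induction k rule: dec_induct)
    case base
    show ?case
    proof (cases "j' \<in> B")
      case False
      then show ?thesis using R_in[of "j' - 1"] q[of "j' - 1"] j' by auto
    qed (rule r)
  next
    case (step k)
    show ?case
    proof (cases "Suc k \<in> V - B")
      case True
      show ?thesis
      proof (rule dd_exchange[OF I'])
        show "dd ?N (add_mset (var (Suc k)) (R (Suc k))) \<in> ?I"
          unfolding R_in[OF True, symmetric] using step.hyps j' by (intro q) simp
        show "dd ?N (add_mset (var j') (add_mset (var (Suc k)) (R (Suc k)))) \<in> ?I"
          using step.IH unfolding R_in[OF True] .
      qed
    next
      case False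
      then show ?thesis using step.IH R_out[of k] by auto
    qed
  qed
  have nd: "nodes (of_bool (j' \<in> B)) j' (B - {j'}) (V - {j}) k = R k" if k: "j' \<le> k" for k
  proof (cases "j' \<in> B")
    case True
    then have "{v\<in>V. k < v \<or> v \<in> B} = insert j' {v\<in>V - {j}. k < v \<or> v \<in> B - {j'}}"
      using j' k BV by auto
    then show ?thesis using True finV k by (simp add: nodes_def R_def)
  next
    case False
    then have "{v\<in>V. k < v \<or> v \<in> B} = {v\<in>V - {j}. k < v \<or> v \<in> B - {j'}}"
      using j' k BV by auto
    then show ?thesis using False by (simp add: nodes_def R_def)
  qed
  show "state ?N (of_bool (j' \<in> B)) j' (B - {j'}) (V - {j}) {} ?I"
  proof (rule stateI)
    fix k assume "k \<in> V - {j}"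
    then have "j' \<le> k" using j'_le by auto
    then show "dd ?N (nodes (Suc (of_bool (j' \<in> B))) j' (B - {j'}) (V - {j}) k) \<in> ?I"
      using q' by (simp only: nodes_Suc nd)
  next
    fix t assume t: "t \<in> B - {j'}"
    then have "j' \<le> t" using j'_le BV by auto
    then show "dd ?N (add_mset (var t) (nodes (of_bool (j' \<in> B)) j' (B - {j'}) (V - {j}) t)) \<in> ?I"
      using r t by (simp only: nd) auto
  qed auto
  show "config (V - {j}) (of_bool (j' \<in> B)) ?N (B - {j'}) j'"
    using finV j' j'_le BV size pos lN \<open>card V \<ge> 2\<close> jV
    by unfold_locales (auto simp: card_Diff_singleton)
qed

subsection \<open>Dividing by the other differences\<close>

text \<open>Division by x_j - x_c acts on the generator at k0, the predecessor of c in V - B. Its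
  nodes are those at c together with x_c, whereas the divided generator at c has x_j in this place.
  Modulo x_j - x_c, positions below c see x_c turn into x_j, while positions beyond c have gained an
  x_j by being divided. All of them fit multiplicity l + 1, and only the elements of B below c still
  count as divided.\<close>

lemma divide_not_in_B:
  assumes I: "hideal n I" and c: "c \<in> V - B" "c \<noteq> j"
    and D: "D = B \<union> {k\<in>V - B. c \<le> k}"
    and st: "state N l j B V D I"
  defines "k0 \<equiv> Max {k\<in>V - B. k < c}"
  shows "state N l j B V (insert k0 D) (colon I (var j - var c))"
    and "state N (Suc l) j B (V - {c}) {t\<in>B. t < c} (adjoin I (var j - var c))"
    and "config (V - {c}) (Suc l) N B j"
    and "k0 \<in> V - B" "k0 < c" "\<And>k. k \<in> V - B \<Longrightarrow> k < c \<longleftrightarrow> k \<le> k0"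
proof -
  let ?I = "adjoin I (var j - var c)"
  have cV: "c \<in> V" "c \<noteq> j" "j < c" "c \<notin> B" using c BV j_le[of c] by auto
  have fin: "finite {k\<in>V - B. k < c}" "{k\<in>V - B. k < c} \<noteq> {}"
    using finV cV jV BV by auto
  show k0: "k0 \<in> V - B" "k0 < c" using Max_in[OF fin] by (auto simp: k0_def)
  show k0': "k < c \<longleftrightarrow> k \<le> k0" if "k \<in> V - B" for k
    using Max_ge[OF fin(1), of k] that k0 by (auto simp: k0_def)
  have "{v\<in>V. k0 < v \<or> v \<in> B} = insert c {v\<in>V. c < v \<or> v \<in> B}"
    using k0 k0' cV by (force simp: not_less)
  then have nd: "nodes m j B V k0 = add_mset (var c) (nodes m j B V c)" for m
    using finV cV by (simp add: nodes_def)
  have "dd N (add_mset (var j) (nodes (Suc l) j B V c)) \<in> I"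
    using state_q'[OF st, of c] c D by simp
  moreover have "dd N (add_mset (var c) (nodes (Suc l) j B V c)) \<in> I"
    unfolding nd[symmetric] using k0 D by (intro state_q[OF st]) auto
  ultimately have "dd N (add_mset (var j) (add_mset (var c) (nodes (Suc l) j B V c)))
      \<in> colon I (var j - var c)"
    by (rule dd_colon[OF I])
  then have "dd N (nodes (Suc (Suc l)) j B V k0) \<in> colon I (var j - var c)"
    unfolding nd[of "Suc (Suc l)"] by (simp add: add_mset_commute)
  then show "state N l j B V (insert k0 D) (colon I (var j - var c))"
    using k0 by (intro state_insert_q[OF st subset_colon[OF I]]) auto
  have I': "hideal n ?I" using I by (rule hideal_adjoin[of _ _ _ 1]) (auto intro: homog_diff)
  have l: "var c - var j \<in> ?I"
    using hideal_uminus[OF I' in_adjoin[OF I, of "var j - var c" 1]] by simp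
  have sub: "I \<subseteq> ?I" by (rule subset_adjoin)
  have low: "dd N (nodes (Suc m) j B (V - {c}) k + M) \<in> ?I"
    if "dd N (nodes m j B V k + M) \<in> I" "k < c" for m k M
    using that sub dd_mod[OF I' l, of N "nodes m j B (V - {c}) k + M"]
      nodes_remove'[OF finV cV(1), of k B m j] cV by auto
  have high: "nodes m j B (V - {c}) k = nodes m j B V k" if "c < k" for m k
    using that cV by (intro nodes_cong) auto
  show "state N (Suc l) j B (V - {c}) {t\<in>B. t < c} ?I"
  proof (rule stateI)
    fix k assume k: "k \<in> V - {c}" "k \<notin> B"
    show "dd N (nodes (Suc (Suc l)) j B (V - {c}) k) \<in> ?I"
    proof (cases "k < c")
      case True
      then have "dd N (nodes (Suc l) j B V k + {#}) \<in> I"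
        using state_q[OF st, of k] k D by auto
      from low[OF this True] show ?thesis by simp
    next
      case False
      then have "c < k" "k \<in> D" using k D by auto
      then show ?thesis using high[of k] state_q'[OF st, of k] k sub by auto
    qed
  next
    fix t assume t: "t \<in> B" "t \<notin> {t\<in>B. t < c}"
    then have "c < t" using cV by (cases "t = c") auto
    then show "dd N (add_mset (var t) (nodes (Suc l) j B (V - {c}) t)) \<in> ?I"
      using high[of t] state_r'[OF st, of t] t D sub by auto
  next
    fix t assume t: "t \<in> B" "t \<in> {t\<in>B. t < c}"
    then have "dd N (nodes (Suc l) j B V t + {#var t#}) \<in> I"
      using state_r'[OF st, of t] D by simp
    from low[OF this] t
    show "dd N (add_mset (var t) (nodes (Suc (Suc l)) j B (V - {c}) t)) \<in> ?I" by simp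
  qed auto
  show "config (V - {c}) (Suc l) N B j"
    using finV jV j_le BV size cV card_pos by unfold_locales (auto simp: card_Diff_singleton)
qed

end

section \<open>Spanning monomials\<close>

definition mult_mons :: "(nat \<Rightarrow>\<^sub>0 nat) set \<Rightarrow> nat set \<Rightarrow> nat \<Rightarrow> cpoly set" where
  "mult_mons A V d = {mon (a + b) | a b. a \<in> A \<and> keys b \<subseteq> V \<and> mdeg (a + b) = d}"

text \<open>Modulo I, and degree by degree, the monomials with exponents in A generate everything as
  a module over the polynomials in V. The set A records the indeterminates below j, which are
  reduced beforehand and stay untouched while V shrinks.\<close>

definition mult_spanned :: "(nat \<Rightarrow>\<^sub>0 nat) set \<Rightarrow> nat set \<Rightarrow> cpoly set \<Rightarrow> bool" where
  "mult_spanned A V I \<longleftrightarrow> (\<forall>m. \<exists>y\<in>cp.span (mult_mons A V (mdeg m)). mon m - y \<in> I)"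

lemma mult_spanned_mono: "mult_spanned A V I \<Longrightarrow> I \<subseteq> I' \<Longrightarrow> mult_spanned A V I'"
  unfolding mult_spanned_def by blast

lemma span_mod:
  assumes I: "hideal n I" and S: "\<And>x. x \<in> S \<Longrightarrow> \<exists>y\<in>cp.span T. x - y \<in> I" and x: "x \<in> cp.span S"
  shows "\<exists>y\<in>cp.span T. x - y \<in> I"
  using x
proof (induction rule: cp.span_induct_alt)
  case base
  then show ?case using hideal_0[OF I] by (intro bexI[of _ 0] cp.span_zero) simp
next
  case (step c x y)
  obtain z where z: "z \<in> cp.span T" "y - z \<in> I" using step by blast
  obtain w where w: "w \<in> cp.span T" "x - w \<in> I" using S step by blast
  have "const c * x + y - (const c * w + z) = const c * (x - w) + (y - z)"
    by (simp add: algebra_simps)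
  also have "\<dots> \<in> I" using z w by (intro hideal_add[OF I] hideal_mult[OF I])
  finally show ?case
    using z w by (intro bexI[of _ "const c * w + z"] cp.span_add cp.span_scale)
qed

lemma mult_spanned_trans:
  assumes I: "hideal n I" and g: "mult_spanned A V I"
    and S: "\<And>a b. a \<in> A \<Longrightarrow> keys b \<subseteq> V \<Longrightarrow>
      \<exists>y\<in>cp.span (mult_mons A' V' (mdeg (a + b))). mon (a + b) - y \<in> I"
  shows "mult_spanned A' V' I"
  unfolding mult_spanned_def
proof
  fix m
  obtain y where y: "y \<in> cp.span (mult_mons A V (mdeg m))" "mon m - y \<in> I"
    using g unfolding mult_spanned_def by blast
  have mult_mons_mod: "\<exists>y\<in>cp.span (mult_mons A' V' (mdeg m)). x - y \<in> I" if x: "x \<in> mult_mons A V (mdeg m)" for x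
  proof -
    obtain a b where ab: "x = mon (a + b)" "a \<in> A" "keys b \<subseteq> V" "mdeg (a + b) = mdeg m"
      using x unfolding mult_mons_def by blast
    show ?thesis using S[OF ab(2,3)] unfolding ab(1,4) .
  qed
  obtain z where z: "z \<in> cp.span (mult_mons A' V' (mdeg m))" "y - z \<in> I"
    using span_mod[OF I mult_mons_mod y(1)] by blast
  have "mon m - z \<in> I" using hideal_add[OF I y(2) z(2)] by simp
  then show "\<exists>y\<in>cp.span (mult_mons A' V' (mdeg m)). mon m - y \<in> I" using z(1) by blast
qed

lemma mult_mons_base: "a \<in> A \<Longrightarrow> keys b \<subseteq> V \<Longrightarrow> mon (a + b) \<in> cp.span (mult_mons A V (mdeg (a + b)))"
  unfolding mult_mons_def by (intro cp.span_base) blast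

lemma mon_single: "mon (single c k) = var c ^ k"
proof (induction k)
  case (Suc k)
  have "single c (Suc k) = single c 1 + single c k"
    by (simp add: single_add[symmetric])
  then show ?case using Suc by (simp add: mon_add) (simp add: var_def)
qed simp

lemma keys_remove: "keys ((b :: nat \<Rightarrow>\<^sub>0 nat) - single c (lookup b c)) = keys b - {c}"
  by (auto simp: in_keys_iff lookup_minus lookup_single when_def split: if_splits)

lemma split_off: "(b :: nat \<Rightarrow>\<^sub>0 nat) = single c (lookup b c) + (b - single c (lookup b c :: nat))"
  by (rule poly_mapping_eqI) (auto simp: lookup_add lookup_minus lookup_single when_def)

lemma hideal_power_diff:
  assumes "hideal n I" "x - y \<in> I"
  shows "x ^ k - y ^ k \<in> I"
proof (induction k)
  case (Suc k)
  have "x ^ Suc k - y ^ Suc k = x ^ k * (x - y) + y * (x ^ k - y ^ k)"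
    by (simp add: algebra_simps)
  then show ?case using Suc assms by (simp only:) (intro hideal_add hideal_mult)
qed (simp add: hideal_0[OF assms(1)])

text \<open>A power of x_c is replaced by the same power of x_j, which preserves degrees and leaves
  A alone.\<close>

lemma mult_spanned_identify:
  assumes I: "hideal n I" and g: "mult_spanned A V I" and j: "j \<in> V" "c \<noteq> j" and l: "var c - var j \<in> I"
  shows "mult_spanned A (V - {c}) I"
proof (rule mult_spanned_trans[OF I g])
  fix a b :: "nat \<Rightarrow>\<^sub>0 nat"
  assume a: "a \<in> A" and b: "keys b \<subseteq> V"
  define k where "k = lookup b c"
  define b' where "b' = b - single c k"
  have bb': "b = single c k + b'" unfolding b'_def k_def by (rule split_off)
  have kb': "keys b' \<subseteq> V - {c}"
    using keys_remove[of b c] b unfolding b'_def k_def by auto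
  let ?b = "single j k + b'"
  have "mon (a + b) - mon (a + ?b) = mon a * mon b' * (var c ^ k - var j ^ k)"
    unfolding bb' by (simp add: mon_add mon_single algebra_simps)
  also have "\<dots> \<in> I" by (intro hideal_mult[OF I] hideal_power_diff[OF I] l)
  finally have 1: "mon (a + b) - mon (a + ?b) \<in> I" .
  have kb: "keys ?b \<subseteq> V - {c}"
    using Poly_Mapping.keys_add[of "single j k" b'] kb' j by (auto split: if_splits)
  have dg: "mdeg (a + ?b) = mdeg (a + b)"
    unfolding bb' by (simp add: mdeg_add)
  show "\<exists>y\<in>cp.span (mult_mons A (V - {c}) (mdeg (a + b))). mon (a + b) - y \<in> I"
    using 1 mult_mons_base[OF a kb] unfolding dg by blast
qed

lemma mult_spanned_kill:
  assumes I: "hideal n I" and g: "mult_spanned A V I" and l: "var c \<in> I"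
  shows "mult_spanned A (V - {c}) I"
proof (rule mult_spanned_trans[OF I g])
  fix a b :: "nat \<Rightarrow>\<^sub>0 nat"
  assume a: "a \<in> A" and b: "keys b \<subseteq> V"
  show "\<exists>y\<in>cp.span (mult_mons A (V - {c}) (mdeg (a + b))). mon (a + b) - y \<in> I"
  proof (cases "lookup b c")
    case 0
    then have "keys b \<subseteq> V - {c}" using b by (auto simp: in_keys_iff)
    moreover have "mon (a + b) - mon (a + b) \<in> I" using hideal_0[OF I] by simp
    ultimately show ?thesis using mult_mons_base[OF a] by blast
  next
    case (Suc k)
    have "mon (a + b) = mon a * mon (b - single c (Suc k)) * var c ^ k * var c"
      using split_off[of b c] Suc by (metis (no_types, opaque_lifting) mon_add mon_single mult.assoc mult.commute power_Suc2)
    also have "\<dots> \<in> I" by (intro hideal_mult[OF I] l)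
    finally have "mon (a + b) - 0 \<in> I" by simp
    then show ?thesis using cp.span_zero by blast
  qed
qed

definition exp_series :: "(nat \<Rightarrow>\<^sub>0 nat) set \<Rightarrow> int fps" where
  "exp_series A = (\<Sum>a\<in>A. fps_X ^ mdeg a)"

lemma exp_series_nth: "finite A \<Longrightarrow> fps_nth (exp_series A) d = int (card {a\<in>A. mdeg a = d})"
proof -
  assume A: "finite A"
  have "fps_nth (exp_series A) d = (\<Sum>a\<in>A. if mdeg a = d then 1 else 0)"
    unfolding exp_series_def fps_sum_nth by (intro sum.cong) auto
  also have "\<dots> = int (card {a\<in>A. mdeg a = d})"
    using A by (subst sum.If_cases) (auto simp: Int_def)
  finally show ?thesis .
qed

lemma exp_series_pos: "0 \<preceq> exp_series A"
  unfolding exp_series_def by (intro fps_le_sum_0 fps_le_X_power)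

lemma hser_mult_spanned_empty:
  assumes I: "hideal n I" and g: "mult_spanned A {} I" and A: "finite A"
  shows "hser I \<preceq> exp_series A"
  unfolding fps_le_def
proof
  fix d
  let ?B = "mon ` {a\<in>A. mdeg a = d}"
  have eq: "mult_mons A {} d = ?B"
    unfolding mult_mons_def by auto
  have "spans I d ?B"
  proof (rule spans_if_mon[OF I])
    show "finite ?B" using A by simp
    show "?B \<subseteq> homog d" by (auto intro: homog_single)
    fix m assume "mdeg m = d"
    then show "\<exists>b\<in>cp.span ?B. mon m - b \<in> I"
      using g unfolding mult_spanned_def eq[symmetric] by blast
  qed
  then have "qdim I d \<le> card ?B" by (rule qdim_le)
  also have "\<dots> \<le> card {a\<in>A. mdeg a = d}" using A by (intro card_image_le) simp
  finally show "fps_nth (hser I) d \<le> fps_nth (exp_series A) d"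
    using exp_series_nth[OF A] by (simp add: hser_def)
qed

section \<open>The upper bound\<close>

definition rank_out :: "nat set \<Rightarrow> nat set \<Rightarrow> nat \<Rightarrow> nat" where
  "rank_out B V x = card {v\<in>V - B. v \<le> x}"

text \<open>Here \<open>e\<close> is the degree of the generator at the smallest position, and the degree at position
  \<open>x\<close> grows with every earlier element outside \<open>B\<close>. For \<open>e > 0\<close> no subtraction truncates.\<close>

definition degree_series :: "nat \<Rightarrow> nat set \<Rightarrow> nat set \<Rightarrow> nat set \<Rightarrow> int fps" where
  "degree_series e B V D = (\<Prod>x\<in>V. q_number (e + rank_out B V x - 1 - of_bool (x \<in> D)))"

lemma degree_series_pos: "0 \<preceq> degree_series e B V D"
  unfolding degree_series_def by (intro fps_le_prod_0 fps_le_q_number)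

lemma bij_betw_rank:
  fixes A :: "nat set"
  assumes A: "finite A"
  shows "bij_betw (\<lambda>x. card {a\<in>A. a \<le> x}) A {1..card A}"
proof -
  let ?r = "\<lambda>x. card {a\<in>A. a \<le> x}"
  have less: "?r x < ?r y" if "x < y" "y \<in> A" for x y
  proof (rule psubset_card_mono)
    have "y \<in> {a\<in>A. a \<le> y}" "y \<notin> {a\<in>A. a \<le> x}" using that by auto
    moreover have "{a\<in>A. a \<le> x} \<subseteq> {a\<in>A. a \<le> y}" using that by auto
    ultimately show "{a\<in>A. a \<le> x} \<subset> {a\<in>A. a \<le> y}" by blast
  qed (use A in simp)
  have "inj_on ?r A"
    by (rule linorder_inj_onI) (use less in \<open>fastforce+\<close>)
  moreover have "?r ` A \<subseteq> {1..card A}"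
  proof (rule image_subsetI)
    fix x assume "x \<in> A"
    then have "{a\<in>A. a \<le> x} \<noteq> {}" by auto
    then have "0 < ?r x" using A by (simp add: card_gt_0_iff)
    moreover have "?r x \<le> card A" using A by (intro card_mono) auto
    ultimately show "?r x \<in> {1..card A}" by simp
  qed
  moreover from calculation have "?r ` A = {1..card A}"
    by (intro card_subset_eq) (simp_all add: card_image)
  ultimately show ?thesis by (simp add: bij_betw_def)
qed

text \<open>The ranks run through 1, ..., card A. Omitting the maximum, or omitting the minimum and
  lowering all ranks by one, leaves 1, ..., card A - 1 in both cases.\<close>

lemma prod_rank_shift:
  fixes A :: "nat set" and g :: "nat \<Rightarrow> 'b::comm_monoid_mult"
  assumes A: "finite A" "A \<noteq> {}"
  shows "(\<Prod>x\<in>A - {Max A}. g (card {a\<in>A. a \<le> x})) = (\<Prod>x\<in>A - {Min A}. g (card {a\<in>A. a \<le> x} - 1))"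
proof -
  let ?r = "\<lambda>x. card {a\<in>A. a \<le> x}"
  have bij: "bij_betw ?r A {1..card A}" using A(1) by (rule bij_betw_rank)
  have pos: "card A > 0" using A by (simp add: card_gt_0_iff)
  have "{a\<in>A. a \<le> Max A} = A" using A by auto
  moreover have sg: "{a\<in>A. a \<le> m} = {m}" if "m \<in> A" "\<And>a. a \<in> A \<Longrightarrow> m \<le> a" for m
    using that by (auto intro: antisym)
  have "{a\<in>A. a \<le> Min A} = {Min A}"
    by (rule sg[OF Min_in[OF A] Min_le[OF A(1)]])
  ultimately have r: "?r (Max A) = card A" "?r (Min A) = 1" by simp_all
  have M: "Max A \<in> A" "Min A \<in> A" using A by auto
  have "bij_betw ?r (A - {Max A}) ({1..card A} - {card A})"
    using bij_betw_DiffI[OF bij, of "{Max A}" "{card A}"] M r(1) pos by (auto simp: bij_betw_def)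
  then have "(\<Prod>x\<in>A - {Max A}. g (?r x)) = (\<Prod>i\<in>{1..card A} - {card A}. g i)"
    by (rule prod.reindex_bij_betw)
  also have "\<dots> = (\<Prod>i\<in>{1..card A} - {1}. g (i - 1))"
    by (rule prod.reindex_bij_witness[of _ "\<lambda>i. i - 1" Suc]) auto
  also have "bij_betw ?r (A - {Min A}) ({1..card A} - {1})"
    using bij_betw_DiffI[OF bij, of "{Min A}" "{1}"] M r(2) pos by (auto simp: bij_betw_def)
  then have "(\<Prod>i\<in>{1..card A} - {1}. g (i - 1)) = (\<Prod>x\<in>A - {Min A}. g (?r x - 1))"
    by (rule prod.reindex_bij_betw[symmetric])
  finally show ?thesis .
qed

context config
begin

lemma rank_out_pos: "x \<in> V \<Longrightarrow> 0 < rank_out B V x"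
proof -
  assume "x \<in> V"
  then have "j \<in> {v\<in>V - B. v \<le> x}" using jV j_le BV by auto
  then show ?thesis using finV unfolding rank_out_def by (subst card_gt_0_iff) auto
qed

text \<open>Apply [m + 1]_q = 1 + q [m]_q to the factor at k0. The term with q corresponds to the
  colon ideal, and \<open>P0\<close> to the enlarged ideal; the next lemmas recognize
  \<open>P0\<close> as the product for a smaller configuration, one for each type of linear
  form.\<close>

lemma degree_series_step:
  assumes "k0 \<in> V" "k0 \<notin> D" "0 < e"
  defines "P0 \<equiv> \<Prod>x\<in>V - {k0}. q_number (e + rank_out B V x - 1 - of_bool (x \<in> D))"
  shows "degree_series e B V D = P0 + fps_X * degree_series e B V (insert k0 D)"
proof -
  have 1: "e + rank_out B V k0 - 1 = Suc (e + rank_out B V k0 - 2)"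
    using rank_out_pos[OF assms(1)] assms(3) by simp
  have "degree_series e B V D = q_number (e + rank_out B V k0 - 1) * P0"
    unfolding degree_series_def P0_def using finV assms by (simp add: prod.remove[of V k0])
  moreover have "degree_series e B V (insert k0 D) = q_number (e + rank_out B V k0 - 2) * P0"
  proof -
    have "(\<Prod>x\<in>V - {k0}. q_number (e + rank_out B V x - 1 - of_bool (x \<in> insert k0 D))) = P0"
      unfolding P0_def by (rule prod.cong) auto
    then show ?thesis
      unfolding degree_series_def using finV assms by (simp add: prod.remove[of V k0] numeral_2_eq_2)
  qed
  ultimately show ?thesis unfolding 1 by (simp add: q_number_Suc algebra_simps)
qed

lemma degree_series_in_B:
  assumes "c \<in> B"
  shows "degree_series e (B - {c}) (V - {c}) D = (\<Prod>x\<in>V - {c}. q_number (e + rank_out B V x - 1 - of_bool (x \<in> D)))"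
proof -
  have "V - {c} - (B - {c}) = V - B" using assms by auto
  then show ?thesis unfolding degree_series_def rank_out_def by simp
qed

text \<open>One side omits j, the other z. Outside B this is \<open>prod_rank_shift\<close>; on B
  the rank lost with j matches the mark of a divided position. When j' leaves B, every rank rises by
  one, which the smaller first argument compensates.\<close>

lemma degree_series_var:
  assumes e: "0 < e" and ne: "V - {j} \<noteq> {}"
  defines "j' \<equiv> Min (V - {j})" and "z \<equiv> Max (V - B)"
  shows "degree_series (e - of_bool (j' \<in> B)) (B - {j'}) (V - {j}) {}
    = (\<Prod>x\<in>V - {z}. q_number (e + rank_out B V x - 1 - of_bool (x \<in> B)))"
proof -
  let ?A = "V - B"
  have A: "finite ?A" "?A \<noteq> {}" using finV jV BV by auto
  have minA: "Min ?A = j" using finV jV BV j_le by (intro Min_eqI) auto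
  have z: "z \<in> ?A" using Max_in[OF A] by (simp add: z_def)
  have j': "j' \<in> V" "j' \<noteq> j"
    using Min_in[OF _ ne] finV by (auto simp: j'_def)
  have rank_out': "rank_out (B - {j'}) (V - {j}) x = rank_out B V x - 1 + of_bool (j' \<in> B)" if "x \<in> V - {j}" for x
  proof -
    have le: "j' \<le> x" "j \<le> x" using that finV j_le by (auto simp: j'_def)
    have f: "finite {v\<in>V - B. v \<le> x}" using finV by simp
    have jm: "j \<in> {v\<in>V - B. v \<le> x}" using le jV BV by auto
    have "{v\<in>V - {j} - (B - {j'}). v \<le> x}
        = (if j' \<in> B then insert j' ({v\<in>V - B. v \<le> x} - {j}) else {v\<in>V - B. v \<le> x} - {j})"
      using le j' by auto
    then show ?thesis using f jm j' unfolding rank_out_def by (auto simp: card_Diff_singleton)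
  qed
  have "degree_series (e - of_bool (j' \<in> B)) (B - {j'}) (V - {j}) {} = (\<Prod>x\<in>V - {j}. q_number (e + rank_out B V x - 2))"
    unfolding degree_series_def
  proof (rule prod.cong[OF refl])
    fix x assume x: "x \<in> V - {j}"
    then have "0 < rank_out B V x" by (intro rank_out_pos) auto
    then have "e - of_bool (j' \<in> B) + rank_out (B - {j'}) (V - {j}) x - 1 - of_bool (x \<in> {}) = e + rank_out B V x - 2"
      unfolding rank_out'[OF x] using e by auto
    then show "q_number (e - of_bool (j' \<in> B) + rank_out (B - {j'}) (V - {j}) x - 1 - of_bool (x \<in> {}))
      = q_number (e + rank_out B V x - 2)" by (rule arg_cong)
  qed
  also have "\<dots> = (\<Prod>x\<in>(?A - {Min ?A}) \<union> B. q_number (e + rank_out B V x - 2))"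
    using minA BV by (intro prod.cong) auto
  also have "(\<Prod>x\<in>(?A - {Min ?A}) \<union> B. q_number (e + rank_out B V x - 2))
      = (\<Prod>x\<in>?A - {Min ?A}. q_number (e + rank_out B V x - 2)) * (\<Prod>x\<in>B. q_number (e + rank_out B V x - 2))"
    using A finB by (intro prod.union_disjoint) auto
  also have "(\<Prod>x\<in>?A - {Min ?A}. q_number (e + rank_out B V x - 2))
      = (\<Prod>x\<in>?A - {Min ?A}. q_number (e - 1 + (rank_out B V x - 1)))"
    using rank_out_pos e by (intro prod.cong arg_cong[of _ _ q_number] refl) force
  also have "\<dots> = (\<Prod>x\<in>?A - {z}. q_number (e - 1 + rank_out B V x))"
    unfolding z_def rank_out_def using prod_rank_shift[OF A, of "\<lambda>i. q_number (e - 1 + i)"] by simp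
  also have "\<dots> * (\<Prod>x\<in>B. q_number (e + rank_out B V x - 2))
      = (\<Prod>x\<in>(?A - {z}) \<union> B. q_number (e + rank_out B V x - 1 - of_bool (x \<in> B)))"
    using A finB e by (subst prod.union_disjoint) (auto intro!: arg_cong2[of _ _ _ _ "(*)"] prod.cong simp: numeral_2_eq_2)
  also have "\<dots> = (\<Prod>x\<in>V - {z}. q_number (e + rank_out B V x - 1 - of_bool (x \<in> B)))"
    using z BV by (intro prod.cong) auto
  finally show ?thesis .
qed

text \<open>The factor of c, with one more rank than k0 and a mark in D, equals the factor of k0
  after c is removed. Beyond c, the rank lost with c replaces the mark in D.\<close>

lemma degree_series_not_in_B:
  assumes e: "0 < e" and c: "c \<in> V - B" and D: "D = B \<union> {k\<in>V - B. c \<le> k}"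
    and k0: "k0 \<in> V - B" "k0 < c" "\<And>k. k \<in> V - B \<Longrightarrow> k < c \<longleftrightarrow> k \<le> k0"
  shows "degree_series e B (V - {c}) {t\<in>B. t < c} = (\<Prod>x\<in>V - {k0}. q_number (e + rank_out B V x - 1 - of_bool (x \<in> D)))"
proof -
  have rank_out': "rank_out B (V - {c}) x = rank_out B V x - of_bool (c \<le> x)" for x
  proof -
    have 1: "{v\<in>V - {c} - B. v \<le> x} = {v\<in>V - B. v \<le> x} - {c}" by auto
    have 2: "c \<in> {v\<in>V - B. v \<le> x} \<longleftrightarrow> c \<le> x" using c by auto
    show ?thesis unfolding rank_out_def 1 card_Diff_singleton_if 2 by simp
  qed
  have nuc: "rank_out B V c = Suc (rank_out B V k0)"
  proof -
    have "{v\<in>V - B. v \<le> c} = insert c {v\<in>V - B. v \<le> k0}"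
      using c k0 by (force simp: le_less)
    then show ?thesis using finV k0(2) unfolding rank_out_def by simp
  qed
  have rest: "(\<Prod>x\<in>V - {c} - {k0}. q_number (e + rank_out B (V - {c}) x - 1 - of_bool (x \<in> {t\<in>B. t < c})))
      = (\<Prod>x\<in>V - {c} - {k0}. q_number (e + rank_out B V x - 1 - of_bool (x \<in> D)))"
  proof (rule prod.cong[OF refl])
    fix x assume x: "x \<in> V - {c} - {k0}"
    have "0 < rank_out B V x" using x by (intro rank_out_pos) auto
    then have "e + rank_out B (V - {c}) x - 1 - of_bool (x \<in> {t\<in>B. t < c}) = e + rank_out B V x - 1 - of_bool (x \<in> D)"
      unfolding rank_out' D using x e c by (cases "x < c") auto
    then show "q_number (e + rank_out B (V - {c}) x - 1 - of_bool (x \<in> {t\<in>B. t < c}))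
      = q_number (e + rank_out B V x - 1 - of_bool (x \<in> D))" by (rule arg_cong)
  qed
  have "degree_series e B (V - {c}) {t\<in>B. t < c} = q_number (e + rank_out B V k0 - 1) *
      (\<Prod>x\<in>V - {c} - {k0}. q_number (e + rank_out B V x - 1 - of_bool (x \<in> D)))"
    unfolding degree_series_def using finV k0 c rest rank_out'[of k0]
    by (subst prod.remove[of "V - {c}" k0]) auto
  also have "V - {c} - {k0} = V - {k0} - {c}" by auto
  also have "q_number (e + rank_out B V k0 - 1) * (\<Prod>x\<in>V - {k0} - {c}. q_number (e + rank_out B V x - 1 - of_bool (x \<in> D)))
      = (\<Prod>x\<in>V - {k0}. q_number (e + rank_out B V x - 1 - of_bool (x \<in> D)))"
    using prod.remove[of "V - {k0}" c "\<lambda>x. q_number (e + rank_out B V x - 1 - of_bool (x \<in> D))"]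
      finV c k0(2) D nuc by auto
  finally show ?thesis .
qed

end

text \<open>All parameters other than V are quantified, because the enlarged ideals over a smaller V
  come with other exponents, multiplicities and minimal indices.\<close>

definition stair_bound :: "nat \<Rightarrow> (nat \<Rightarrow>\<^sub>0 nat) set \<Rightarrow> nat set \<Rightarrow> bool" where
  "stair_bound n A V \<longleftrightarrow> (\<forall>l N B j D I. config V l N B j \<longrightarrow> D \<subseteq> B \<longrightarrow> hideal n I \<longrightarrow> mult_spanned A V I \<longrightarrow>
     state N l j B V D I \<longrightarrow> hser I \<preceq> exp_series A * degree_series (N + 1 - l - card V) B V D)"

lemma stair_boundD:
  assumes "stair_bound n A V" "config V l N B j" "D \<subseteq> B" "hideal n I" "mult_spanned A V I" "state N l j B V D I"
  shows "hser I \<preceq> exp_series A * degree_series (N + 1 - l - card V) B V D"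
  using assms unfolding stair_bound_def by simp

text \<open>The series of the last colon ideal stays an unknown, and
  \<open>h * (P - fps_X ^ m * P')\<close> collects the bounds for the enlarged ideals met on the
  way. In this form the chain can be read from either end.\<close>

lemma descent_step:
  assumes I: "hideal n I" and p: "p \<in> homog 1"
    and adj: "hser (adjoin I p) \<preceq> h * P0" and P: "P = P0 + fps_X * P1"
    and IH: "hser (colon I p) \<preceq> fps_X ^ m * hser (colon (colon I p) F) + h * (P1 - fps_X ^ m * P')"
  shows "hser I \<preceq> fps_X ^ Suc m * hser (colon I (p * F)) + h * (P - fps_X ^ Suc m * P')"
proof -
  have "hser I \<preceq> fps_X * hser (colon I p) + hser (adjoin I p)"
    by (rule hser_colon_adjoin[OF I p])
  also have "\<dots> \<preceq> fps_X * (fps_X ^ m * hser (colon (colon I p) F) + h * (P1 - fps_X ^ m * P')) + h * P0"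
    by (intro fps_le_add fps_le_X_mult IH adj)
  also have "\<dots> = fps_X ^ Suc m * hser (colon I (p * F)) + h * (P - fps_X ^ Suc m * P')"
    unfolding P colon_colon by (simp add: algebra_simps)
  finally show ?thesis .
qed

context config
begin

context
  fixes n A e
  assumes stair_bound: "\<And>V'. card V' < card V \<Longrightarrow> stair_bound n A V'"
    and fA: "finite A"
    and e: "e = N + 1 - l - card V" "0 < e"
begin

lemma diff_homog: "var a - var b \<in> homog 1"
  by (intro homog_diff) auto

text \<open>Division by x_j - x_c moves the lower end of the divided part of V - B from c to its
  predecessor. At c = j every position is divided.\<close>

lemma chain_not_in_B:
  assumes "hideal n I" "mult_spanned A V I" "c \<in> V - B" "D = B \<union> {k\<in>V - B. c \<le> k}" "state N l j B V D I"
  defines "T \<equiv> {k\<in>V - B. j < k \<and> k \<le> c}"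
  shows "hser I \<preceq> fps_X ^ card T * hser (colon I (\<Prod>k\<in>T. var j - var k))
      + exp_series A * (degree_series e B V D - fps_X ^ card T * degree_series e B V V)
    \<and> state N l j B V V (colon I (\<Prod>k\<in>T. var j - var k))"
  using assms(1-5) unfolding T_def
proof (induction c arbitrary: I D rule: less_induct)
  case (less c)
  show ?case
  proof (cases "c = j")
    case True
    then have "D = V" "{k\<in>V - B. j < k \<and> k \<le> c} = {}" using less.prems BV j_le by auto
    then show ?thesis using less.prems by (simp only: card.empty prod.empty colon_1) simp
  next
    case False
    let ?p = "var j - var c"
    let ?T = "\<lambda>c. {k\<in>V - B. j < k \<and> k \<le> c}"
    define k0 where "k0 = Max {k\<in>V - B. k < c}"
    note C = divide_not_in_B[OF less.prems(1,3) False less.prems(4,5), folded k0_def]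
    have Ic: "hideal n (colon I ?p)" "hideal n (adjoin I ?p)"
      using less.prems(1) diff_homog by (blast intro: hideal_colon hideal_adjoin)+
    have D': "insert k0 D = B \<union> {k\<in>V - B. k0 \<le> k}"
    proof -
      have "k0 \<le> k \<longleftrightarrow> k = k0 \<or> c \<le> k" if "k \<in> V - B" for k
        using C(6)[OF that] C(5) by linarith
      then have "{k\<in>V - B. k0 \<le> k} = insert k0 {k\<in>V - B. c \<le> k}"
        using C(4) by blast
      then show ?thesis unfolding less.prems(4) by simp
    qed
    have gc: "mult_spanned A V (colon I ?p)"
      by (rule mult_spanned_mono[OF less.prems(2) subset_colon[OF less.prems(1)]])
    have IH: "hser (colon I ?p) \<preceq> fps_X ^ card (?T k0) * hser (colon (colon I ?p) (\<Prod>k\<in>?T k0. var j - var k))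
      + exp_series A * (degree_series e B V (insert k0 D) - fps_X ^ card (?T k0) * degree_series e B V V)
    \<and> state N l j B V V (colon (colon I ?p) (\<Prod>k\<in>?T k0. var j - var k))"
      by (rule less.IH[OF C(5) Ic(1) gc C(4) D' C(1)])
    have "var c - var j \<in> adjoin I ?p"
      using hideal_uminus[OF Ic(2) in_adjoin[OF less.prems(1), of ?p 1]] by simp
    then have ga: "mult_spanned A (V - {c}) (adjoin I ?p)"
      using mult_spanned_identify[OF Ic(2) mult_spanned_mono[OF less.prems(2) subset_adjoin] jV] False by blast
    have cV: "c \<in> V" using less.prems by auto
    then have "card (V - {c}) < card V" using finV by (intro card_Diff1_less)
    then have "hser (adjoin I ?p) \<preceq> exp_series A * degree_series (N + 1 - Suc l - card (V - {c})) B (V - {c}) {t\<in>B. t < c}"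
      by (intro stair_boundD[OF stair_bound C(3) _ Ic(2) ga C(2)]) auto
    also have "N + 1 - Suc l - card (V - {c}) = e"
      using e cV card_pos finV by (simp add: card_Diff_singleton)
    also have "degree_series e B (V - {c}) {t\<in>B. t < c} = (\<Prod>x\<in>V - {k0}. q_number (e + rank_out B V x - 1 - of_bool (x \<in> D)))"
      by (rule degree_series_not_in_B[OF e(2) less.prems(3,4) C(4-6)])
    finally have adj: "hser (adjoin I ?p) \<preceq> exp_series A * (\<Prod>x\<in>V - {k0}. q_number (e + rank_out B V x - 1 - of_bool (x \<in> D)))" .
    have k0D: "k0 \<in> V" "k0 \<notin> D" using C(4,5) less.prems(4) by auto
    have "j < c" using False cV j_le[of c] by simp
    then have T: "?T c = insert c (?T k0)" "c \<notin> ?T k0"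
      using less.prems(3) C(4-6) by (auto simp: order_le_less)
    then have T': "card (?T c) = Suc (card (?T k0))"
      "(\<Prod>k\<in>?T c. var j - var k) = ?p * (\<Prod>k\<in>?T k0. var j - var k)"
      using finV by simp_all
    show ?thesis
      unfolding T'
      using descent_step[OF less.prems(1) diff_homog adj degree_series_step[OF k0D e(2)] conjunct1[OF IH]] IH
      by (simp add: colon_colon)
  qed
qed

lemma chain_var:
  assumes "hideal n I" "mult_spanned A V I" "state N l j B V B I"
  defines "T \<equiv> V - B - {j}"
  defines "F \<equiv> var j * (\<Prod>k\<in>T. var j - var k)"
  shows "hser I \<preceq> fps_X ^ Suc (card T) * hser (colon I F)
      + exp_series A * (degree_series e B V B - fps_X ^ Suc (card T) * degree_series e B V V)
    \<and> state N l j B V V (colon I F)"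
proof -
  let ?p = "var j"
  define z where "z = Max (V - B)"
  have A: "finite (V - B)" "V - B \<noteq> {}" using finV jV BV by auto
  have z: "z \<in> V - B" using Max_in[OF A] by (simp add: z_def)
  have z_ge: "v \<le> z" if "v \<in> V - B" for v
    using Max_ge[OF A(1) that] by (simp add: z_def)
  have p: "?p \<in> homog 1" by simp
  have Ic: "hideal n (colon I ?p)" "hideal n (adjoin I ?p)"
    using assms(1) p by (blast intro: hideal_colon hideal_adjoin)+
  have T: "T = {k\<in>V - B. j < k \<and> k \<le> z}"
    unfolding T_def using z_ge j_le by (auto simp: order_le_less)
  have D': "insert z B = B \<union> {k\<in>V - B. z \<le> k}"
    using z z_ge by (auto intro: antisym)
  have IH: "hser (colon I ?p) \<preceq> fps_X ^ card T * hser (colon (colon I ?p) (\<Prod>k\<in>T. var j - var k))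
      + exp_series A * (degree_series e B V (insert z B) - fps_X ^ card T * degree_series e B V V)
    \<and> state N l j B V V (colon (colon I ?p) (\<Prod>k\<in>T. var j - var k))"
    unfolding T
    by (rule chain_not_in_B[OF Ic(1) mult_spanned_mono[OF assms(2) subset_colon[OF assms(1)]] z D'
       divide_var_colon[OF assms(1,3), folded z_def]])
  have "?p \<in> adjoin I ?p"
    using in_adjoin[OF assms(1), of ?p 1] by simp
  then have ga: "mult_spanned A (V - {j}) (adjoin I ?p)"
    using mult_spanned_kill[OF Ic(2) mult_spanned_mono[OF assms(2) subset_adjoin]] by blast
  have adj: "hser (adjoin I ?p) \<preceq> exp_series A * (\<Prod>x\<in>V - {z}. q_number (e + rank_out B V x - 1 - of_bool (x \<in> B)))"
  proof (cases "V - {j} = {}")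
    case True
    then have "V = {j}" "z = j" using jV z by auto
    then show ?thesis using hser_mult_spanned_empty[OF Ic(2) _ fA] ga by simp
  next
    case False
    define j' where "j' = Min (V - {j})"
    have lN: "l + card V \<le> N" using e by simp
    note C = divide_var_adjoin[OF assms(1,3) False lN, folded j'_def]
    have "card (V - {j}) < card V" using finV jV by (intro card_Diff1_less)
    then have "hser (adjoin I ?p) \<preceq> exp_series A * degree_series (N - Suc l + 1 - of_bool (j' \<in> B) - card (V - {j})) (B - {j'}) (V - {j}) {}"
      by (intro stair_boundD[OF stair_bound C(2) _ Ic(2) ga C(1)]) auto
    also have "N - Suc l + 1 - of_bool (j' \<in> B) - card (V - {j}) = e - of_bool (j' \<in> B)"
      using e jV card_pos finV lN by (auto simp: card_Diff_singleton)
    also have "degree_series \<dots> (B - {j'}) (V - {j}) {} = (\<Prod>x\<in>V - {z}. q_number (e + rank_out B V x - 1 - of_bool (x \<in> B)))"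
      unfolding j'_def z_def by (rule degree_series_var[OF e(2) False])
    finally show ?thesis .
  qed
  have zD: "z \<in> V" "z \<notin> B" using z by auto
  show ?thesis
    unfolding F_def
    using descent_step[OF assms(1) p adj degree_series_step[OF zD e(2)] conjunct1[OF IH]] IH
    by (simp add: colon_colon)
qed

text \<open>The factors x_j - x_c with c in B come before x_j, because Euler's identity needs all of
  B divided. The remaining ones come after x_j, because their descent starts from the maximum of V -
  B, the position that x_j divides.\<close>

lemma chain:
  assumes "hideal n I" "mult_spanned A V I" "state N l j B V D I" "D \<subseteq> B"
  defines "T \<equiv> V - {j} - D"
  defines "F \<equiv> var j * (\<Prod>k\<in>T. var j - var k)"
  shows "hser I \<preceq> fps_X ^ Suc (card T) * hser (colon I F)
      + exp_series A * (degree_series e B V D - fps_X ^ Suc (card T) * degree_series e B V V)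
    \<and> state N l j B V V (colon I F)"
  using assms(1-4) unfolding F_def T_def
proof (induction "card (B - D)" arbitrary: I D rule: less_induct)
  case less
  show ?case
  proof (cases "D = B")
    case True
    have "V - {j} - B = V - B - {j}" by auto
    then show ?thesis
      using chain_var[OF less.prems(1,2) less.prems(3)[unfolded True]] unfolding True by (simp only:)
  next
    case False
    then obtain c where c: "c \<in> B" "c \<notin> D" using less.prems by auto
    let ?p = "var j - var c"
    let ?T = "\<lambda>D. V - {j} - D"
    let ?F = "\<lambda>D. var j * (\<Prod>k\<in>?T D. var j - var k)"
    note C = divide_in_B[OF less.prems(1,3,4) c]
    have Ic: "hideal n (colon I ?p)" "hideal n (adjoin I ?p)"
      using less.prems(1) diff_homog by (blast intro: hideal_colon hideal_adjoin)+
    have cV: "c \<in> V" "c \<noteq> j" using c BV by auto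
    have 1: "card (B - insert c D) < card (B - D)"
      using c finB by (intro psubset_card_mono) auto
    have 2: "insert c D \<subseteq> B" using c less.prems by auto
    have IH: "hser (colon I ?p) \<preceq> fps_X ^ Suc (card (?T (insert c D))) * hser (colon (colon I ?p) (?F (insert c D)))
      + exp_series A * (degree_series e B V (insert c D) - fps_X ^ Suc (card (?T (insert c D))) * degree_series e B V V)
    \<and> state N l j B V V (colon (colon I ?p) (?F (insert c D)))"
      by (rule less.hyps[OF 1 Ic(1) mult_spanned_mono[OF less.prems(2) subset_colon[OF less.prems(1)]] C(1) 2])
    have "var c - var j \<in> adjoin I ?p"
      using hideal_uminus[OF Ic(2) in_adjoin[OF less.prems(1), of ?p 1]] by simp
    then have ga: "mult_spanned A (V - {c}) (adjoin I ?p)"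
      using mult_spanned_identify[OF Ic(2) mult_spanned_mono[OF less.prems(2) subset_adjoin] jV cV(2)] by blast
    have "card (V - {c}) < card V" using finV cV by (intro card_Diff1_less)
    moreover have Dc: "D \<subseteq> B - {c}" using c less.prems by auto
    ultimately have "hser (adjoin I ?p) \<preceq> exp_series A * degree_series (N + 1 - Suc l - card (V - {c})) (B - {c}) (V - {c}) D"
      by (intro stair_boundD[OF stair_bound C(3) Dc Ic(2) ga C(2)])
    also have "N + 1 - Suc l - card (V - {c}) = e"
      using e cV card_pos finV by (simp add: card_Diff_singleton)
    also have "degree_series e (B - {c}) (V - {c}) D = (\<Prod>x\<in>V - {c}. q_number (e + rank_out B V x - 1 - of_bool (x \<in> D)))"
      by (rule degree_series_in_B[OF c(1)])
    finally have adj: "hser (adjoin I ?p) \<preceq> exp_series A * (\<Prod>x\<in>V - {c}. q_number (e + rank_out B V x - 1 - of_bool (x \<in> D)))" .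
    have T: "?T D = insert c (?T (insert c D))" "c \<notin> ?T (insert c D)"
      using c cV by auto
    have fT: "finite (?T (insert c D))" using finV by simp
    have T': "card (?T D) = Suc (card (?T (insert c D)))"
      unfolding T(1) by (rule card_insert_disjoint[OF fT T(2)])
    have F': "?F D = ?p * ?F (insert c D)"
      unfolding T(1) prod.insert[OF fT T(2)] by (rule mult.left_commute)
    show ?thesis
      unfolding T' F'
      using descent_step[OF less.prems(1) diff_homog adj degree_series_step[OF cV(1) c(2) e(2)] conjunct1[OF IH]]
        conjunct2[OF IH] unfolding colon_colon by (rule conjI)
  qed
qed

end

end

text \<open>The outer induction on card V takes care of the enlarged ideals. The inner one, on the
  degree of the generator at j, takes care of the colon ideal: a full round of divisions adds one
  copy of x_j and lowers this degree by one. At degree 0 the generator is 1 and the quotient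
  vanishes.\<close>

lemma upper_bound:
  assumes fA: "finite A"
  shows "stair_bound n A V"
proof (induction "card V" arbitrary: V rule: less_induct)
  case less
  have "hser I \<preceq> exp_series A * degree_series (N + 1 - l - card V) B V D"
    if "config V l N B j" "D \<subseteq> B" "hideal n I" "mult_spanned A V I" "state N l j B V D I" for l N B j D I
    using that
  proof (induction "N + 1 - l - card V" arbitrary: l D I)
    case 0
    interpret config V l N B j by fact
    have "{v\<in>V. j < v \<or> v \<in> B} = V - {j}" using BV j_le by (auto simp: order_le_less)
    then have "dd N (nodes (Suc l) j B V j) = 1"
      using 0 size card_pos jV finV by (intro dd_eq_1) (simp add: nodes_def card_Diff_singleton)
    then have "1 \<in> I" using dd_nodes_in[OF 0(6,3), of j] by simp
    then have "hser I = 0" using hser_eq_0 0(4) by blast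
    moreover have "0 \<preceq> exp_series A * degree_series 0 B V D" by (intro fps_le_mult exp_series_pos degree_series_pos)
    ultimately show ?case using 0 by simp
  next
    case (Suc e)
    interpret config V l N B j by fact
    define F where "F = var j * (\<Prod>k\<in>V - {j} - D. var j - var k)"
    define m where "m = Suc (card (V - {j} - D))"
    have ch: "hser I \<preceq> fps_X ^ m * hser (colon I F) + exp_series A * (degree_series (Suc e) B V D - fps_X ^ m * degree_series (Suc e) B V V)"
      and st: "state N l j B V V (colon I F)"
      using chain[OF less fA Suc.hyps(2) zero_less_Suc Suc.prems(3,4,5,2)] unfolding F_def m_def by blast+
    have F: "F \<in> homog (1 + (\<Sum>k\<in>V - {j} - D. 1))"
      unfolding F_def by (intro homog_mult homog_prod homog_diff) auto
    have cl: "config V (Suc l) N B j"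
      using finV jV j_le BV Suc.hyps(2) by unfold_locales auto
    have "hser (colon I F) \<preceq> exp_series A * degree_series (N + 1 - Suc l - card V) B V {}"
    proof (rule Suc.hyps(1))
      show "e = N + 1 - Suc l - card V" using Suc.hyps(2) by simp
      show "hideal n (colon I F)" by (rule hideal_colon[OF Suc.prems(3) F])
      show "mult_spanned A V (colon I F)"
        by (rule mult_spanned_mono[OF Suc.prems(4) subset_colon[OF Suc.prems(3)]])
      show "state N (Suc l) j B V {} (colon I F)"
      proof -
        have "B \<subseteq> V" using BV by auto
        then show ?thesis using st state_V by blast
      qed
    qed (use cl in auto)
    \<comment> \<open>Lowering every factor by one can be expressed by the first argument or by
      marking all of V.\<close>
    also have "degree_series (N + 1 - Suc l - card V) B V {} = degree_series (Suc e) B V V"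
      unfolding degree_series_def
    proof (intro prod.cong refl arg_cong[of _ _ q_number])
      fix x assume "x \<in> V"
      then show "N + 1 - Suc l - card V + rank_out B V x - 1 - of_bool (x \<in> {}) = Suc e + rank_out B V x - 1 - of_bool (x \<in> V)"
        using Suc.hyps(2) rank_out_pos[of x] by simp
    qed
    finally have *: "hser (colon I F) \<preceq> exp_series A * degree_series (Suc e) B V V" .
    have "F' \<preceq> G' \<Longrightarrow> fps_X ^ m * F' \<preceq> fps_X ^ m * G'" for F' G'
      by (induction m) (auto simp: mult.assoc intro: fps_le_X_mult)
    then have "fps_X ^ m * hser (colon I F) + exp_series A * (degree_series (Suc e) B V D - fps_X ^ m * degree_series (Suc e) B V V)
      \<preceq> fps_X ^ m * (exp_series A * degree_series (Suc e) B V V) + exp_series A * (degree_series (Suc e) B V D - fps_X ^ m * degree_series (Suc e) B V V)"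
      using * by (intro fps_le_add) auto
    also have "\<dots> = exp_series A * degree_series (Suc e) B V D" by (simp add: algebra_simps)
    finally show ?case using fps_le_trans[OF ch] Suc.hyps(2) by simp
  qed
  then show ?case unfolding stair_bound_def by blast
qed

section \<open>Staircase monomials\<close>

definition polys_in :: "nat set \<Rightarrow> cpoly set" where
  "polys_in V = {f. \<forall>m \<in> keys f. keys m \<subseteq> V}"

lemma polys_in_0 [simp]: "0 \<in> polys_in V" by (simp add: polys_in_def)
lemma polys_in_1 [simp]: "1 \<in> polys_in V" by (simp add: polys_in_def)
lemma polys_in_const [simp]: "const c \<in> polys_in V" by (simp add: polys_in_def const_def)
lemma polys_in_var: "i \<in> V \<Longrightarrow> var i \<in> polys_in V" by (simp add: polys_in_def var_def)
lemma polys_in_mon: "keys m \<subseteq> V \<Longrightarrow> mon m \<in> polys_in V" by (simp add: polys_in_def)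
lemma polys_in_add: "f \<in> polys_in V \<Longrightarrow> g \<in> polys_in V \<Longrightarrow> f + g \<in> polys_in V"
  using Poly_Mapping.keys_add[of f g] by (auto simp: polys_in_def)
lemma polys_in_uminus: "f \<in> polys_in V \<Longrightarrow> - f \<in> polys_in V"
  by (simp add: polys_in_def)
lemma polys_in_diff: "f \<in> polys_in V \<Longrightarrow> g \<in> polys_in V \<Longrightarrow> f - g \<in> polys_in V"
  using polys_in_add[of f V "- g"] polys_in_uminus[of g V] by simp
lemma polys_in_mult: "f \<in> polys_in V \<Longrightarrow> g \<in> polys_in V \<Longrightarrow> f * g \<in> polys_in V"
  unfolding polys_in_def
proof (intro CollectI ballI)
  fix m assume f: "f \<in> {f. \<forall>m\<in>keys f. keys m \<subseteq> V}"
    and g: "g \<in> {f. \<forall>m\<in>keys f. keys m \<subseteq> V}"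
    and m: "m \<in> keys (f * g)"
  obtain a b where "a \<in> keys f" "b \<in> keys g" "m = a + b"
    using keys_mult[of f g] m by blast
  then show "keys m \<subseteq> V"
    using f g Poly_Mapping.keys_add[of a b] by blast
qed
lemma polys_in_sum: "(\<And>i. i \<in> A \<Longrightarrow> f i \<in> polys_in V) \<Longrightarrow> (\<Sum>i\<in>A. f i) \<in> polys_in V"
  by (induction A rule: infinite_finite_induct) (auto intro: polys_in_add)
lemma polys_in_prod: "(\<And>i. i \<in> A \<Longrightarrow> f i \<in> polys_in V) \<Longrightarrow> (\<Prod>i\<in>A. f i) \<in> polys_in V"
  by (induction A rule: infinite_finite_induct) (auto intro: polys_in_mult)
lemma polys_in_hcomp: "f \<in> polys_in V \<Longrightarrow> hcomp d f \<in> polys_in V"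
  by (auto simp: polys_in_def in_keys_iff lookup_hcomp split: if_splits)
lemma polys_in_hc: "(\<And>y. y \<in># M \<Longrightarrow> y \<in> polys_in V) \<Longrightarrow> hc d M \<in> polys_in V"
proof (induction M arbitrary: d)
  case empty then show ?case by (cases d) auto
next
  case (add y M)
  show ?case
    using add by (induction d) (auto simp: hc_Suc_add intro!: polys_in_add polys_in_mult)
qed
lemma polys_in_dd: "(\<And>y. y \<in># M \<Longrightarrow> y \<in> polys_in V) \<Longrightarrow> dd N M \<in> polys_in V"
  by (simp add: dd_def polys_in_hc)

lemma hc_expand: "hc d (add_mset y M) = (\<Sum>i\<le>d. y ^ i * hc (d - i) M)"
  by (simp add: hc_def fps_mult_nth geom_def atMost_atLeast0)

text \<open>For j = n + 1 these are the exponents of Artin's monomial basis of the coinvariant ring;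
  a smaller j keeps x_1, ..., x_{j-1} only.\<close>

definition stair_exps :: "nat \<Rightarrow> (nat \<Rightarrow>\<^sub>0 nat) set" where
  "stair_exps j = {a. keys a \<subseteq> {1..<j} \<and> (\<forall>i\<in>keys a. lookup a i < i)}"

lemma stair_exps_1: "stair_exps (Suc 0) = {0}"
  by (auto simp: stair_exps_def)

lemma stair_exps_Suc:
  assumes "0 < j"
  shows "bij_betw (\<lambda>(a, e). a + single j e) (stair_exps j \<times> {..<j}) (stair_exps (Suc j))"
proof -
  have lj: "lookup a j = 0" if "a \<in> stair_exps j" for a
    using that by (auto simp: stair_exps_def in_keys_iff)
  show ?thesis
  proof (rule bij_betw_byWitness[where f' = "\<lambda>a. (a - single j (lookup a j), lookup a j)"])
    show "\<forall>a\<in>stair_exps j \<times> {..<j}. (\<lambda>a. (a - single j (lookup a j), lookup a j))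
        ((\<lambda>(a, e). a + single j e) a) = a"
      using lj by (auto simp: lookup_add)
    show "\<forall>a'\<in>stair_exps (Suc j). (\<lambda>(a, e). a + single j e)
        (a' - single j (lookup a' j), lookup a' j) = a'"
      using split_off[of _ j] by (simp add: add.commute)
    show "(\<lambda>(a, e). a + single j e) ` (stair_exps j \<times> {..<j}) \<subseteq> stair_exps (Suc j)"
    proof clarify
      fix a e assume a: "a \<in> stair_exps j" and e: "e < j"
      have "keys (a + single j e) \<subseteq> {1..<Suc j}"
        using a Poly_Mapping.keys_add[of a "single j e"] assms
        by (fastforce simp: stair_exps_def split: if_splits)
      moreover have "lookup (a + single j e) i < i"
        if "i \<in> keys (a + single j e)" for i
        using that a e lj[OF a] by (cases "i = j") (auto simp: stair_exps_def lookup_add lookup_single in_keys_iff when_def)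
      ultimately show "a + single j e \<in> stair_exps (Suc j)"
        by (simp add: stair_exps_def)
    qed
    show "(\<lambda>a. (a - single j (lookup a j), lookup a j)) ` stair_exps (Suc j)
        \<subseteq> stair_exps j \<times> {..<j}"
    proof (rule image_subsetI)
      fix a assume a: "a \<in> stair_exps (Suc j)"
      let ?a = "a - single j (lookup a j)"
      have "lookup a j < j"
        using a assms by (cases "j \<in> keys a") (auto simp: stair_exps_def in_keys_iff)
      moreover have "?a \<in> stair_exps j"
        unfolding stair_exps_def
      proof (intro CollectI conjI ballI)
        have k: "keys ?a = keys a - {j}" by (rule keys_remove)
        have sa: "keys a \<subseteq> {1..<Suc j}"
          "\<And>i. i \<in> keys a \<Longrightarrow> lookup a i < i"
          using a unfolding stair_exps_def by blast+
        show "keys ?a \<subseteq> {1..<j}" unfolding k using sa(1) by auto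
        fix i assume "i \<in> keys ?a"
        then have "i \<in> keys a" "i \<noteq> j" unfolding k by blast+
        then show "lookup ?a i < i"
          using sa(2)[of i] by (simp add: lookup_minus lookup_single)
      qed
      ultimately show "(?a, lookup a j) \<in> stair_exps j \<times> {..<j}" by blast
    qed
  qed
qed

lemma exp_series_stair_exps: "exp_series (stair_exps (Suc j)) = (\<Prod>k\<in>{1..j}. q_number k)"
proof (induction j)
  case 0 show ?case unfolding stair_exps_1 by (simp add: exp_series_def)
next
  case (Suc j)
  have "exp_series (stair_exps (Suc (Suc j))) = (\<Sum>p\<in>stair_exps (Suc j) \<times> {..<Suc j}.
      fps_X ^ mdeg (case p of (a, e) \<Rightarrow> a + single (Suc j) e))"
    using sum.reindex_bij_betw[OF stair_exps_Suc[of "Suc j"], of "\<lambda>a. fps_X ^ mdeg a :: int fps"]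
    by (simp only: exp_series_def zero_less_Suc simp_thms)
  also have "\<dots> = (\<Sum>(a, e)\<in>stair_exps (Suc j) \<times> {..<Suc j}. fps_X ^ (mdeg a + e))"
    by (simp add: case_prod_unfold mdeg_add)
  also have "\<dots> = exp_series (stair_exps (Suc j)) * q_number (Suc j)"
    unfolding exp_series_def q_number_def by (simp add: sum_product sum.cartesian_product power_add del: sum.lessThan_Suc)
  finally show ?case using Suc by simp
qed

lemma finite_stair_exps: "finite (stair_exps (Suc j))"
proof (induction j)
  case (Suc j)
  then show ?case using bij_betw_finite[OF stair_exps_Suc[of "Suc j"]] by auto
qed (simp add: stair_exps_1)

lemma mult_spanned_full:
  assumes I: "hideal n I"
  shows "mult_spanned {0} {1..n} I"
  unfolding mult_spanned_def
proof
  fix m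
  show "\<exists>y\<in>cp.span (mult_mons {0} {1..n} (mdeg m)). mon m - y \<in> I"
  proof (cases "keys m \<subseteq> {1..n}")
    case True
    have "mon m \<in> cp.span (mult_mons {0} {1..n} (mdeg m))"
      using mult_mons_base[of 0 "{0}" m "{1..n}"] True by simp
    moreover have "mon m - mon m \<in> I" using hideal_0[OF I] by simp
    ultimately show ?thesis by blast
  next
    case False
    have "mon m - 0 \<in> I" using hideal_mon[OF I False] by simp
    then show ?thesis using cp.span_zero by blast
  qed
qed

text \<open>The polynomial \<open>h\<^sub>j(x\<^sub>j, \<dots>, x\<^sub>n)\<close> is monic of degree \<open>j\<close> in \<open>x\<^sub>j\<close>, so modulo it only exponents
  of \<open>x\<^sub>j\<close> below \<open>j\<close> are needed.\<close>

lemma mult_spanned_monic: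
  assumes I: "hideal n I" and g: "mult_spanned (stair_exps j) {j..n} I" and j: "0 < j" "j \<le> n"
    and h: "hc j (image_mset var (mset_set {j..n})) \<in> I"
  shows "mult_spanned (stair_exps (Suc j)) {Suc j..n} I"
proof (rule mult_spanned_trans[OF I g])
  let ?M = "image_mset var (mset_set {Suc j..n})"
  let ?G = "\<lambda>d. cp.span (mult_mons (stair_exps (Suc j)) {Suc j..n} d)"
  have "{j..n} = insert j {Suc j..n}" using j by auto
  then have h': "hc j (add_mset (var j) ?M) \<in> I" using h by simp
  have "(\<Sum>i\<le>j. var j ^ i * hc (j - i) ?M) \<in> I"
    using h' unfolding hc_expand .
  moreover have "{..j} = insert j {..<j}" by auto
  ultimately have xj: "var j ^ j + (\<Sum>i<j. var j ^ i * hc (j - i) ?M) \<in> I" by simp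
  have main: "\<exists>y\<in>?G (mdeg a + e + mdeg b). mon a * var j ^ e * mon b - y \<in> I"
    if a: "a \<in> stair_exps j" and b: "keys b \<subseteq> {Suc j..n}" for a b e
    using b
  proof (induction e arbitrary: b rule: less_induct)
    case (less e)
    show ?case
    proof (cases "e < j")
      case True
      then have "a + single j e \<in> stair_exps (Suc j)"
        using bij_betw_apply[OF stair_exps_Suc[OF j(1)], of "(a, e)"] a by simp
      from mult_mons_base[OF this less.prems]
      have "mon a * var j ^ e * mon b \<in> ?G (mdeg a + e + mdeg b)"
        by (simp add: mon_add mon_single mdeg_add)
      then show ?thesis using hideal_0[OF I] by (intro bexI) auto
    next
      case False
      then have e: "e = (e - j) + j" by simp
      let ?c = "mon a * var j ^ (e - j) * mon b"
      let ?f = "\<Sum>i<j. var j ^ i * hc (j - i) ?M"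
      have "?c * (var j ^ j + ?f) \<in> I" by (rule hideal_mult[OF I xj])
      moreover have "?c * (var j ^ j + ?f) = mon a * var j ^ e * mon b + ?c * ?f"
        using False by (simp add: distrib_left power_add[symmetric] mult_ac)
      ultimately have 1: "mon a * var j ^ e * mon b - - (?c * ?f) \<in> I" by simp
      \<comment> \<open>The rewritten monomials have the same degree and a smaller exponent at x_j,
        but a larger part in the later indeterminates. The induction on e therefore leaves b
        arbitrary.\<close>
      have 2: "- (?c * ?f) \<in> cp.span {mon a * var j ^ e' * mon b' | e' b'. e' < e \<and>
          keys b' \<subseteq> {Suc j..n} \<and> e' + mdeg b' = e + mdeg b}" (is "_ \<in> cp.span ?S")
      proof -
        have "?c * (var j ^ i * hc (j - i) ?M) \<in> cp.span ?S" if i: "i < j" for i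
        proof -
          let ?h = "hc (j - i) ?M"
          have hh: "?h \<in> homog (j - i)" "?h \<in> polys_in {Suc j..n}"
            by (auto intro!: hc_homog polys_in_hc polys_in_var)
          have "?c * (var j ^ i * ?h) = (\<Sum>m\<in>keys ?h.
              const (lookup ?h m) * (mon a * var j ^ (e - j + i) * mon (b + m)))"
            by (subst (1) poly_eq_sum_mon[of ?h]) (simp add: sum_distrib_left mon_add power_add mult_ac)
          also have "\<dots> \<in> cp.span ?S"
          proof (intro cp.span_sum cp.span_scale cp.span_base)
            fix m assume m: "m \<in> keys ?h"
            have "mdeg m = j - i" using m hh(1) by (auto simp: homog_def)
            moreover have "keys (b + m) \<subseteq> {Suc j..n}"
              using m hh(2) less.prems Poly_Mapping.keys_add[of b m] by (fastforce simp: polys_in_def)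
            ultimately show "mon a * var j ^ (e - j + i) * mon (b + m) \<in> ?S"
              using i False by (intro CollectI exI[of _ "e - j + i"] exI[of _ "b + m"]) (auto simp: mdeg_add)
          qed
          finally show ?thesis .
        qed
        then show ?thesis
          unfolding sum_distrib_left by (intro cp.span_neg cp.span_sum) auto
      qed
      have "\<exists>y\<in>?G (mdeg a + e + mdeg b). - (?c * ?f) - y \<in> I"
      proof (rule span_mod[OF I _ 2])
        fix x assume "x \<in> ?S"
        then obtain e' b' where x: "x = mon a * var j ^ e' * mon b'" "e' < e"
          "keys b' \<subseteq> {Suc j..n}" "e' + mdeg b' = e + mdeg b" by blast
        have dg: "mdeg a + e' + mdeg b' = mdeg a + e + mdeg b" using x(4) by simp
        show "\<exists>y\<in>?G (mdeg a + e + mdeg b). x - y \<in> I"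
          using less.IH[OF x(2,3)] unfolding x(1) dg .
      qed
      then obtain y where "y \<in> ?G (mdeg a + e + mdeg b)" "- (?c * ?f) - y \<in> I" by blast
      then show ?thesis using hideal_add[OF I 1, of "- (?c * ?f) - y"] by (intro bexI[of _ y]) simp_all
    qed
  qed
  fix a b :: "nat \<Rightarrow>\<^sub>0 nat"
  assume a: "a \<in> stair_exps j" and b: "keys b \<subseteq> {j..n}"
  define e where "e = lookup b j"
  define b' where "b' = b - single j e"
  have bb': "b = single j e + b'" unfolding b'_def e_def by (rule split_off)
  have "keys b' = keys b - {j}"
    unfolding b'_def e_def by (rule keys_remove)
  also have "\<dots> \<subseteq> {j..n} - {j}" using b by blast
  also have "\<dots> = {Suc j..n}" by auto
  finally have "keys b' \<subseteq> {Suc j..n}" .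
  from main[OF a this, of e]
  show "\<exists>y\<in>?G (mdeg (a + b)). mon (a + b) - y \<in> I"
    unfolding bb' by (simp add: mon_add mon_single mdeg_add mult_ac add_ac)
qed

section \<open>The Hilbert series of the quotients\<close>

definition p_gen :: "nat \<Rightarrow> nat set \<Rightarrow> nat \<Rightarrow> cpoly" where
  "p_gen n J k = dd n (add_mset (var k) (image_mset var (mset_set {v\<in>{1..n}. k < v \<or> v \<in> J})))"

definition stair_series :: "nat \<Rightarrow> nat set \<Rightarrow> int fps" where
  "stair_series n J = (\<Prod>i = 1..n. q_number (staircase J i))"

lemma staircase_eq: "staircase J k = card ({1..k} - J)"
proof (induction k)
  case (Suc k)
  have "{1..Suc k} = insert (Suc k) {1..k}" by auto
  then have "{1..Suc k} - J = (if Suc k \<in> J then {1..k} - J else insert (Suc k) ({1..k} - J))"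
    by auto
  then show ?case using Suc by simp
qed simp

lemma p_gen_below:
  assumes "B \<subseteq> {j..n}" "1 \<le> k" "k < j" "j \<le> n"
  shows "p_gen n B k = hc k (image_mset var (mset_set {k..n}))"
proof -
  have "{v\<in>{1..n}. k < v \<or> v \<in> B} = {Suc k..n}" "{k..n} = insert k {Suc k..n}" using assms by auto
  then show ?thesis using assms by (simp add: p_gen_def dd_def)
qed

text \<open>Since B lies at or above j, the generators below j are the h_k(x_k, ..., x_n), monic in
  x_k; they reduce the indeterminates before j one after the other.\<close>

lemma mult_spanned_stair:
  assumes I: "hideal n I" and r: "\<And>k. k \<in> {1..n} \<Longrightarrow> p_gen n B k \<in> I" and B: "B \<subseteq> {j..n}"
    and j: "1 \<le> j" "j \<le> n"
  shows "mult_spanned (stair_exps j) {j..n} I"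
proof -
  have "mult_spanned (stair_exps (Suc i)) {Suc i..n} I" if "Suc i \<le> j" for i
    using that
  proof (induction i)
    case 0
    then show ?case using mult_spanned_full[OF I] by (simp add: stair_exps_1)
  next
    case (Suc i)
    have "hc (Suc i) (image_mset var (mset_set {Suc i..n})) \<in> I"
      using r[of "Suc i"] p_gen_below[OF B, of "Suc i"] Suc.prems j by simp
    then show ?case using Suc j by (intro mult_spanned_monic[OF I _ zero_less_Suc]) auto
  qed
  from this[of "j - 1"] j show ?thesis by simp
qed

lemma config_start:
  assumes "1 \<le> j" "j \<le> n" "B \<subseteq> {Suc j..n}"
  shows "config {j..n} 0 n B j"
  using assms by unfold_locales auto

text \<open>At position k, \<open>p_gen\<close> has the extra node x_k where \<open>state\<close>
  asks for x_j when k is outside B. The two agree at k = j, and \<open>dd_exchange\<close> carries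
  x_j upwards from one position to the next.\<close>

lemma state_start:
  assumes I: "hideal n I" and r: "\<And>k. k \<in> {1..n} \<Longrightarrow> p_gen n B k \<in> I" and B: "B \<subseteq> {Suc j..n}"
    and j: "1 \<le> j" "j \<le> n"
  shows "state n 0 j B {j..n} {} I"
proof -
  interpret config "{j..n}" 0 n B j by (rule config_start[OF j B])
  have nd: "nodes 0 j B {j..n} k = image_mset var (mset_set {v\<in>{1..n}. k < v \<or> v \<in> B})" if "j \<le> k" for k
  proof -
    have "{v\<in>{j..n}. k < v \<or> v \<in> B} = {v\<in>{1..n}. k < v \<or> v \<in> B}" using that j B by auto
    then show ?thesis by (simp add: nodes_def)
  qed
  have r': "dd n (add_mset (var k) (nodes 0 j B {j..n} k)) \<in> I" if "j \<le> k" "k \<le> n" for k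
    using r[of k] that j nd[of k] by (simp add: p_gen_def)
  have q: "dd n (add_mset (var j) (nodes 0 j B {j..n} k)) \<in> I" if "j \<le> k" "k \<le> n" for k
    using that
  proof (induction k rule: dec_induct)
    case base then show ?case using r'[of j] by simp
  next
    case (step k)
    show ?case
    proof (cases "Suc k \<in> B")
      case True
      then have "nodes 0 j B {j..n} (Suc k) = nodes 0 j B {j..n} k" by (intro nodes_step_out) simp
      then show ?thesis using step by simp
    next
      case False
      have eq: "nodes 0 j B {j..n} k = add_mset (var (Suc k)) (nodes 0 j B {j..n} (Suc k))"
        using step False by (intro nodes_step_in) auto
      have 1: "dd n (add_mset (var j) (nodes 0 j B {j..n} k)) \<in> I" using step by simp
      show ?thesis
        using step by (intro dd_exchange[OF I r'[of "Suc k"] 1[unfolded eq]]) auto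
    qed
  qed
  show ?thesis using q r' B by (intro stateI) auto
qed

text \<open>The indeterminates below j contribute [1]_q ... [j-1]_q through Artin's exponents.
  Inserting j into B lowers the staircase by one from j on, which is the effect of marking all
  positions as divided.\<close>

lemma degree_series_stair:
  assumes j: "1 \<le> j" "j \<le> n" and B: "B \<subseteq> {Suc j..n}"
  shows "exp_series (stair_exps j) * degree_series j B {j..n} {} = stair_series n B"
    and "exp_series (stair_exps j) * degree_series j B {j..n} {j..n} = stair_series n (insert j B)"
proof -
  have low: "exp_series (stair_exps j) = (\<Prod>k\<in>{1..<j}. q_number k)"
    using exp_series_stair_exps[of "j - 1"] j by (simp add: atLeastLessThanSuc_atLeastAtMost[symmetric])
  have s1: "staircase C k = k" if "k < j" "C \<subseteq> {j..n}" for k C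
  proof -
    have "{1..k} - C = {1..k}" using that by auto
    then show ?thesis by (simp add: staircase_eq)
  qed
  have s2: "staircase B k = j - 1 + rank_out B {j..n} k" "rank_out B {j..n} k > 0"
    "staircase (insert j B) k = j - 1 + rank_out B {j..n} k - 1" if "j \<le> k" "k \<le> n" for k
  proof -
    have "{1..k} - B = {1..<j} \<union> {v\<in>{j..n} - B. v \<le> k}" using that j B by auto
    then show 1: "staircase B k = j - 1 + rank_out B {j..n} k"
      unfolding staircase_eq rank_out_def by (simp add: card_Un_disjoint disjoint_iff)
    show "rank_out B {j..n} k > 0"
      using config.rank_out_pos[OF config_start[OF j B]] that by simp
    have "{1..k} - insert j B = ({1..k} - B) - {j}" "j \<in> {1..k} - B" using that j B by auto
    then show "staircase (insert j B) k = j - 1 + rank_out B {j..n} k - 1"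
      using 1 unfolding staircase_eq by (simp add: card_Diff_singleton)
  qed
  have Bj: "B \<subseteq> {j..n}" "insert j B \<subseteq> {j..n}" using B j by auto
  have split: "(\<Prod>i = 1..n. f i) = (\<Prod>i\<in>{1..<j}. f i) * (\<Prod>i\<in>{j..n}. f i)" for f :: "nat \<Rightarrow> int fps"
  proof -
    have "{1..n} = {1..<j} \<union> {j..n}" using j by auto
    then show ?thesis by (simp add: prod.union_disjoint ivl_disj_int)
  qed
  show "exp_series (stair_exps j) * degree_series j B {j..n} {} = stair_series n B"
    unfolding low stair_series_def split degree_series_def
    using s1[OF _ Bj(1)] s2 j by (intro arg_cong2[of _ _ _ _ "(*)"] prod.cong refl arg_cong[of _ _ q_number]) auto
  show "exp_series (stair_exps j) * degree_series j B {j..n} {j..n} = stair_series n (insert j B)"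
    unfolding low stair_series_def split degree_series_def
    using s1[OF _ Bj(2)] s2 j by (intro arg_cong2[of _ _ _ _ "(*)"] prod.cong refl arg_cong[of _ _ q_number]) auto
qed

lemma fps_le_X_power_cancel: "fps_X ^ m * F \<preceq> fps_X ^ m * G \<Longrightarrow> F \<preceq> G"
proof -
  assume *: "fps_X ^ m * F \<preceq> fps_X ^ m * G"
  have "fps_nth F d \<le> fps_nth G d" for d
    using *[unfolded fps_le_def, rule_format, of "d + m"] by (simp add: fps_X_power_mult_nth)
  then show ?thesis by (simp add: fps_le_def)
qed

lemma stair_series_pos: "0 \<preceq> stair_series n J"
  unfolding stair_series_def by (intro fps_le_prod_0 fps_le_q_number)

text \<open>The general bound is taken at j = 1, which a configuration keeps out of B. If 1 belongs
  to J, then \<open>p_gen n J 1\<close> has n + 1 nodes and equals 1, in accordance with [0]_q =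
  0.\<close>

lemma hser_le_stair:
  assumes I: "hideal n I" and r: "\<And>k. k \<in> {1..n} \<Longrightarrow> p_gen n J k \<in> I" and J: "J \<subseteq> {1..n}"
  shows "hser I \<preceq> stair_series n J"
proof (cases "n = 0")
  case True
  then have "hser I \<preceq> exp_series {0}" using mult_spanned_full[OF I] by (intro hser_mult_spanned_empty[OF I]) auto
  then show ?thesis using True by (simp add: exp_series_def stair_series_def)
next
  case False
  show ?thesis
  proof (cases "1 \<in> J")
    case True
    have "{v\<in>{1..n}. 1 < v \<or> v \<in> J} = {1..n}"
      using True by (auto simp: Suc_le_eq order_le_less)
    then have "p_gen n J 1 = 1" unfolding p_gen_def by (intro dd_eq_1) simp
    then have "hser I = 0" using r[of 1] False by (intro hser_eq_0[OF I]) simp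
    then show ?thesis using stair_series_pos by simp
  next
    case 1: False
    have J2: "J \<subseteq> {Suc 1..n}"
    proof
      fix x assume x: "x \<in> J"
      then have "x \<noteq> 1" using 1 by metis
      moreover have "x \<in> {1..n}" using x J by blast
      ultimately show "x \<in> {Suc 1..n}" by simp
    qed
    have n: "1 \<le> n" using False by simp
    have g: "mult_spanned (stair_exps 1) {1..n} I" using mult_spanned_full[OF I] by (simp add: stair_exps_1)
    have "finite (stair_exps 1)" using finite_stair_exps[of 0] by simp
    from stair_boundD[OF upper_bound[OF this] config_start[OF _ n J2] _ I g state_start[OF I r J2 _ n]]
    have "hser I \<preceq> exp_series (stair_exps 1) * degree_series (n + 1 - 0 - card {1..n}) J {1..n} {}" by simp
    then show ?thesis using degree_series_stair(1)[OF _ n J2] by simp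
  qed
qed

text \<open>The telescoped inequality is solved for the colon ideal: with the lower bound on I, the
  terms for \<open>stair_series n B\<close> cancel, and so does the common power of q. Among the new
  generators, those at j and at elements of B come from the end of the chain; the others lie in I
  already.\<close>

lemma colon_step:
  assumes I: "hideal n I" and r: "\<And>k. k \<in> {1..n} \<Longrightarrow> p_gen n B k \<in> I" and B: "B \<subseteq> {Suc j..n}"
    and j: "1 \<le> j" "j \<le> n" and ge: "stair_series n B \<preceq> hser I"
  defines "F \<equiv> var j * (\<Prod>i\<in>{j+1..n}. var j - var i)"
  shows "stair_series n (insert j B) \<preceq> hser (colon I F)"
    and "\<And>k. k \<in> {1..n} \<Longrightarrow> p_gen n (insert j B) k \<in> colon I F"
proof -
  interpret config "{j..n}" 0 n B j by (rule config_start[OF j B])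
  have Bj: "B \<subseteq> {j..n}" using B by auto
  note st = state_start[OF I r B j]
  have fin: "finite (stair_exps j)" using finite_stair_exps[of "j - 1"] j by simp
  have e: "j = n + 1 - 0 - card {j..n}" "0 < j" using j by auto
  have T: "{j..n} - {j} - {} = {j+1..n}" by auto
  note ch = chain[OF upper_bound[OF fin] fin e I mult_spanned_stair[OF I r Bj j] st empty_subsetI, unfolded T, folded F_def]
  define m where "m = Suc (card {j+1..n})"
  have "hser I \<preceq> fps_X ^ m * hser (colon I F) + exp_series (stair_exps j) * (degree_series j B {j..n} {} - fps_X ^ m * degree_series j B {j..n} {j..n})"
    using ch unfolding m_def by blast
  then have "stair_series n B \<preceq> fps_X ^ m * hser (colon I F)
      + (exp_series (stair_exps j) * degree_series j B {j..n} {} - fps_X ^ m * (exp_series (stair_exps j) * degree_series j B {j..n} {j..n}))"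
    using fps_le_trans[OF ge] by (simp add: algebra_simps)
  then have "fps_X ^ m * stair_series n (insert j B) \<preceq> fps_X ^ m * hser (colon I F)"
    unfolding degree_series_stair[OF j B] by (simp add: fps_le_def)
  then show "stair_series n (insert j B) \<preceq> hser (colon I F)" by (rule fps_le_X_power_cancel)
  have st': "state n 0 j B {j..n} {j..n} (colon I F)" using ch by blast
  have sub: "I \<subseteq> colon I F" by (rule subset_colon[OF I])
  fix k assume k: "k \<in> {1..n}"
  show "p_gen n (insert j B) k \<in> colon I F"
  proof (cases "k < j")
    case True
    then have "{v\<in>{1..n}. k < v \<or> v \<in> insert j B} = {v\<in>{1..n}. k < v \<or> v \<in> B}" by auto
    then have "p_gen n (insert j B) k = p_gen n B k" by (simp add: p_gen_def)
    then show ?thesis using r[OF k] sub by auto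
  next
    case False
    then have jk: "j \<le> k" by simp
    have "{v\<in>{1..n}. k < v \<or> v \<in> insert j B} = insert j {v\<in>{j..n}. k < v \<or> v \<in> B}"
      using jk j B k by auto
    moreover have "j \<notin> {v\<in>{j..n}. k < v \<or> v \<in> B}" using jk B by auto
    ultimately have eq: "p_gen n (insert j B) k = dd n (add_mset (var k) (nodes (Suc 0) j B {j..n} k))"
      by (simp add: p_gen_def nodes_def)
    show ?thesis
    proof (cases "k \<in> B")
      case True
      then show ?thesis unfolding eq using jk k by (intro state_r'[OF st']) auto
    next
      case kB: False
      show ?thesis
      proof (cases "k = j")
        case True
        then show ?thesis using state_q'[OF st', of j] j kB eq by simp
      next
        case False
        then obtain i where i: "k = Suc i" "j \<le> i" using jk by (cases k) auto
        have "nodes (Suc 0) j B {j..n} i = add_mset (var k) (nodes (Suc 0) j B {j..n} k)"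
          unfolding i(1) using i k kB by (intro nodes_step_in) auto
        then show ?thesis
          unfolding eq using dd_nodes_in[OF st empty_subsetI i(2)] sub by (metis subsetD)
      qed
    qed
  qed
qed

lemma f_poly_homog: "f_poly n J \<in> homog (\<Sum>j\<in>J. 1 + (\<Sum>i\<in>{j+1..n}. 1))"
  unfolding f_poly_def by (intro homog_prod homog_mult homog_diff homog_var)

text \<open>J is built up from its largest element downwards, so that each new j lies below B and
  the chain can run over {j..n}.\<close>

lemma colon_f_poly:
  assumes I: "hideal n I" and r: "\<And>k. k \<in> {1..n} \<Longrightarrow> p_gen n {} k \<in> I"
    and ge: "stair_series n {} \<preceq> hser I" and J: "J \<subseteq> {1..n}"
  shows "stair_series n J \<preceq> hser (colon I (f_poly n J))
    \<and> (\<forall>k\<in>{1..n}. p_gen n J k \<in> colon I (f_poly n J))"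
proof -
  have "finite J" using J finite_subset by blast
  then show ?thesis using J
  proof (induction J rule: finite_linorder_min_induct)
    case empty
    then show ?case using r ge by (simp add: f_poly_def)
  next
    case (insert j B)
    have 1: "B \<subseteq> {Suc j..n}" "1 \<le> j" "j \<le> n" "B \<subseteq> {1..n}" "j \<notin> B"
      using insert by (auto simp: Suc_le_eq)
    have H: "hideal n (colon I (f_poly n B))" by (rule hideal_colon[OF I f_poly_homog])
    have "f_poly n (insert j B) = f_poly n B * (var j * (\<Prod>i\<in>{j+1..n}. var j - var i))"
      using insert.hyps 1 unfolding f_poly_def by (simp add: mult_ac)
    then show ?case
      using colon_step[OF H _ 1(1-3)] insert.IH[OF 1(4)] by (simp add: colon_colon[symmetric])
  qed
qed

section \<open>Evaluation homomorphisms\<close>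

lemma eval_with_superset:
  assumes "finite S" "keys f \<subseteq> S" "\<phi> 0 = 0"
  shows "eval_with \<phi> a f = (\<Sum>m\<in>S. \<phi> (lookup f m) *
     (\<Prod>i \<in> keys m. a i ^ lookup m i))"
  unfolding eval_with_def using assms
  by (intro sum.mono_neutral_left) (auto simp: in_keys_iff)

lemma monomial_value_superset:
  fixes a :: "nat \<Rightarrow> 'a::comm_semiring_1"
  assumes "finite S" "keys m \<subseteq> S"
  shows "(\<Prod>i \<in> keys m. a i ^ lookup m i) = (\<Prod>i\<in>S. a i ^ lookup m i)"
  using assms by (intro prod.mono_neutral_left) (auto simp: in_keys_iff)

lemma monomial_value_add:
  fixes a :: "nat \<Rightarrow> 'a::comm_semiring_1"
  shows "(\<Prod>i \<in> keys (m + m'). a i ^ lookup (m + m') i)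
   = (\<Prod>i \<in> keys m. a i ^ lookup m i) *
     (\<Prod>i \<in> keys m'. a i ^ lookup m' i)"
proof -
  let ?S = "keys m \<union> keys m'"
  have "(\<Prod>i \<in> keys (m + m'). a i ^ lookup (m + m') i)
      = (\<Prod>i\<in>?S. a i ^ lookup (m + m') i)"
    using Poly_Mapping.keys_add[of m m'] by (intro monomial_value_superset) auto
  also have "\<dots> = (\<Prod>i\<in>?S. a i ^ lookup m i) * (\<Prod>i\<in>?S. a i ^ lookup m' i)"
    by (simp add: lookup_add power_add prod.distrib)
  finally show ?thesis
    by (simp add: monomial_value_superset[of ?S m] monomial_value_superset[of ?S m'])
qed

definition coeff_hom :: "(complex \<Rightarrow> 'a::comm_ring_1) \<Rightarrow> bool" where
  "coeff_hom \<phi> \<longleftrightarrow> \<phi> 1 = 1 \<and> (\<forall>x y. \<phi> (x + y) = \<phi> x + \<phi> y) \<and> (\<forall>x y. \<phi> (x * y) = \<phi> x * \<phi> y)"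

lemma coeff_hom_id [simp]: "coeff_hom id"
  by (simp add: coeff_hom_def)

lemma coeff_hom_const [simp]: "coeff_hom const"
  by (simp add: coeff_hom_def const_add const_mult)

context
  fixes \<phi> :: "complex \<Rightarrow> 'a::comm_ring_1" and a :: "nat \<Rightarrow> 'a"
  assumes hom: "coeff_hom \<phi>"
begin

lemma coeff_hom_0: "\<phi> 0 = 0"
proof -
  have "\<phi> 0 + \<phi> 0 = \<phi> 0" using hom unfolding coeff_hom_def by (metis add_0)
  then show ?thesis by simp
qed

lemma eval_single: "eval_with \<phi> a (single m c) =
    \<phi> c * (\<Prod>i \<in> keys m. a i ^ lookup m i)"
  using coeff_hom_0 by (subst eval_with_superset[of "{m}"]) (auto simp: eval_with_def)

lemma eval_add: "eval_with \<phi> a (f + g) = eval_with \<phi> a f + eval_with \<phi> a g"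
proof -
  let ?S = "keys f \<union> keys g"
  have *: "\<phi> (x + y) = \<phi> x + \<phi> y" for x y using hom by (simp add: coeff_hom_def)
  show ?thesis
    using Poly_Mapping.keys_add[of f g]
    by (simp add: eval_with_superset[of ?S] coeff_hom_0 lookup_add * distrib_right sum.distrib)
qed

lemma eval_0: "eval_with \<phi> a 0 = 0"
  by (simp add: eval_with_def)

lemma eval_sum: "eval_with \<phi> a (\<Sum>i\<in>A. f i) = (\<Sum>i\<in>A. eval_with \<phi> a (f i))"
  by (induction A rule: infinite_finite_induct) (auto simp: eval_add eval_0)

lemma eval_mult: "eval_with \<phi> a (f * g) = eval_with \<phi> a f * eval_with \<phi> a g"
proof -
  let ?s = "\<lambda>f m. single m (lookup f m)"
  have expand: "f = (\<Sum>m\<in>keys f. ?s f m)" for f :: cpoly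
    by (subst (1) poly_eq_sum_mon) (simp add: const_def mult_single)
  have mult: "\<phi> (x * y) = \<phi> x * \<phi> y" for x y using hom by (simp add: coeff_hom_def)
  have "f * g = (\<Sum>m\<in>keys f. ?s f m) * (\<Sum>m\<in>keys g. ?s g m)"
    using expand[of f] expand[of g] by simp
  also have "\<dots> = (\<Sum>m\<in>keys f. \<Sum>m'\<in>keys g. ?s f m * ?s g m')"
    by (rule sum_product)
  finally have "eval_with \<phi> a (f * g)
      = (\<Sum>m\<in>keys f. \<Sum>m'\<in>keys g. eval_with \<phi> a (?s f m * ?s g m'))"
    by (simp only: eval_sum)
  also have "\<dots> = (\<Sum>m\<in>keys f. \<Sum>m'\<in>keys g. eval_with \<phi> a (?s f m) * eval_with \<phi> a (?s g m'))"
    by (intro sum.cong refl) (simp add: mult_single eval_single mult monomial_value_add mult_ac)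
  also have "\<dots> = eval_with \<phi> a (\<Sum>m\<in>keys f. ?s f m) * eval_with \<phi> a (\<Sum>m\<in>keys g. ?s g m)"
    unfolding eval_sum by (rule sum_product[symmetric])
  finally show ?thesis using expand[of f] expand[of g] by simp
qed

lemma eval_const: "eval_with \<phi> a (const c) = \<phi> c"
  unfolding const_def eval_single by simp

lemma eval_1: "eval_with \<phi> a 1 = 1"
  using eval_const[of 1] hom by (simp add: coeff_hom_def)

lemma eval_var: "eval_with \<phi> a (var i) = a i"
  using hom by (simp add: var_def eval_single coeff_hom_def)

lemma eval_uminus: "eval_with \<phi> a (- f) = - eval_with \<phi> a f"
  using eval_add[of f "- f"] eval_0 by (simp add: eq_neg_iff_add_eq_0 add.commute)

lemma eval_diff: "eval_with \<phi> a (f - g) = eval_with \<phi> a f - eval_with \<phi> a g"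
  using eval_add[of f "- g"] by (simp add: eval_uminus)

lemma eval_prod: "eval_with \<phi> a (\<Prod>i\<in>A. f i) = (\<Prod>i\<in>A. eval_with \<phi> a (f i))"
  by (induction A rule: infinite_finite_induct) (auto simp: eval_mult eval_1)

lemma eval_hc: "eval_with \<phi> a (hc d M) = hc d (image_mset (eval_with \<phi> a) M)"
proof (induction M arbitrary: d)
  case empty then show ?case by (cases d) (auto simp: eval_0 eval_1)
next
  case (add y M)
  show ?case
    using add by (induction d) (auto simp: hc_Suc_add eval_add eval_mult eval_1)
qed

lemma eval_dd: "eval_with \<phi> a (dd N M) = dd N (image_mset (eval_with \<phi> a) M)"
  by (simp add: dd_def eval_hc eval_0)

end

lemmas eval_id = eval_add[OF coeff_hom_id] eval_mult[OF coeff_hom_id] eval_diff[OF coeff_hom_id]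
  eval_const[OF coeff_hom_id] eval_var[OF coeff_hom_id] eval_1[OF coeff_hom_id] eval_0[OF coeff_hom_id]
  eval_sum[OF coeff_hom_id] eval_prod[OF coeff_hom_id]

lemmas eval_simps = eval_add eval_mult eval_diff eval_const eval_var eval_1 eval_0 eval_sum eval_prod

lemma eval_cong:
  assumes "f \<in> polys_in V" "\<And>i. i \<in> V \<Longrightarrow> a i = b i"
  shows "eval_with \<phi> a f = eval_with \<phi> b f"
  unfolding eval_with_def
proof (intro sum.cong refl arg_cong2[of _ _ _ _ "(*)"] prod.cong)
  fix m i assume "m \<in> keys f" "i \<in> keys m"
  then have "i \<in> V" using assms(1) unfolding polys_in_def by blast
  then show "a i ^ lookup m i = b i ^ lookup m i" by (simp add: assms(2))
qed

lemma eval_subst: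
  "eval_with id z (eval_with const s f) = eval_with id (\<lambda>i. eval_with id z (s i)) f"
proof -
  have "eval_with id z (eval_with const s f) = (\<Sum>m\<in>keys f. eval_with id z
      (const (lookup f m) * (\<Prod>i\<in>keys m. s i ^ lookup m i)))"
    unfolding eval_with_def[of const] by (rule eval_sum[OF coeff_hom_id])
  also have "\<dots> = eval_with id (\<lambda>i. eval_with id z (s i)) f"
    unfolding eval_with_def[of id "\<lambda>i. eval_with id z (s i)"]
  proof (intro sum.cong refl)
    have pw: "eval_with id z (g ^ k) = eval_with id z g ^ k" for g k
      by (induction k) (simp_all only: power_0 power_Suc eval_id)
    fix m show "eval_with id z (const (lookup f m) * (\<Prod>i\<in>keys m. s i ^ lookup m i))
      = id (lookup f m) * (\<Prod>i\<in>keys m. eval_with id z (s i) ^ lookup m i)"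
      by (simp only: eval_id pw)
  qed
  finally show ?thesis .
qed

lemma mon_eq_prod: "mon m = (\<Prod>i\<in>keys m. var i ^ lookup m i)"
proof -
  have "(\<Sum>i\<in>keys m. single i (lookup m i)) = m"
  proof (rule poly_mapping_eqI)
    fix k
    have "lookup (\<Sum>i\<in>keys m. single i (lookup m i)) k
        = (\<Sum>i\<in>keys m. if i = k then lookup m i else 0)"
      unfolding lookup_sum lookup_single when_def by (intro sum.cong) auto
    also have "\<dots> = lookup m k" by (simp add: in_keys_iff)
    finally show "lookup (\<Sum>i\<in>keys m. single i (lookup m i)) k
      = lookup m k" .
  qed
  moreover have "mon (\<Sum>i\<in>A. f i) = (\<Prod>i\<in>A. mon (f i))" for A :: "nat set" and f
    by (induction A rule: infinite_finite_induct) (auto simp: mon_add)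
  ultimately have "mon m = (\<Prod>i\<in>keys m. mon (single i (lookup m i)))"
    by metis
  then show ?thesis by (simp only: mon_single)
qed

lemma eval_var_id: "f \<in> polys_in V \<Longrightarrow> (\<And>i. i \<in> V \<Longrightarrow> s i = var i) \<Longrightarrow> eval_with const s f = f"
proof -
  assume f: "f \<in> polys_in V" and s: "\<And>i. i \<in> V \<Longrightarrow> s i = var i"
  have "eval_with const s f = eval_with const var f" by (rule eval_cong[OF f s])
  also have "\<dots> = f"
    unfolding eval_with_def mon_eq_prod[symmetric] by (rule poly_eq_sum_mon[symmetric])
  finally show ?thesis .
qed

lemma homog_power: "f \<in> homog e \<Longrightarrow> f ^ k \<in> homog (k * e)"
  by (induction k) (auto intro: homog_mult)

text \<open>Substituting linear forms, possibly 0, preserves degrees. This covers both permuting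
  indeterminates and deleting them.\<close>

lemma eval_hcomp:
  assumes s: "\<And>i. s i \<in> homog 1"
  shows "eval_with const s (hcomp d f) = hcomp d (eval_with const s f)"
proof -
  let ?t = "\<lambda>m. const (lookup f m) * (\<Prod>i\<in>keys m. s i ^ lookup m i)"
  have t: "?t m \<in> homog (mdeg m)" for m
    unfolding mdeg_def using s by (intro homog_const_mult homog_prod) (metis homog_power mult_1_right)
  have "hcomp d (eval_with const s f) = (\<Sum>m\<in>keys f. if mdeg m = d then ?t m else 0)"
    unfolding eval_with_def hcomp_sum by (intro sum.cong refl) (use hcomp_homog[OF t] in auto)
  also have "\<dots> = (\<Sum>m\<in>{m\<in>keys f. mdeg m = d}. ?t m)"
    by (simp add: sum.inter_filter)
  also have "\<dots> = eval_with const s (hcomp d f)"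
    unfolding hcomp_def eval_sum[OF coeff_hom_const] eval_single[OF coeff_hom_const] ..
  finally show ?thesis ..
qed

section \<open>Ideals of \<open>poly_ring n\<close>\<close>

lemma carrier_poly_ring: "carrier (poly_ring n) = polys_in {1..n}"
  by (simp add: poly_ring_def polys_in_def)

lemma poly_ring_simps [simp]:
  "x \<oplus>\<^bsub>poly_ring n\<^esub> y = x + y" "x \<otimes>\<^bsub>poly_ring n\<^esub> y = x * y"
  "\<zero>\<^bsub>poly_ring n\<^esub> = 0" "\<one>\<^bsub>poly_ring n\<^esub> = 1"
  by (simp_all add: poly_ring_def)

lemma ring_poly_ring: "ring (poly_ring n)"
  using cring_poly_ring cring.axioms(1) by blast

lemma ideal_poly_ringI:
  assumes "I \<subseteq> polys_in {1..n}" "0 \<in> I" "\<And>f g. f \<in> I \<Longrightarrow> g \<in> I \<Longrightarrow> f + g \<in> I"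
    and mult: "\<And>f r. f \<in> I \<Longrightarrow> r \<in> polys_in {1..n} \<Longrightarrow> r * f \<in> I"
  shows "ideal I (poly_ring n)"
proof (rule idealI[OF ring_poly_ring])
  have inv: "- f \<in> I" if "f \<in> I" for f
    using mult[OF that, of "- 1"] by (simp add: polys_in_uminus)
  have gr: "group (add_monoid (poly_ring n))"
    using abelian_group.a_group ring.is_abelian_group ring_poly_ring by blast
  have inv': "inv\<^bsub>add_monoid (poly_ring n)\<^esub> f = - f" if "f \<in> I" for f
  proof (rule group.inv_equality[OF gr])
    show "- f \<otimes>\<^bsub>add_monoid (poly_ring n)\<^esub> f = \<one>\<^bsub>add_monoid (poly_ring n)\<^esub>"
      by (simp add: poly_ring_def)
    show "f \<in> carrier (add_monoid (poly_ring n))" "- f \<in> carrier (add_monoid (poly_ring n))"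
      using that assms(1) polys_in_uminus by (auto simp: carrier_poly_ring)
  qed
  show "subgroup I (add_monoid (poly_ring n))"
  proof (rule subgroup.intro)
    show "I \<subseteq> carrier (add_monoid (poly_ring n))"
      using assms(1) by (simp add: carrier_poly_ring)
    show "inv\<^bsub>add_monoid (poly_ring n)\<^esub> x \<in> I" if "x \<in> I" for x
      using inv' inv that by simp
  qed (use assms(2,3) in simp_all)
qed (use mult in \<open>auto simp: carrier_poly_ring mult.commute\<close>)

lemma ideal_poly_ringD:
  assumes "ideal I (poly_ring n)"
  shows "I \<subseteq> polys_in {1..n}" "0 \<in> I" "\<And>f g. f \<in> I \<Longrightarrow> g \<in> I \<Longrightarrow> f + g \<in> I"
    "\<And>f r. f \<in> I \<Longrightarrow> r \<in> polys_in {1..n} \<Longrightarrow> r * f \<in> I"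
proof -
  interpret ideal I "poly_ring n" by fact
  show "I \<subseteq> polys_in {1..n}" using a_subset by (simp add: carrier_poly_ring)
  show "0 \<in> I" using additive_subgroup.zero_closed[OF ideal.axioms(1)[OF assms]] by simp
  show "f + g \<in> I" if "f \<in> I" "g \<in> I" for f g using additive_subgroup.a_closed[OF ideal.axioms(1)[OF assms] that] by simp
  show "r * f \<in> I" if "f \<in> I" "r \<in> polys_in {1..n}" for f r
    using I_l_closed[of f r] that by (simp add: carrier_poly_ring)
qed

lemma Idl_ideal: "S \<subseteq> polys_in {1..n} \<Longrightarrow> ideal (Idl\<^bsub>poly_ring n\<^esub> S) (poly_ring n)"
  using ring.genideal_ideal[OF ring_poly_ring, of S] by (simp add: carrier_poly_ring)

lemma Idl_self: "S \<subseteq> polys_in {1..n} \<Longrightarrow> S \<subseteq> Idl\<^bsub>poly_ring n\<^esub> S"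
  using ring.genideal_self[OF ring_poly_ring, of S] by (simp add: carrier_poly_ring)

lemma Idl_least: "ideal I (poly_ring n) \<Longrightarrow> S \<subseteq> I \<Longrightarrow> Idl\<^bsub>poly_ring n\<^esub> S \<subseteq> I"
  by (rule ring.genideal_minimal[OF ring_poly_ring])

text \<open>The polynomials all of whose components lie in the generated ideal form an ideal that
  contains the generators.\<close>

lemma Idl_hcomp:
  assumes S: "S \<subseteq> polys_in {1..n}" and h: "\<And>f d. f \<in> S \<Longrightarrow> hcomp d f \<in> Idl\<^bsub>poly_ring n\<^esub> S"
    and f: "f \<in> Idl\<^bsub>poly_ring n\<^esub> S"
  shows "hcomp d f \<in> Idl\<^bsub>poly_ring n\<^esub> S"
proof -
  let ?I = "Idl\<^bsub>poly_ring n\<^esub> S" and ?H = "{f \<in> polys_in {1..n}. \<forall>d. hcomp d f \<in> Idl\<^bsub>poly_ring n\<^esub> S}"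
  note I = ideal_poly_ringD[OF Idl_ideal[OF S]]
  have sum: "(\<Sum>i\<in>A. g i) \<in> ?I" if "\<And>i. i \<in> A \<Longrightarrow> g i \<in> ?I" for A :: "nat set" and g
    using that by (induction A rule: infinite_finite_induct) (auto intro: I)
  have "ideal ?H (poly_ring n)"
  proof (rule ideal_poly_ringI)
    fix f r assume f: "f \<in> ?H" and r: "r \<in> polys_in {1..n}"
    obtain D where D: "\<And>m. m \<in> keys r \<Longrightarrow> mdeg m \<le> D" using ex_degree_bound by blast
    have "hcomp d (r * f) \<in> ?I" for d
    proof -
      have "hcomp d (r * f) = hcomp d ((\<Sum>k\<le>D. hcomp k r) * f)" by (simp add: sum_hcomp[OF D])
      also have "\<dots> = (\<Sum>k\<le>D. if k \<le> d then hcomp k r * hcomp (d - k) f else 0)"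
        by (simp only: sum_distrib_right hcomp_sum hcomp_mult[OF hcomp_in_homog])
      also have "\<dots> \<in> ?I" using f I(2) I(4)[OF _ polys_in_hcomp[OF r]] by (intro sum) auto
      finally show ?thesis .
    qed
    then show "r * f \<in> ?H" using f r by (auto intro: polys_in_mult)
  qed (use I in \<open>auto intro: polys_in_add\<close>)
  moreover have "S \<subseteq> ?H" using S h by auto
  ultimately have "?I \<subseteq> ?H" by (rule Idl_least)
  then show ?thesis using f by blast
qed

definition restr :: "nat \<Rightarrow> cpoly \<Rightarrow> cpoly" where
  "restr n = eval_with const (\<lambda>i. if i \<in> {1..n} then var i else 0)"

text \<open>The preimage under deleting the indeterminates outside {1..n}: the passage from ideals
  of \<open>poly_ring n\<close> to the setting of \<open>hideal\<close>, which does not change the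
  quotient.\<close>

definition ext :: "nat \<Rightarrow> cpoly set \<Rightarrow> cpoly set" where
  "ext n I = {f. restr n f \<in> I}"

lemma restr_polys_in: "restr n f \<in> polys_in {1..n}"
proof -
  have pw: "g ^ k \<in> polys_in {1..n}" if "g \<in> polys_in {1..n}" for g k
    using that by (induction k) (auto intro: polys_in_mult)
  show ?thesis
    unfolding restr_def eval_with_def by (intro polys_in_sum polys_in_mult polys_in_prod pw) (auto intro: polys_in_var)
qed

lemma restr_id: "f \<in> polys_in {1..n} \<Longrightarrow> restr n f = f"
  unfolding restr_def by (rule eval_var_id) auto

lemma hideal_ext:
  assumes I: "ideal I (poly_ring n)" and h: "\<And>f d. f \<in> I \<Longrightarrow> hcomp d f \<in> I"
  shows "hideal n (ext n I)"
proof -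
  note I = ideal_poly_ringD[OF I]
  have "restr n (hcomp d f) = hcomp d (restr n f)" for d f
    unfolding restr_def by (intro eval_hcomp) auto
  then show ?thesis
    unfolding hideal_def ext_def using I restr_polys_in h
    by (auto simp: restr_def eval_simps)
qed

lemma ext_inter: "f \<in> polys_in {1..n} \<Longrightarrow> f \<in> ext n I \<longleftrightarrow> f \<in> I"
  by (simp add: ext_def restr_id)

lemma ext_mono_iff: "I \<subseteq> polys_in {1..n} \<Longrightarrow> I' \<subseteq> polys_in {1..n} \<Longrightarrow> ext n I \<subseteq> ext n I' \<longleftrightarrow> I \<subseteq> I'"
  by (rule iffI) (meson ext_inter subset_iff, auto simp: ext_def)

lemma ext_eq_iff: "I \<subseteq> polys_in {1..n} \<Longrightarrow> I' \<subseteq> polys_in {1..n} \<Longrightarrow> ext n I = ext n I' \<longleftrightarrow> I = I'"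
  using ext_mono_iff[of I n I'] ext_mono_iff[of I' n I] by blast

lemma ext_colon_ideal:
  assumes "p \<in> polys_in {1..n}"
  shows "ext n (colon_ideal n I p) = colon (ext n I) p"
proof -
  have "restr n (p * f) = p * restr n f" for f
    using restr_id[OF assms] by (simp add: restr_def eval_mult)
  then show ?thesis
    using restr_polys_in by (auto simp: ext_def colon_ideal_def colon_def carrier_poly_ring mult.commute)
qed

section \<open>The coinvariant ideal and the points of the symmetric group\<close>

definition sym_gens :: "nat \<Rightarrow> cpoly set" where
  "sym_gens n = {f \<in> symmetric_polys n. lookup f 0 = 0}"

lemma sym_gens_polys_in: "sym_gens n \<subseteq> polys_in {1..n}"
  by (auto simp: sym_gens_def symmetric_polys_def carrier_poly_ring)

lemma coinvariant_eq: "coinvariant_ideal n = Idl\<^bsub>poly_ring n\<^esub> (sym_gens n)"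
  by (simp add: coinvariant_ideal_def sym_gens_def)

lemmas coinvariant = ideal_poly_ringD[OF Idl_ideal[OF sym_gens_polys_in], folded coinvariant_eq]

lemma sym_gens_sub: "sym_gens n \<subseteq> coinvariant_ideal n"
  unfolding coinvariant_eq by (rule Idl_self[OF sym_gens_polys_in])

lemma sym_gens_hcomp: "f \<in> sym_gens n \<Longrightarrow> hcomp d f \<in> sym_gens n"
  unfolding sym_gens_def symmetric_polys_def carrier_poly_ring
  by (auto simp: polys_in_hcomp eval_hcomp lookup_hcomp)

lemma coinvariant_hcomp: "f \<in> coinvariant_ideal n \<Longrightarrow> hcomp d f \<in> coinvariant_ideal n"
  unfolding coinvariant_eq
  by (rule Idl_hcomp[OF sym_gens_polys_in]) (rule subsetD[OF Idl_self[OF sym_gens_polys_in] sym_gens_hcomp])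

lemma hideal_coinvariant: "hideal n (ext n (coinvariant_ideal n))"
  using coinvariant_hcomp Idl_ideal[OF sym_gens_polys_in, of n, folded coinvariant_eq]
  by (rule hideal_ext[rotated])

lemma hc_sym: 
  assumes "0 < d"
  shows "hc d (image_mset var (mset_set {1..n})) \<in> sym_gens n"
proof -
  let ?h = "hc d (image_mset var (mset_set {1..n}))"
  have "eval_with const (\<lambda>i. var (\<sigma> i)) ?h = ?h" if "\<sigma> permutes {1..n}" for \<sigma>
  proof -
    have "image_mset (eval_with const (\<lambda>i. var (\<sigma> i))) (image_mset var (mset_set {1..n}))
        = image_mset var (image_mset \<sigma> (mset_set {1..n}))"
      by (simp add: image_mset.compositionality o_def eval_var)
    also have "image_mset \<sigma> (mset_set {1..n}) = mset_set {1..n}"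
      using that by (simp add: image_mset_mset_set permutes_inj_on permutes_image)
    finally show ?thesis by (simp add: eval_hc)
  qed
  moreover have "?h \<in> homog d" by (intro hc_homog) auto
  then have "hcomp d ?h = ?h" by simp
  then have "lookup ?h 0 = 0"
    using assms lookup_hcomp[of d ?h 0] by (metis less_irrefl mdeg_0)
  moreover have "?h \<in> polys_in {1..n}" by (intro polys_in_hc) (auto intro: polys_in_var)
  ultimately show ?thesis by (simp add: sym_gens_def symmetric_polys_def carrier_poly_ring)
qed

text \<open>Indeterminates are removed one by one through h_d(x_{i+1}, ..., x_n) = h_d(x_i, ...,
  x_n) - x_i h_{d-1}(x_i, ..., x_n). Each removal lowers a degree by one, whence the condition that
  d is at least i.\<close>

lemma hc_coinvariant:
  assumes "1 \<le> i" "i \<le> d" "i \<le> n"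
  shows "hc d (image_mset var (mset_set {i..n})) \<in> coinvariant_ideal n"
  using assms
proof (induction i arbitrary: d rule: dec_induct)
  case base
  then show ?case using hc_sym[of d n] sym_gens_sub by auto
next
  case (step i)
  let ?M = "image_mset var (mset_set {Suc i..n})"
  obtain e where d: "d = Suc e" "i \<le> e" using step by (cases d) auto
  have "{i..n} = insert i {Suc i..n}" using step by auto
  then have eq: "image_mset var (mset_set {i..n}) = add_mset (var i) ?M" by simp
  have "hc (Suc e) ?M = hc (Suc e) (add_mset (var i) ?M) + - var i * hc e (add_mset (var i) ?M)"
    by (simp add: hc_Suc_add)
  also have "\<dots> \<in> coinvariant_ideal n"
    using step.IH[of "Suc e"] step.IH[of e] d step.prems step.hyps
    by (intro coinvariant) (auto simp: eq intro!: polys_in_uminus polys_in_var)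
  finally show ?case using d by simp
qed

lemma p_gen_empty:
  assumes "k \<in> {1..n}"
  shows "p_gen n {} k = hc k (image_mset var (mset_set {k..n}))"
proof -
  have "{v\<in>{1..n}. k < v \<or> v \<in> {}} = {Suc k..n}" "{k..n} = insert k {Suc k..n}" using assms by auto
  then show ?thesis using assms by (simp add: p_gen_def dd_def)
qed

lemma p_gen_polys_in: "k \<in> {1..n} \<Longrightarrow> p_gen n J k \<in> polys_in {1..n}"
  unfolding p_gen_def by (intro polys_in_dd) (auto intro: polys_in_var)

lemma p_gen_coinvariant: "k \<in> {1..n} \<Longrightarrow> p_gen n {} k \<in> ext n (coinvariant_ideal n)"
  using ext_inter[OF p_gen_polys_in, of k n "{}"] hc_coinvariant[of k k n] by (simp add: p_gen_empty)

section \<open>The degree filtration and polynomials vanishing on all permutations\<close>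

definition deg_less :: "nat \<Rightarrow> cpoly set" where
  "deg_less d = {f. \<forall>m\<in>keys f. mdeg m < d}"

lemma deg_less_0 [simp]: "0 \<in> deg_less d" by (simp add: deg_less_def)
lemma deg_less_add: "f \<in> deg_less d \<Longrightarrow> g \<in> deg_less d \<Longrightarrow> f + g \<in> deg_less d"
  using Poly_Mapping.keys_add[of f g] by (auto simp: deg_less_def)
lemma deg_less_uminus: "f \<in> deg_less d \<Longrightarrow> - f \<in> deg_less d"
  by (simp add: deg_less_def)
lemma deg_less_diff: "f \<in> deg_less d \<Longrightarrow> g \<in> deg_less d \<Longrightarrow> f - g \<in> deg_less d"
  using deg_less_add[of f d "- g"] deg_less_uminus[of g d] by simp
lemma deg_less_sum: "(\<And>i. i \<in> A \<Longrightarrow> f i \<in> deg_less d) \<Longrightarrow> (\<Sum>i\<in>A. f i) \<in> deg_less d"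
  by (induction A rule: infinite_finite_induct) (auto intro: deg_less_add)
lemma deg_less_mult: "f \<in> deg_less (Suc d) \<Longrightarrow> g \<in> deg_less e \<Longrightarrow> f * g \<in> deg_less (d + e)"
  using keys_mult[of f g] by (fastforce simp: deg_less_def mdeg_add)
lemma deg_less_mono: "f \<in> deg_less d \<Longrightarrow> d \<le> e \<Longrightarrow> f \<in> deg_less e"
  by (fastforce simp: deg_less_def)
lemma homog_deg_less: "f \<in> homog d \<Longrightarrow> d < e \<Longrightarrow> f \<in> deg_less e"
  by (auto simp: homog_def deg_less_def)
lemma hcomp_deg_less: "f \<in> deg_less d \<Longrightarrow> d \<le> e \<Longrightarrow> hcomp e f = 0"
  by (rule poly_mapping_eqI) (simp add: lookup_hcomp deg_less_def, metis in_keys_iff linorder_not_less)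
lemma deg_less_Suc_hcomp: "f \<in> deg_less (Suc d) \<Longrightarrow> f - hcomp d f \<in> deg_less d"
  unfolding deg_less_def by (auto simp: in_keys_iff lookup_minus lookup_hcomp less_Suc_eq split: if_splits)
lemma deg_less_0_iff [simp]: "f \<in> deg_less 0 \<longleftrightarrow> f = 0"
  by (auto simp: deg_less_def)

definition perm_points :: "nat \<Rightarrow> (nat \<Rightarrow> complex) set" where
  "perm_points n = perm_point n ` {w. w permutes {1..n}}"

lemma vanishing_polys_in: "vanishing_ideal n Z \<subseteq> polys_in {1..n}"
  by (auto simp: vanishing_ideal_def carrier_poly_ring)

lemma vanishing_0: "0 \<in> vanishing_ideal n Z"
  by (auto simp: vanishing_ideal_def carrier_poly_ring eval_id)
lemma vanishing_add: "f \<in> vanishing_ideal n Z \<Longrightarrow> g \<in> vanishing_ideal n Z \<Longrightarrow> f + g \<in> vanishing_ideal n Z"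
  unfolding vanishing_ideal_def carrier_poly_ring mem_Collect_eq eval_id by (auto intro: polys_in_add)
lemma vanishing_diff: "f \<in> vanishing_ideal n Z \<Longrightarrow> g \<in> vanishing_ideal n Z \<Longrightarrow> f - g \<in> vanishing_ideal n Z"
  unfolding vanishing_ideal_def carrier_poly_ring mem_Collect_eq eval_id by (auto intro: polys_in_diff)
lemma vanishing_mult: "f \<in> vanishing_ideal n Z \<Longrightarrow> r \<in> polys_in {1..n} \<Longrightarrow> r * f \<in> vanishing_ideal n Z"
  unfolding vanishing_ideal_def carrier_poly_ring mem_Collect_eq eval_id by (auto intro: polys_in_mult)
lemma vanishing_sum: "(\<And>i. i \<in> A \<Longrightarrow> f i \<in> vanishing_ideal n Z) \<Longrightarrow> (\<Sum>i\<in>A. f i) \<in> vanishing_ideal n Z"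
  by (induction A rule: infinite_finite_induct) (auto intro: vanishing_0 vanishing_add)

lemma sym_const_on_perm_points:
  assumes f: "f \<in> symmetric_polys n" and z: "z \<in> perm_points n"
  shows "eval_with id z f = eval_with id (perm_point n id) f"
proof -
  obtain w where w: "w permutes {1..n}" "z = perm_point n w" using z by (auto simp: perm_points_def)
  have fPV: "f \<in> polys_in {1..n}" using f by (simp add: symmetric_polys_def carrier_poly_ring)
  have "eval_with id (perm_point n id) f
      = eval_with id (perm_point n id) (eval_with const (\<lambda>i. var (w i)) f)"
    using f w by (simp add: symmetric_polys_def)
  also have "\<dots> = eval_with id (\<lambda>i. perm_point n id (w i)) f"
    unfolding eval_subst eval_id ..
  also have "\<dots> = eval_with id z f"
  proof (rule eval_cong[OF fPV])
    fix i assume "i \<in> {1..n}"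
    then show "perm_point n id (w i) = z i"
      using permutes_in_image[OF w(1), of i] by (simp add: w(2) perm_point_def)
  qed
  finally show ?thesis ..
qed

text \<open>This is the inclusion of I_n in gr I(S_n), with zero components allowed. A symmetric
  form of positive degree takes a single value on all permutations, and subtracting this value lifts
  it. The polynomials all of whose components lift form an ideal.\<close>

lemma coinvariant_lift:
  assumes "g \<in> coinvariant_ideal n"
  shows "\<exists>h\<in>vanishing_ideal n (perm_points n). h - hcomp d g \<in> deg_less d"
proof -
  let ?V = "vanishing_ideal n (perm_points n)"
  let ?G = "{g \<in> polys_in {1..n}. \<forall>d. \<exists>h\<in>?V. h - hcomp d g \<in> deg_less d}"
  have "ideal ?G (poly_ring n)"
  proof (rule ideal_poly_ringI)
    show "0 \<in> ?G" using vanishing_0 by (auto intro!: bexI[of _ 0])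
    fix f g assume f: "f \<in> ?G" and g: "g \<in> ?G"
    have "\<exists>h\<in>?V. h - hcomp d (f + g) \<in> deg_less d" for d
    proof -
      obtain u v where uv: "u \<in> ?V" "u - hcomp d f \<in> deg_less d" "v \<in> ?V" "v - hcomp d g \<in> deg_less d"
        using f g by blast
      have "(u + v) - hcomp d (f + g) \<in> deg_less d"
        using deg_less_add[OF uv(2,4)] by (simp add: algebra_simps)
      then show ?thesis using vanishing_add[OF uv(1,3)] by blast
    qed
    then show "f + g \<in> ?G" using f g by (auto intro: polys_in_add)
  next
    fix f r assume f: "f \<in> ?G" and r: "r \<in> polys_in {1..n}"
    obtain D where D: "\<And>m. m \<in> keys r \<Longrightarrow> mdeg m \<le> D" using ex_degree_bound by blast
    have "\<exists>h\<in>?V. h - hcomp d (r * f) \<in> deg_less d" for d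
    proof -
      have "\<forall>d. \<exists>h. h \<in> ?V \<and> h - hcomp d f \<in> deg_less d" using f by blast
      then obtain u where u: "\<And>d. u d \<in> ?V" "\<And>d. u d - hcomp d f \<in> deg_less d"
        by (auto dest!: choice)
      let ?h = "\<Sum>k\<le>D. if k \<le> d then hcomp k r * u (d - k) else 0"
      have "hcomp d (r * f) = hcomp d ((\<Sum>k\<le>D. hcomp k r) * f)" by (simp add: sum_hcomp[OF D])
      also have "\<dots> = (\<Sum>k\<le>D. if k \<le> d then hcomp k r * hcomp (d - k) f else 0)"
        by (simp only: sum_distrib_right hcomp_sum hcomp_mult[OF hcomp_in_homog])
      finally have "?h - hcomp d (r * f) = (\<Sum>k\<le>D. if k \<le> d then hcomp k r * (u (d - k) - hcomp (d - k) f) else 0)"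
        by (simp add: sum_subtractf[symmetric] right_diff_distrib if_distrib cong: if_cong)
      also have "\<dots> \<in> deg_less d"
      proof (rule deg_less_sum)
        fix k
        have "hcomp k r * (u (d - k) - hcomp (d - k) f) \<in> deg_less (k + (d - k))"
          by (intro deg_less_mult u homog_deg_less[OF hcomp_in_homog]) simp
        then show "(if k \<le> d then hcomp k r * (u (d - k) - hcomp (d - k) f) else 0) \<in> deg_less d"
          by (cases "k \<le> d") auto
      qed
      finally have "?h - hcomp d (r * f) \<in> deg_less d" .
      moreover have "?h \<in> ?V"
        using u(1) vanishing_0 vanishing_mult[OF u(1) polys_in_hcomp[OF r]] by (intro vanishing_sum) auto
      ultimately show ?thesis by blast
    qed
    then show "r * f \<in> ?G" using f r by (auto intro: polys_in_mult)
  qed auto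
  moreover have "sym_gens n \<subseteq> ?G"
  proof
    fix f assume f: "f \<in> sym_gens n"
    have "\<exists>h\<in>?V. h - hcomp d f \<in> deg_less d" for d
    proof (cases "d = 0")
      case True
      have "hcomp 0 f = 0"
        using f by (intro poly_mapping_eqI) (auto simp: lookup_hcomp sym_gens_def)
      then show ?thesis using True vanishing_0 by auto
    next
      case False
      let ?g = "hcomp d f" and ?c = "eval_with id (perm_point n id) (hcomp d f)"
      have g: "?g \<in> symmetric_polys n" using sym_gens_hcomp[OF f] by (simp add: sym_gens_def)
      have gPV: "?g \<in> polys_in {1..n}" using g by (simp add: symmetric_polys_def carrier_poly_ring)
      have "eval_with id z (?g - const ?c) = 0" if "z \<in> perm_points n" for z
        unfolding eval_id using sym_const_on_perm_points[OF g that] by simp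
      then have "?g - const ?c \<in> ?V"
        using gPV unfolding vanishing_ideal_def carrier_poly_ring by (auto intro: polys_in_diff)
      moreover have "?g - const ?c - ?g \<in> deg_less d"
        using deg_less_uminus[OF homog_deg_less[OF homog_const, of d ?c]] False by simp
      ultimately show ?thesis by blast
    qed
    then show "f \<in> ?G" using f sym_gens_polys_in by auto
  qed
  ultimately have "coinvariant_ideal n \<subseteq> ?G" unfolding coinvariant_eq by (rule Idl_least)
  then show ?thesis using assms by blast
qed

text \<open>Fix the last coordinate t. The others run over the bijections onto T - {t}, so by
  induction each coefficient, a polynomial in t of degree below card T, vanishes at every element of
  T and is zero. T is arbitrary because the induction removes elements from it.\<close>

lemma stair_coeffs_0:
  fixes c :: "(nat \<Rightarrow>\<^sub>0 nat) \<Rightarrow> complex"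
  assumes "finite T" "card T = n"
    and "\<And>z. bij_betw z {1..n} T \<Longrightarrow>
      (\<Sum>a\<in>stair_exps (Suc n). c a * (\<Prod>i\<in>{1..n}. z i ^ lookup a i)) = 0"
    and "a \<in> stair_exps (Suc n)"
  shows "c a = 0"
  using assms
proof (induction n arbitrary: T c a)
  case 0
  then show ?case using 0(3)[of "\<lambda>_. 0"] by (simp add: stair_exps_1 bij_betw_def)
next
  case (Suc n)
  let ?s = "\<lambda>e. single (Suc n) e"
  define d where "d t a = (\<Sum>e<Suc n. c (a + ?s e) * t ^ e)" for t a
  have d0: "d t a = 0" if t: "t \<in> T" and a: "a \<in> stair_exps (Suc n)" for t a
  proof (rule Suc.IH[of "T - {t}" "d t"])
    show "finite (T - {t})" "card (T - {t}) = n" using Suc.prems t by auto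
    fix z assume z: "bij_betw z {1..n} (T - {t})"
    let ?z = "z(Suc n := t)"
    have "bij_betw ?z {1..n} (T - {t})" using z by (subst bij_betw_cong[of _ _ z]) auto
    moreover have "bij_betw ?z {Suc n} {t}" by (simp add: bij_betw_def)
    ultimately have "bij_betw ?z ({1..n} \<union> {Suc n}) (T - {t} \<union> {t})"
      by (rule bij_betw_combine) auto
    moreover have "{1..n} \<union> {Suc n} = {1..Suc n}" "T - {t} \<union> {t} = T" using t by auto
    ultimately have bij: "bij_betw ?z {1..Suc n} T" by simp
    have lk: "lookup a (Suc n) = 0" if "a \<in> stair_exps (Suc n)" for a
      using that by (auto simp: stair_exps_def in_keys_iff)
    have "0 = (\<Sum>a\<in>stair_exps (Suc (Suc n)). c a * (\<Prod>i\<in>{1..Suc n}. ?z i ^ lookup a i))"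
      using Suc.prems(3)[OF bij] by simp
    also have "\<dots> = (\<Sum>p\<in>stair_exps (Suc n) \<times> {..<Suc n}. (\<lambda>a. c a * (\<Prod>i\<in>{1..Suc n}. ?z i ^ lookup a i))
        ((\<lambda>(a, e). a + ?s e) p))"
      by (rule sum.reindex_bij_betw[OF stair_exps_Suc[OF zero_less_Suc], symmetric])
    also have "\<dots> = (\<Sum>(a, e)\<in>stair_exps (Suc n) \<times> {..<Suc n}. c (a + ?s e) * t ^ e * (\<Prod>i\<in>{1..n}. z i ^ lookup a i))"
    proof (intro sum.cong refl, clarify)
      fix a e assume a: "a \<in> stair_exps (Suc n)"
      have "(\<Prod>i\<in>{1..Suc n}. ?z i ^ lookup (a + ?s e) i)
          = t ^ e * (\<Prod>i\<in>{1..n}. ?z i ^ lookup (a + ?s e) i)"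
        using lk[OF a] by (simp add: lookup_add)
      also have "(\<Prod>i\<in>{1..n}. ?z i ^ lookup (a + ?s e) i) = (\<Prod>i\<in>{1..n}. z i ^ lookup a i)"
        by (intro prod.cong) (auto simp: lookup_add lookup_single when_def)
      finally show "c (a + ?s e) * (\<Prod>i\<in>{1..Suc n}. ?z i ^ lookup (a + ?s e) i)
        = c (a + ?s e) * t ^ e * (\<Prod>i\<in>{1..n}. z i ^ lookup a i)" by simp
    qed
    also have "\<dots> = (\<Sum>a\<in>stair_exps (Suc n). d t a * (\<Prod>i\<in>{1..n}. z i ^ lookup a i))"
      unfolding d_def sum_distrib_right by (rule sum.cartesian_product[symmetric])
    finally show "(\<Sum>a\<in>stair_exps (Suc n). d t a * (\<Prod>i\<in>{1..n}. z i ^ lookup a i)) = 0" by simp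
  qed (rule a)
  obtain b e where be: "a = b + ?s e" "b \<in> stair_exps (Suc n)" "e < Suc n"
  proof -
    have "a \<in> (\<lambda>(a, e). a + ?s e) ` (stair_exps (Suc n) \<times> {..<Suc n})"
      using Suc.prems(4) bij_betw_imp_surj_on[OF stair_exps_Suc[of "Suc n"]] by simp
    then obtain q where q: "a = (\<lambda>(a, e). a + ?s e) q" "q \<in> stair_exps (Suc n) \<times> {..<Suc n}"
      by (rule imageE)
    show ?thesis using that[of "fst q" "snd q"] q by (auto simp: case_prod_unfold mem_Times_iff)
  qed
  define p where "p = (\<Sum>e<Suc n. Polynomial.monom (c (b + ?s e)) e)"
  have "poly p t = d t b" for t
    unfolding p_def d_def poly_sum poly_monom ..
  then have roots: "T \<subseteq> {t. poly p t = 0}" using d0 be by auto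
  have "p = 0"
  proof (rule ccontr)
    assume p: "p \<noteq> 0"
    have "card T \<le> card {t. poly p t = 0}" using roots p by (intro card_mono poly_roots_finite)
    also have "\<dots> \<le> Polynomial.degree p" using p by (rule card_poly_roots_bound)
    also have "Polynomial.degree p \<le> n"
      unfolding p_def by (intro degree_sum_le) (auto intro: order.trans[OF degree_monom_le])
    finally show False using Suc.prems by simp
  qed
  then have "Polynomial.coeff p e = 0" by simp
  then show "c a = 0" using be unfolding p_def by (simp add: coeff_sum sum.delta del: sum.lessThan_Suc)
qed

lemma span_mon: "finite A \<Longrightarrow> cp.span (mon ` A) = range (\<lambda>c. \<Sum>a\<in>A. const (c a) * mon a)"
proof -
  assume A: "finite A"
  have inj: "inj_on mon A"
    by (rule inj_onI) (metis keys_single singleton_inject zero_neq_one)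
  have "cp.span (mon ` A) = range (\<lambda>u. \<Sum>v\<in>mon ` A. const (u v) * v)"
    using A by (intro cp.span_finite) simp
  also have "\<dots> = range (\<lambda>c. \<Sum>a\<in>A. const (c a) * mon a)"
  proof (intro subset_antisym subsetI)
    fix x assume "x \<in> range (\<lambda>u. \<Sum>v\<in>mon ` A. const (u v) * v)"
    then obtain u where x: "x = (\<Sum>v\<in>mon ` A. const (u v) * v)" by blast
    have "x = (\<Sum>a\<in>A. const ((u \<circ> mon) a) * mon a)"
      unfolding x using inj by (simp add: sum.reindex)
    then show "x \<in> range (\<lambda>c. \<Sum>a\<in>A. const (c a) * mon a)" by blast
  next
    fix x assume "x \<in> range (\<lambda>c. \<Sum>a\<in>A. const (c a) * mon a)"
    then obtain c where x: "x = (\<Sum>a\<in>A. const (c a) * mon a)" by blast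
    have "x = (\<Sum>v\<in>mon ` A. const ((c \<circ> the_inv_into A mon) v) * v)"
      unfolding x sum.reindex[OF inj] by (intro sum.cong) (simp_all add: the_inv_into_f_f[OF inj])
    then show "x \<in> range (\<lambda>u. \<Sum>v\<in>mon ` A. const (u v) * v)" by blast
  qed
  finally show ?thesis .
qed

lemma stair_vanishing_0:
  assumes s: "s \<in> cp.span (mon ` stair_exps (Suc n))" and v: "s \<in> vanishing_ideal n (perm_points n)"
  shows "s = 0"
proof -
  obtain c where c: "s = (\<Sum>a\<in>stair_exps (Suc n). const (c a) * mon a)"
    using s span_mon[OF finite_stair_exps] by auto
  define T where "T = (of_nat ` {1..n} :: complex set)"
  have inj: "inj_on (of_nat :: nat \<Rightarrow> complex) {1..n}" by (simp add: inj_on_def)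
  have "c a = 0" if "a \<in> stair_exps (Suc n)" for a
  proof (rule stair_coeffs_0[OF _ _ _ that])
    show "finite T" "card T = n" using inj by (simp_all add: T_def card_image)
    fix z :: "nat \<Rightarrow> complex" assume z: "bij_betw z {1..n} T"
    define w where "w i = (if i \<in> {1..n} then inv_into {1..n} of_nat (z i) else i)" for i
    have "bij_betw (inv_into {1..n} of_nat) T {1..n}"
      unfolding T_def using inj by (intro bij_betw_inv_into) (simp add: bij_betw_def)
    from bij_betw_trans[OF z this] have "bij_betw w {1..n} {1..n}"
      by (subst bij_betw_cong[of _ _ "inv_into {1..n} of_nat \<circ> z"]) (auto simp: w_def)
    then have w: "w permutes {1..n}" by (rule bij_imp_permutes) (unfold w_def, rule if_not_P)
    have wz: "perm_point n w i = z i" if "i \<in> {1..n}" for i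
    proof -
      have "z i \<in> of_nat ` {1..n}" using z that unfolding T_def bij_betw_def by blast
      then show ?thesis using that by (simp add: perm_point_def w_def f_inv_into_f)
    qed
    have "0 = eval_with id (perm_point n w) s"
      using v w by (auto simp: vanishing_ideal_def perm_points_def)
    also have "\<dots> = (\<Sum>a\<in>stair_exps (Suc n). c a * (\<Prod>i\<in>{1..n}. z i ^ lookup a i))"
      unfolding c eval_id
    proof (intro sum.cong refl)
      fix a assume "a \<in> stair_exps (Suc n)"
      then have k: "keys a \<subseteq> {1..n}" by (auto simp: stair_exps_def)
      have "eval_with id (perm_point n w) (mon a) = (\<Prod>i\<in>{1..n}. perm_point n w i ^ lookup a i)"
        unfolding eval_single[OF coeff_hom_id] by (simp add: monomial_value_superset[OF _ k])
      also have "\<dots> = (\<Prod>i\<in>{1..n}. z i ^ lookup a i)" by (simp add: wz)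
      finally show "id (c a) * eval_with id (perm_point n w) (mon a)
        = c a * (\<Prod>i\<in>{1..n}. z i ^ lookup a i)" by simp
    qed
    finally show "(\<Sum>a\<in>stair_exps (Suc n). c a * (\<Prod>i\<in>{1..n}. z i ^ lookup a i)) = 0" ..
  qed
  then show ?thesis by (simp add: c)
qed

lemma mult_spanned_coinvariant: "mult_spanned (stair_exps (Suc n)) {} (ext n (coinvariant_ideal n))"
proof -
  let ?I = "ext n (coinvariant_ideal n)"
  have "mult_spanned (stair_exps (Suc i)) {Suc i..n} ?I" if "i \<le> n" for i
    using that
  proof (induction i)
    case 0
    then show ?case using mult_spanned_full[OF hideal_coinvariant] by (simp add: stair_exps_1)
  next
    case (Suc i)
    have "hc (Suc i) (image_mset var (mset_set {Suc i..n})) \<in> ?I"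
      using p_gen_coinvariant[of "Suc i" n] p_gen_empty[of "Suc i" n] Suc.prems by simp
    then show ?case using Suc by (intro mult_spanned_monic[OF hideal_coinvariant _ zero_less_Suc]) auto
  qed
  from this[of n] show ?thesis by simp
qed

abbreviation stair_mons :: "nat \<Rightarrow> nat \<Rightarrow> cpoly set" where
  "stair_mons n d \<equiv> mon ` {a\<in>stair_exps (Suc n). mdeg a = d}"

lemma stair_mons_span:
  assumes "s \<in> cp.span (stair_mons n d)"
  shows "s \<in> homog d" "s \<in> polys_in {1..n}" "s \<in> cp.span (mon ` stair_exps (Suc n))"
proof -
  show "s \<in> homog d" using span_homog[of "stair_mons n d" d] assms by (auto intro: homog_single)
  have "cp.span (stair_mons n d) \<subseteq> polys_in {1..n}"
    by (rule cp.span_minimal) (auto simp: cp.subspace_def stair_exps_def intro!: polys_in_add polys_in_mult polys_in_mon)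
  then show "s \<in> polys_in {1..n}" using assms by blast
  show "s \<in> cp.span (mon ` stair_exps (Suc n))"
    using cp.span_mono[of "stair_mons n d" "mon ` stair_exps (Suc n)"] assms by blast
qed

lemma reduce_homogeneous:
  assumes f: "f \<in> homog d" "f \<in> polys_in {1..n}"
  shows "\<exists>s\<in>cp.span (stair_mons n d). f - s \<in> coinvariant_ideal n"
proof -
  let ?I = "ext n (coinvariant_ideal n)"
  have eq: "mult_mons (stair_exps (Suc n)) {} d = stair_mons n d" unfolding mult_mons_def by auto
  have "f \<in> cp.span (mon ` keys f)"
    by (subst poly_eq_sum_mon) (intro cp.span_sum cp.span_scale cp.span_base imageI)
  moreover have "\<exists>y\<in>cp.span (stair_mons n d). x - y \<in> ?I" if "x \<in> mon ` keys f" for x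
  proof -
    obtain m where m: "x = mon m" "mdeg m = d" using \<open>x \<in> _\<close> f(1) by (auto simp: homog_def)
    show ?thesis
      using mult_spanned_coinvariant[of n, unfolded mult_spanned_def, rule_format, of m] unfolding m eq .
  qed
  ultimately obtain s where s: "s \<in> cp.span (stair_mons n d)" "f - s \<in> ?I"
    using span_mod[OF hideal_coinvariant] by blast
  then have "f - s \<in> coinvariant_ideal n"
    using ext_inter[OF polys_in_diff[OF f(2) stair_mons_span(2)[OF s(1)]]] by blast
  then show ?thesis using s(1) by blast
qed

text \<open>Modulo I_n the degree-d part of f is a combination s of Artin's monomials. The
  difference lifts to some h vanishing on all permutations, so that subtracting h and s leaves lower
  degree only.\<close>

lemma reduce_step:
  assumes f: "f \<in> deg_less (Suc d)" "f \<in> polys_in {1..n}"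
  obtains s h where "s \<in> cp.span (stair_mons n d)" "hcomp d f - s \<in> coinvariant_ideal n"
    "h \<in> vanishing_ideal n (perm_points n)" "f - h - s \<in> deg_less d" "f - h - s \<in> polys_in {1..n}"
proof -
  obtain s where s: "s \<in> cp.span (stair_mons n d)" "hcomp d f - s \<in> coinvariant_ideal n"
    using reduce_homogeneous[OF hcomp_in_homog polys_in_hcomp[OF f(2)]] by blast
  note s' = stair_mons_span[OF s(1)]
  obtain h where h: "h \<in> vanishing_ideal n (perm_points n)" "h - hcomp d (hcomp d f - s) \<in> deg_less d"
    using coinvariant_lift[OF s(2)] by blast
  have "hcomp d (hcomp d f - s) = hcomp d f - s"
    using s'(1) hcomp_homog[OF hcomp_in_homog[of d f], of d] by simp
  from deg_less_diff[OF deg_less_Suc_hcomp[OF f(1)] h(2)[unfolded this]]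
  have "(f - hcomp d f) - (h - (hcomp d f - s)) \<in> deg_less d" .
  then have "f - h - s \<in> deg_less d" by (simp add: algebra_simps)
  moreover have "f - h - s \<in> polys_in {1..n}"
    using f(2) h(1) s'(2) vanishing_polys_in by (intro polys_in_diff) auto
  ultimately show ?thesis using that s h(1) by blast
qed

lemma reduce:
  assumes "f \<in> deg_less d" "f \<in> polys_in {1..n}"
  shows "\<exists>s\<in>cp.span (mon ` stair_exps (Suc n)). s \<in> deg_less d \<and> f - s \<in> vanishing_ideal n (perm_points n)"
  using assms
proof (induction d arbitrary: f)
  case 0
  then show ?case using vanishing_0 cp.span_zero by (intro bexI[of _ 0]) auto
next
  case (Suc d)
  obtain s h where s: "s \<in> cp.span (stair_mons n d)"
    and h: "h \<in> vanishing_ideal n (perm_points n)" "f - h - s \<in> deg_less d" "f - h - s \<in> polys_in {1..n}"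
    using reduce_step[OF Suc.prems] by blast
  obtain s' where s': "s' \<in> cp.span (mon ` stair_exps (Suc n))" "s' \<in> deg_less d" "f - h - s - s' \<in> vanishing_ideal n (perm_points n)"
    using Suc.IH[OF h(2,3)] by blast
  have "f - (s + s') = h + (f - h - s - s')" by simp
  also have "\<dots> \<in> vanishing_ideal n (perm_points n)" by (rule vanishing_add[OF h(1) s'(3)])
  finally have "f - (s + s') \<in> vanishing_ideal n (perm_points n)" .
  moreover have "s + s' \<in> deg_less (Suc d)"
    using homog_deg_less[OF stair_mons_span(1)[OF s], of "Suc d"] deg_less_mono[OF s'(2), of "Suc d"] by (intro deg_less_add) auto
  moreover have "s + s' \<in> cp.span (mon ` stair_exps (Suc n))"
    using stair_mons_span(3)[OF s] s'(1) by (rule cp.span_add)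
  ultimately show ?case by blast
qed

text \<open>This is the inclusion of gr I(S_n) in I_n. Reducing f degree by degree leaves a
  combination of Artin's monomials that vanishes on all permutations, hence is zero. So its degree-d
  part s is zero, and the degree-d part of f lies in I_n.\<close>

lemma top_of_vanishing:
  assumes f: "f \<in> vanishing_ideal n (perm_points n)" "f \<in> deg_less (Suc d)"
  shows "hcomp d f \<in> coinvariant_ideal n"
proof -
  have fPV: "f \<in> polys_in {1..n}" using f(1) vanishing_polys_in by blast
  obtain s h where s: "s \<in> cp.span (stair_mons n d)" "hcomp d f - s \<in> coinvariant_ideal n"
    and h: "h \<in> vanishing_ideal n (perm_points n)" "f - h - s \<in> deg_less d" "f - h - s \<in> polys_in {1..n}"
    using reduce_step[OF f(2) fPV] by blast
  obtain s' where s': "s' \<in> cp.span (mon ` stair_exps (Suc n))" "s' \<in> deg_less d" "f - h - s - s' \<in> vanishing_ideal n (perm_points n)"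
    using reduce[OF h(2,3)] by blast
  have "s + s' = f - h - (f - h - s - s')" by simp
  also have "\<dots> \<in> vanishing_ideal n (perm_points n)" by (intro vanishing_diff f h s')
  finally have "s + s' = 0"
    using stair_mons_span(3)[OF s(1)] s'(1) by (intro stair_vanishing_0 cp.span_add)
  then have "hcomp d (s + s') = 0" by simp
  then have "s = 0" using stair_mons_span(1)[OF s(1)] hcomp_deg_less[OF s'(2), of d] by simp
  then show ?thesis using s(2) by simp
qed

lemma stair_coinvariant_0:
  assumes s: "s \<in> cp.span (stair_mons n d)" "s \<in> coinvariant_ideal n"
  shows "s = 0"
proof -
  note s3 = stair_mons_span[OF s(1)]
  obtain h where h: "h \<in> vanishing_ideal n (perm_points n)" "h - hcomp d s \<in> deg_less d"
    using coinvariant_lift[OF s(2)] by blast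
  have h2: "h - s \<in> deg_less d" "h - s \<in> polys_in {1..n}" using h s3 vanishing_polys_in by (auto intro: polys_in_diff)
  obtain s' where s': "s' \<in> cp.span (mon ` stair_exps (Suc n))" "s' \<in> deg_less d" "h - s - s' \<in> vanishing_ideal n (perm_points n)"
    using reduce[OF h2] by blast
  have "s + s' = h - (h - s - s')" by simp
  also have "\<dots> \<in> vanishing_ideal n (perm_points n)" by (intro vanishing_diff h s')
  finally have "s + s' = 0"
    using s3(3) s'(1) by (intro stair_vanishing_0 cp.span_add)
  then have "hcomp d (s + s') = 0" by simp
  then show "s = 0" using s3(1) hcomp_deg_less[OF s'(2), of d] by simp
qed

text \<open>Artin's monomials of degree d are independent modulo the ideal. Hence so are their
  representatives in the span of a smallest spanning set, and they cannot outnumber that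
  set.\<close>

lemma stair_le_coinvariant: "stair_series n {} \<preceq> hser (ext n (coinvariant_ideal n))"
  unfolding fps_le_def
proof
  fix d
  let ?I = "ext n (coinvariant_ideal n)" and ?A = "{a\<in>stair_exps (Suc n). mdeg a = d}"
  note I = hideal_coinvariant[of n]
  have fin: "finite ?A" using finite_stair_exps by simp
  obtain B where B: "spans ?I d B" "card B = qdim ?I d" using ex_qdim[OF I] .
  have "\<forall>a\<in>?A. \<exists>y. y \<in> cp.span B \<and> mon a - y \<in> ?I"
    using B(1) homog_single unfolding spans_def by blast
  then obtain y where y: "\<And>a. a \<in> ?A \<Longrightarrow> y a \<in> cp.span B" "\<And>a. a \<in> ?A \<Longrightarrow> mon a - y a \<in> ?I"
    by (metis (no_types, lifting) bchoice)
  have zero: "c a = 0" if c: "(\<Sum>a\<in>?A. const (c a) * y a) = 0" and a: "a \<in> ?A" for c a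
  proof -
    let ?s = "\<Sum>a\<in>?A. const (c a) * mon a"
    have s: "?s \<in> cp.span (stair_mons n d)"
      by (intro cp.span_sum cp.span_scale cp.span_base imageI)
    have "?s = (\<Sum>a\<in>?A. const (c a) * (mon a - y a))"
      using c by (simp add: right_diff_distrib sum_subtractf)
    also have "\<dots> \<in> ?I" using y(2) by (intro hideal_sum[OF I] hideal_mult[OF I])
    finally have "?s \<in> coinvariant_ideal n"
      using ext_inter[OF stair_mons_span(2)[OF s]] by blast
    then have "?s = 0" by (rule stair_coinvariant_0[OF s])
    then have "lookup ?s a = 0" by simp
    moreover have "lookup ?s a = (\<Sum>a'\<in>?A. if a' = a then c a' else 0)"
      unfolding lookup_sum lookup_const_mult lookup_single when_def by (intro sum.cong) auto
    ultimately show ?thesis using fin a by simp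
  qed
  have inj: "inj_on y ?A"
  proof (rule inj_onI, rule ccontr)
    fix a b assume ab: "a \<in> ?A" "b \<in> ?A" "y a = y b" "a \<noteq> b"
    let ?c = "\<lambda>x. if x = a then 1 else if x = b then -1 else 0"
    have "(\<Sum>x\<in>?A. const (?c x) * y x) = (\<Sum>x\<in>{a, b}. const (?c x) * y x)"
      using ab fin by (intro sum.mono_neutral_right) auto
    also have "\<dots> = 0" using ab by (simp add: const_uminus)
    finally show False using zero[of ?c a] ab(1) by simp
  qed
  have "cp.independent (y ` ?A)"
  proof (rule cp.independent_if_scalars_zero)
    fix f x assume f: "(\<Sum>x\<in>y ` ?A. const (f x) * x) = 0" and x: "x \<in> y ` ?A"
    have "(\<Sum>a\<in>?A. const ((f \<circ> y) a) * y a) = 0"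
      using f inj by (simp add: sum.reindex)
    from zero[OF this] x show "f x = 0" by auto
  qed (use fin in simp)
  then have "card (y ` ?A) \<le> card B"
    using B(1) y(1) by (intro cp.independent_span_bound[THEN conjunct2]) (auto simp: spans_def)
  then have "card ?A \<le> qdim ?I d" using inj B(2) by (simp add: card_image)
  moreover have "stair_series n {} = exp_series (stair_exps (Suc n))"
    unfolding exp_series_stair_exps stair_series_def by (simp add: staircase_eq)
  ultimately show "fps_nth (stair_series n {}) d \<le> fps_nth (hser ?I) d"
    using exp_series_nth[OF finite_stair_exps] by (simp add: hser_def)
qed

section \<open>The locus of Nietzschean permutations\<close>

text \<open>The polynomial g is the degree-d leading form of f, or 0 if f has smaller degree.
  Admitting 0 makes the relation stable under products, and under sums in one degree, without any
  test for zero.\<close>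

definition approx :: "nat \<Rightarrow> cpoly \<Rightarrow> cpoly \<Rightarrow> bool" where
  "approx d f g \<longleftrightarrow> g \<in> homog d \<and> f - g \<in> deg_less d"

lemma approx_deg_less: "approx d f g \<Longrightarrow> f \<in> deg_less (Suc d)"
proof -
  assume "approx d f g"
  then have "(f - g) + g \<in> deg_less (Suc d)"
    unfolding approx_def by (intro deg_less_add) (auto intro: deg_less_mono homog_deg_less)
  then show ?thesis by simp
qed

lemma approx_hcomp: "approx d f g \<Longrightarrow> hcomp d f = g"
  using hcomp_deg_less[of "f - g" d d] by (auto simp: approx_def)

lemma approx_mult:
  assumes "approx d f g" "approx e f' g'"
  shows "approx (d + e) (f * f') (g * g')"
proof -
  have gs: "g \<in> homog d" "f - g \<in> deg_less d" "f' - g' \<in> deg_less e" using assms by (auto simp: approx_def)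
  have "f' * (f - g) \<in> deg_less (e + d)" "g * (f' - g') \<in> deg_less (d + e)"
    by (rule deg_less_mult[OF approx_deg_less[OF assms(2)] gs(2)], rule deg_less_mult[OF homog_deg_less[OF gs(1) lessI] gs(3)])
  then have "f' * (f - g) + g * (f' - g') \<in> deg_less (d + e)" by (intro deg_less_add) (simp_all add: add.commute)
  moreover have "f' * (f - g) + g * (f' - g') = f * f' - g * g'" by (simp add: algebra_simps)
  ultimately show ?thesis using assms homog_mult by (auto simp: approx_def)
qed

lemma approx_prod:
  "(\<And>i. i \<in> A \<Longrightarrow> approx (d i) (f i) (g i)) \<Longrightarrow> approx (\<Sum>i\<in>A. d i) (\<Prod>i\<in>A. f i) (\<Prod>i\<in>A. g i)"
proof (induction A rule: infinite_finite_induct)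
  case (insert x F)
  then show ?case by (simp add: approx_mult)
qed (auto simp: approx_def)

lemma approx_var_add: "approx 1 (var i + const c) (var i)"
  using homog_deg_less[OF homog_const[of c], of 1] by (simp add: approx_def)

lemma approx_hc:
  assumes "\<And>b. b \<in># M \<Longrightarrow> approx 1 (f b) (g b)"
  shows "approx d (hc d (image_mset f M)) (hc d (image_mset g M))"
  using assms
proof (induction M arbitrary: d)
  case empty then show ?case by (cases d) (auto simp: approx_def)
next
  case (add b M)
  have IH: "approx e (hc e (image_mset f M)) (hc e (image_mset g M))" for e
    using add by auto
  show ?case
  proof (induction d)
    case (Suc d)
    have "approx (1 + d) (f b * hc d (image_mset f (add_mset b M))) (g b * hc d (image_mset g (add_mset b M)))"
      using add.prems Suc by (intro approx_mult) auto
    then show ?case using IH[of "Suc d"]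
      by (auto simp: approx_def hc_Suc_add algebra_simps dest: deg_less_add)
  qed (simp add: approx_def)
qed

lemma top_component_hcomp: "top_component f = hcomp (total_degree f) f"
  by (simp add: top_component_def hcomp_def)

lemma total_degree_deg_less: "f \<in> deg_less (Suc (total_degree f))"
  by (auto simp: deg_less_def total_degree_def less_Suc_eq_le)

lemma approx_top: "f \<noteq> 0 \<Longrightarrow> approx (total_degree f) f (top_component f)"
  using deg_less_Suc_hcomp[OF total_degree_deg_less] by (simp add: approx_def top_component_hcomp)

lemma top_component_approx:
  assumes "approx d f g" "g \<noteq> 0"
  shows "f \<noteq> 0" "top_component f = g"
proof -
  show "f \<noteq> 0" using approx_hcomp[OF assms(1)] assms(2) by auto
  obtain m where m: "lookup g m \<noteq> 0"
    using assms(2) by (metis lookup_zero poly_mapping_eqI)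
  then have "mdeg m = d" "lookup f m \<noteq> 0"
    using approx_hcomp[OF assms(1)] by (metis lookup_hcomp)+
  then have "d \<in> mdeg ` keys f" by (auto simp: in_keys_iff)
  moreover have "x \<le> d" if "x \<in> mdeg ` keys f" for x
    using approx_deg_less[OF assms(1)] that by (auto simp: deg_less_def)
  ultimately have "total_degree f = d"
    unfolding total_degree_def by (intro Max_eqI) auto
  then show "top_component f = g"
    using approx_hcomp[OF assms(1)] by (simp add: top_component_hcomp)
qed

section \<open>Deformed generators that vanish on the locus\<close>

definition root_poly :: "nat \<Rightarrow> complex Polynomial.poly" where
  "root_poly n = (\<Prod>a\<in>{1..n}. [:- of_nat a, 1:])"

lemma degree_root_poly: "Polynomial.degree (root_poly n) = n"
  unfolding root_poly_def by (subst degree_prod_eq_sum_degree) auto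

lemma coeff_root_poly: "Polynomial.coeff (root_poly n) n = 1"
proof -
  have "Polynomial.lead_coeff (root_poly n) = 1"
    unfolding root_poly_def lead_coeff_prod by simp
  then show ?thesis by (simp add: degree_root_poly)
qed

text \<open>By linearity the sum is the divided difference of P at T. At a single node it is a value
  of P; for distinct a and b in T, its product with a - b is a difference of two divided differences
  at fewer nodes.\<close>

lemma dd_roots:
  assumes "finite T" "T \<noteq> {}" "\<And>t. t \<in> T \<Longrightarrow> poly P t = 0"
  shows "(\<Sum>i\<le>Polynomial.degree P. Polynomial.coeff P i * dd i (mset_set T)) = (0 :: complex)"
  using assms
proof (induction "card T" arbitrary: T rule: less_induct)
  case less
  let ?G = "\<lambda>M. \<Sum>i\<le>Polynomial.degree P. Polynomial.coeff P i * dd i M"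
  obtain a where a: "a \<in> T" using less.prems by blast
  show ?case
  proof (cases "T = {a}")
    case True
    then show ?thesis using less.prems(3)[OF a] by (simp add: dd_single poly_altdef)
  next
    case False
    then obtain b where b: "b \<in> T" "b \<noteq> a" using a by blast
    define M where "M = mset_set (T - {a} - {b})"
    have fin: "finite T" using less.prems by simp
    have T: "mset_set T = add_mset a (add_mset b M)" "mset_set (T - {b}) = add_mset a M"
      "mset_set (T - {a}) = add_mset b M"
    proof -
      show *: "mset_set (T - {a}) = add_mset b M"
        unfolding M_def using fin b by (subst mset_set.remove[of _ b]) auto
      show "mset_set T = add_mset a (add_mset b M)"
        using fin a * by (subst mset_set.remove[of _ a]) auto
      have "T - {b} - {a} = T - {a} - {b}" by auto
      then show "mset_set (T - {b}) = add_mset a M"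
        unfolding M_def using fin a b by (subst mset_set.remove[of _ a]) auto
    qed
    have "T - {b} \<noteq> {}" "T - {a} \<noteq> {}" using a b by blast+
    then have "?G (add_mset a M) = 0" "?G (add_mset b M) = 0"
      unfolding T(2,3)[symmetric] using fin a b less.prems(3)
      by (auto intro!: less.hyps card_Diff1_less simp del: card_Diff_insert card_Diff_singleton)
    then have "0 = ?G (add_mset a M) - ?G (add_mset b M)" by simp
    also have "\<dots> = (a - b) * ?G (add_mset a (add_mset b M))"
      by (simp add: sum_subtractf[symmetric] right_diff_distrib[symmetric] dd_diff sum_distrib_left mult_ac)
    finally show ?thesis using b T(1) by simp
  qed
qed

text \<open>The nodes of the divided difference \<open>p_gen n J k\<close>, shifted so that they become distinct elements
  of \<open>{1..n}\<close> at a Nietzschean permutation, where \<open>w j + 1\<close> is the value at an earlier position.\<close>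

definition shifted_nodes :: "nat \<Rightarrow> nat set \<Rightarrow> nat \<Rightarrow> (nat \<times> complex) multiset" where
  "shifted_nodes n J k = image_mset (\<lambda>j. (j, 1)) (mset_set {j\<in>J. j \<le> k}) + image_mset (\<lambda>j. (j, 0)) (mset_set {k..n})"

lemma p_gen_nodes:
  assumes "J \<subseteq> {1..n}" "k \<in> {1..n}"
  shows "p_gen n J k = dd n (image_mset (\<lambda>(j, c). var j) (shifted_nodes n J k))"
proof -
  have fin: "finite {j\<in>J. j \<le> k}" by simp
  have "{v\<in>{1..n}. k < v \<or> v \<in> J} = {j\<in>J. j \<le> k} \<union> {Suc k..n}" using assms by auto
  then have "mset_set {v\<in>{1..n}. k < v \<or> v \<in> J} = mset_set {j\<in>J. j \<le> k} + mset_set {Suc k..n}"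
    using fin by (simp add: mset_set_Union disjoint_iff)
  moreover have "{k..n} = insert k {Suc k..n}" using assms by auto
  ultimately show ?thesis
    by (simp add: p_gen_def shifted_nodes_def image_mset.compositionality o_def)
qed

definition deformed :: "nat \<Rightarrow> nat set \<Rightarrow> nat \<Rightarrow> cpoly" where
  "deformed n J k = (\<Sum>i\<le>n. const (Polynomial.coeff (root_poly n) i) *
     dd i (image_mset (\<lambda>(j, c). var j + const c) (shifted_nodes n J k)))"

text \<open>The leading coefficient of \<open>root_poly\<close> is 1, lower powers of u have divided
  differences of lower degree, and shifting nodes by constants affects lower degrees only.\<close>

lemma deformed_approx:
  assumes J: "J \<subseteq> {1..n}" and k: "k \<in> {1..n}"
  shows "\<exists>d. approx d (deformed n J k) (p_gen n J k)"
proof -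
  let ?M = "shifted_nodes n J k"
  let ?Y = "image_mset (\<lambda>(j, c). var j + const c) ?M" and ?X = "image_mset (\<lambda>(j, c). var j) ?M"
  define s where "s = size ?M"
  have "card {j\<in>J. j \<le> k} \<le> card {1..k}" using J by (intro card_mono) auto
  then have s: "s \<le> n + 1" using k by (simp add: s_def shifted_nodes_def)
  have hc: "approx d (hc d ?Y) (hc d ?X)" for d
    by (rule approx_hc) (use approx_var_add in auto)
  have "approx (n + 1 - s) (dd n ?Y) (dd n ?X)"
    using hc s by (simp add: dd_def s_def)
  moreover have "(\<Sum>i<n. const (Polynomial.coeff (root_poly n) i) * dd i ?Y) \<in> deg_less (n + 1 - s)"
  proof (intro deg_less_sum)
    fix i assume "i \<in> {..<n}"
    then have i: "i < n" by simp
    have "dd i ?Y \<in> deg_less (n + 1 - s)"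
    proof (cases "s \<le> i + 1")
      case True
      then have "dd i ?Y \<in> deg_less (Suc (i + 1 - s))"
        using approx_deg_less[OF hc[of "i + 1 - s"]] by (simp add: dd_def s_def)
      then show ?thesis by (rule deg_less_mono) (use True i in simp)
    qed (simp add: dd_def s_def)
    then show "const (Polynomial.coeff (root_poly n) i) * dd i ?Y \<in> deg_less (n + 1 - s)"
      using deg_less_mult[OF homog_deg_less[OF homog_const lessI]] by fastforce
  qed
  moreover have "{..n} = insert n {..<n}" by auto
  then have "deformed n J k = dd n ?Y + (\<Sum>i<n. const (Polynomial.coeff (root_poly n) i) * dd i ?Y)"
    by (simp add: deformed_def coeff_root_poly)
  ultimately have "approx (n + 1 - s) (deformed n J k) (dd n ?X)"
    using deg_less_add by (fastforce simp: approx_def add_diff_eq add.commute)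
  then show ?thesis unfolding p_gen_nodes[OF J k] by blast
qed

lemma deformed_vanishing:
  assumes J: "J \<subseteq> {1..n}" and k: "k \<in> {1..n}"
  shows "deformed n J k \<in> vanishing_ideal n (nietzschean_locus n J)"
proof -
  let ?M = "shifted_nodes n J k" and ?J = "{j\<in>J. j \<le> k}"
  have fin: "finite ?J" by simp
  have in_n: "j \<in> {1..n}" if "(j, c) \<in># ?M" for j c
    using that J k by (auto simp: shifted_nodes_def)
  have "deformed n J k \<in> polys_in {1..n}"
    unfolding deformed_def using in_n
    by (intro polys_in_sum polys_in_mult polys_in_const polys_in_dd) (auto intro!: polys_in_add polys_in_var)
  moreover have "eval_with id (perm_point n w) (deformed n J k) = 0" if w: "w \<in> nietzschean_perms n J" for w
  proof -
    let ?z = "perm_point n w"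
    have wp: "w permutes {1..n}" and nr: "\<And>j. j \<in> J \<Longrightarrow> \<not> resentful n w j"
      using w by (auto simp: nietzschean_perms_def)
    have inj: "w i = w j \<longleftrightarrow> i = j" for i j using permutes_inj[OF wp] by (auto dest: injD)
    have wn: "w i \<in> {1..n}" if "i \<in> {1..n}" for i using permutes_in_image[OF wp] that by blast
    define T1 where "T1 = (\<lambda>j. of_nat (w j) + 1 :: complex) ` ?J"
    define T2 where "T2 = (\<lambda>j. of_nat (w j) :: complex) ` {k..n}"
    have 1: "image_mset (\<lambda>j. of_nat (w j) + 1 :: complex) (mset_set ?J) = mset_set T1"
      unfolding T1_def by (intro image_mset_mset_set) (auto simp: inj_on_def inj)
    have 2: "image_mset (\<lambda>j. of_nat (w j) :: complex) (mset_set {k..n}) = mset_set T2"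
      unfolding T2_def by (intro image_mset_mset_set) (auto simp: inj_on_def inj)
    \<comment> \<open>A shifted node can equal an unshifted one only if w j + 1 = w t with j \<le> k
      \<le> t. Then t > j, so w would be j-resentful.\<close>
    have disj: "T1 \<inter> T2 = {}"
    proof (rule ccontr)
      assume "T1 \<inter> T2 \<noteq> {}"
      then obtain x where x: "x \<in> T1" "x \<in> T2" by blast
      obtain j where j: "j \<in> J" "j \<le> k" "x = of_nat (w j) + 1" using x(1) unfolding T1_def by blast
      obtain t where t: "t \<in> {k..n}" "x = of_nat (w t)" using x(2) unfolding T2_def by blast
      have jt: "j \<in> J" "j \<le> k" "t \<in> {k..n}" "of_nat (w j) + 1 = (of_nat (w t) :: complex)"
        using j t by simp_all
      then have eq: "w j + 1 = w t" by (metis of_nat_1 of_nat_add of_nat_eq_iff)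
      then have "j \<noteq> t" by auto
      then have "t \<in> {j+1..n}" using jt by auto
      then have "resentful n w j" using eq by (auto simp: resentful_def)
      then show False using nr jt by blast
    qed
    have "image_mset (eval_with id ?z) (image_mset (\<lambda>(j, c). var j + const c) ?M)
        = image_mset (\<lambda>(j, c). ?z j + c) ?M"
      unfolding image_mset.compositionality
      by (intro image_mset_cong) (auto simp only: o_apply eval_id id_apply prod.case)
    also have "\<dots> = image_mset (\<lambda>(j, c). of_nat (w j) + c) ?M"
      using in_n by (intro image_mset_cong) (force simp: perm_point_def)
    also have "\<dots> = mset_set T1 + mset_set T2"
      unfolding shifted_nodes_def 1[symmetric] 2[symmetric] by (simp add: image_mset.compositionality o_def)
    also have "\<dots> = mset_set (T1 \<union> T2)"
      using disj fin by (subst mset_set_Union) (auto simp: T1_def T2_def)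
    finally have eq: "image_mset (eval_with id ?z) (image_mset (\<lambda>(j, c). var j + const c) ?M) = mset_set (T1 \<union> T2)" .
    \<comment> \<open>The other kind of resentment, w j = n, is the one that would push a shifted
      node out of {1..n}.\<close>
    have root: "poly (root_poly n) t = 0" if t: "t \<in> T1 \<union> T2" for t
    proof -
      have "t \<in> of_nat ` {1..n}"
      proof (cases "t \<in> T1")
        case True
        then obtain j where j: "j \<in> J" "t = of_nat (w j) + 1" by (auto simp: T1_def)
        then have "w j \<noteq> n" "w j \<in> {1..n}" using nr[OF j(1)] wn J by (auto simp: resentful_def)
        then have "t = of_nat (w j + 1)" "w j + 1 \<in> {1..n}" using j by auto
        then show ?thesis by blast
      next
        case False
        then obtain j where j: "j \<in> {k..n}" "t = of_nat (w j)" using t by (auto simp: T2_def)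
        then show ?thesis using wn[of j] k by auto
      qed
      then show ?thesis by (auto simp: root_poly_def poly_prod)
    qed
    have "eval_with id ?z (deformed n J k)
        = (\<Sum>i\<le>n. Polynomial.coeff (root_poly n) i * dd i (mset_set (T1 \<union> T2)))"
      unfolding deformed_def eval_id eval_dd[OF coeff_hom_id] eq id_apply ..
    also have "\<dots> = 0"
      using dd_roots[of "T1 \<union> T2" "root_poly n"] root fin k unfolding degree_root_poly
      by (auto simp: T1_def T2_def)
    finally show ?thesis .
  qed
  ultimately show ?thesis
    by (auto simp: vanishing_ideal_def carrier_poly_ring nietzschean_locus_def)
qed

definition gr_gens :: "nat \<Rightarrow> (nat \<Rightarrow> complex) set \<Rightarrow> cpoly set" where
  "gr_gens n Z = {top_component f | f. f \<in> vanishing_ideal n Z \<and> f \<noteq> 0}"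

lemma gr_gens_polys_in: "gr_gens n Z \<subseteq> polys_in {1..n}"
  using vanishing_polys_in polys_in_hcomp by (fastforce simp: gr_gens_def top_component_hcomp)

lemma gr_ideal_eq: "gr_ideal n (vanishing_ideal n Z) = Idl\<^bsub>poly_ring n\<^esub> (gr_gens n Z)"
  by (simp add: gr_ideal_def gr_gens_def)

lemma p_gen_in_gr:
  assumes "J \<subseteq> {1..n}" "k \<in> {1..n}"
  shows "p_gen n J k \<in> gr_ideal n (vanishing_ideal n (nietzschean_locus n J))"
proof (cases "p_gen n J k = 0")
  case True
  then show ?thesis
    unfolding gr_ideal_eq using ideal_poly_ringD(2)[OF Idl_ideal[OF gr_gens_polys_in]] by simp
next
  case False
  obtain d where "approx d (deformed n J k) (p_gen n J k)" using deformed_approx[OF assms] by blast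
  from top_component_approx[OF this False] deformed_vanishing[OF assms]
  have "p_gen n J k \<in> gr_gens n (nietzschean_locus n J)" unfolding gr_gens_def by force
  then show ?thesis unfolding gr_ideal_eq using Idl_self[OF gr_gens_polys_in] by blast
qed

lemma f_poly_polys_in:
  assumes "J \<subseteq> {1..n}"
  shows "f_poly n J \<in> polys_in {1..n}"
  unfolding f_poly_def using assms by (intro polys_in_prod polys_in_mult polys_in_diff polys_in_var) auto

lemma ideal_colon:
  assumes J: "J \<subseteq> {1..n}"
  shows "ideal (colon_ideal n (coinvariant_ideal n) (f_poly n J)) (poly_ring n)"
proof (rule ideal_poly_ringI)
  fix f r assume "f \<in> colon_ideal n (coinvariant_ideal n) (f_poly n J)" "r \<in> polys_in {1..n}"
  then show "r * f \<in> colon_ideal n (coinvariant_ideal n) (f_poly n J)"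
    using coinvariant(4)[of "f * f_poly n J" n r] polys_in_mult
    by (simp add: colon_ideal_def carrier_poly_ring mult.assoc)
qed (auto simp: colon_ideal_def carrier_poly_ring distrib_right coinvariant intro: polys_in_add)

text \<open>Multiplication by a deformation of \<open>f\<^sub>J\<close> that vanishes exactly at the permutations outside
  \<open>\<NN>\<^sub>J\<close> turns polynomials vanishing on the locus into polynomials vanishing on all permutations.\<close>

lemma gr_le_colon:
  assumes J: "J \<subseteq> {1..n}"
  shows "gr_ideal n (vanishing_ideal n (nietzschean_locus n J)) \<subseteq> colon_ideal n (coinvariant_ideal n) (f_poly n J)"
  unfolding gr_ideal_eq
proof (rule Idl_least[OF ideal_colon[OF J]], rule subsetI)
  fix g assume g: "g \<in> gr_gens n (nietzschean_locus n J)"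
  then obtain f where f: "f \<in> vanishing_ideal n (nietzschean_locus n J)" "f \<noteq> 0" "g = top_component f"
    by (auto simp: gr_gens_def)
  \<comment> \<open>At a permutation w the factors become w j - n and w j - w i + 1; their zeros are
    the two ways of being j-resentful.\<close>
  define h where "h = (\<Prod>j\<in>J. (var j + const (- of_nat n)) * (\<Prod>i\<in>{j+1..n}. (var j - var i) + 1))"
  define e where "e = (\<Sum>j\<in>J. 1 + (\<Sum>i\<in>{j+1..n}. 1 :: nat))"
  have "approx 1 (var j - var i + 1) (var j - var i)" for i j
    using homog_diff[OF homog_var(1) homog_var(1)] homog_deg_less[OF homog_1, of 1] by (simp add: approx_def)
  then have h: "approx e h (f_poly n J)"
    unfolding h_def e_def f_poly_def by (intro approx_prod approx_mult approx_var_add)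
  from approx_mult[OF approx_top[OF f(2)] h]
  have fh: "approx (total_degree f + e) (f * h) (g * f_poly n J)" unfolding f(3) .
  have hPV: "h \<in> polys_in {1..n}"
    unfolding h_def using J by (intro polys_in_prod polys_in_mult polys_in_add polys_in_diff polys_in_var polys_in_const polys_in_1) auto
  have "eval_with id (perm_point n w) (f * h) = 0" if w: "w permutes {1..n}" for w
  proof (cases "w \<in> nietzschean_perms n J")
    case True
    then have "eval_with id (perm_point n w) f = 0"
      using f(1) by (auto simp: vanishing_ideal_def nietzschean_locus_def)
    then show ?thesis unfolding eval_id by simp
  next
    case False
    then obtain j where j: "j \<in> J" "resentful n w j" using w by (auto simp: nietzschean_perms_def)
    have fin: "finite J" using J finite_subset by blast
    have jn: "j \<in> {1..n}" using j J by blast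
    have "eval_with id (perm_point n w) ((var j + const (- of_nat n)) * (\<Prod>i\<in>{j+1..n}. (var j - var i) + 1)) = 0"
    proof (cases "w j = n")
      case True
      then have "perm_point n w j + - of_nat n = 0" using jn by (simp add: perm_point_def)
      then show ?thesis unfolding eval_id id_apply by simp
    next
      case False
      then obtain i where i: "i \<in> {j+1..n}" "w j + 1 = w i" using j(2) by (auto simp: resentful_def)
      then have "i \<in> {1..n}" using jn by auto
      then have "perm_point n w j - perm_point n w i + 1 = 0"
        using jn i(2)[symmetric] by (simp add: perm_point_def)
      then have "(\<Prod>i\<in>{j+1..n}. perm_point n w j - perm_point n w i + 1) = 0"
        using i(1) by (intro prod_zero) auto
      then show ?thesis unfolding eval_id id_apply by simp
    qed
    then have "eval_with id (perm_point n w) h = 0"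
      unfolding h_def eval_prod[OF coeff_hom_id] using j(1) fin by (intro prod_zero) blast+
    then show ?thesis unfolding eval_id by simp
  qed
  then have "f * h \<in> vanishing_ideal n (perm_points n)"
    using f(1) hPV vanishing_polys_in by (auto simp: vanishing_ideal_def perm_points_def carrier_poly_ring intro: polys_in_mult)
  from top_of_vanishing[OF this approx_deg_less[OF fh]]
  have "g * f_poly n J \<in> coinvariant_ideal n" unfolding approx_hcomp[OF fh] .
  then show "g \<in> colon_ideal n (coinvariant_ideal n) (f_poly n J)"
    using g gr_gens_polys_in by (auto simp: colon_ideal_def carrier_poly_ring)
qed

section \<open>The generators \<open>p\<^bsub>J,i\<^esub>\<close>\<close>

lemma complete_homogeneous_0: "complete_homogeneous 0 S = 1"
proof -
  have "{m. keys m \<subseteq> S \<and> mdeg m = 0} = {0 :: nat \<Rightarrow>\<^sub>0 nat}" by auto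
  then show ?thesis by (simp add: complete_homogeneous_def)
qed

lemma complete_homogeneous_empty: "complete_homogeneous (Suc d) {} = 0"
proof -
  have "{m :: nat \<Rightarrow>\<^sub>0 nat. keys m \<subseteq> {} \<and> mdeg m = Suc d} = {}" by auto
  then show ?thesis by (simp add: complete_homogeneous_def)
qed

text \<open>The monomials are sorted by whether x_a occurs in them. The result is the recursion that
  determines \<open>hc\<close>.\<close>

lemma complete_homogeneous_insert:
  assumes S: "finite S" "a \<notin> S"
  shows "complete_homogeneous (Suc d) (insert a S)
    = complete_homogeneous (Suc d) S + var a * complete_homogeneous d (insert a S)"
proof -
  let ?M = "\<lambda>d S. {m :: nat \<Rightarrow>\<^sub>0 nat. keys m \<subseteq> S \<and> mdeg m = d}"
  let ?f = "\<lambda>m. single a 1 + m"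
  have fin: "finite (?M d S')" if "finite S'" for d S' using that by (rule finite_mdeg)
  have "?M (Suc d) (insert a S) = ?M (Suc d) S \<union> ?f ` ?M d (insert a S)"
  proof (intro subset_antisym subsetI)
    fix m assume m: "m \<in> ?M (Suc d) (insert a S)"
    show "m \<in> ?M (Suc d) S \<union> ?f ` ?M d (insert a S)"
    proof (cases "a \<in> keys m")
      case False
      then have "m \<in> ?M (Suc d) S" using m by blast
      then show ?thesis by blast
    next
      case True
      define m' where "m' = m - single a 1"
      have eq: "m = ?f m'"
        unfolding m'_def using True
        by (intro poly_mapping_eqI) (auto simp: lookup_add lookup_minus lookup_single when_def in_keys_iff)
      have "keys m' \<subseteq> keys m"
        unfolding m'_def by (auto simp: in_keys_iff lookup_minus)
      moreover have "mdeg m = Suc (mdeg m')" by (subst eq) (simp add: mdeg_add)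
      ultimately have "m' \<in> ?M d (insert a S)" using m by auto
      then show ?thesis using eq by blast
    qed
  next
    fix m assume "m \<in> ?M (Suc d) S \<union> ?f ` ?M d (insert a S)"
    then show "m \<in> ?M (Suc d) (insert a S)"
      using Poly_Mapping.keys_add[of "single a (1 :: nat)"] by (fastforce simp: mdeg_add)
  qed
  moreover have "?M (Suc d) S \<inter> ?f ` ?M d (insert a S) = {}"
  proof -
    have "a \<in> keys (?f m)" for m :: "nat \<Rightarrow>\<^sub>0 nat" by (simp add: in_keys_iff lookup_add)
    then show ?thesis using S(2) by blast
  qed
  ultimately have "complete_homogeneous (Suc d) (insert a S)
      = complete_homogeneous (Suc d) S + (\<Sum>m\<in>?f ` ?M d (insert a S). mon m)"
    unfolding complete_homogeneous_def using S(1) fin by (simp add: sum.union_disjoint)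
  also have "(\<Sum>m\<in>?f ` ?M d (insert a S). mon m) = var a * complete_homogeneous d (insert a S)"
    unfolding complete_homogeneous_def sum_distrib_left
    by (subst sum.reindex) (auto simp: inj_on_def var_def mult_single)
  finally show ?thesis .
qed

lemma complete_homogeneous_hc:
  assumes "finite S"
  shows "complete_homogeneous d S = hc d (image_mset var (mset_set S))"
  using assms
proof (induction S arbitrary: d rule: finite_induct)
  case empty
  then show ?case by (cases d) (simp_all add: complete_homogeneous_0 complete_homogeneous_empty)
next
  case (insert a S)
  show ?case
  proof (induction d)
    case 0 then show ?case by (simp add: complete_homogeneous_0)
  next
    case (Suc d)
    show ?case using insert Suc by (simp add: complete_homogeneous_insert hc_Suc_add)
  qed
qed

section \<open>Partial derivatives of complete homogeneous polynomials\<close>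

lemma partial_deriv_superset:
  assumes "finite S" "keys f \<subseteq> S"
  shows "partial_deriv s f = (\<Sum>m\<in>S. single (m - single s 1)
    (of_nat (lookup m s) * lookup f m))"
  unfolding partial_deriv_def using assms
  by (intro sum.mono_neutral_left) (auto simp: in_keys_iff)

lemma partial_deriv_add: "partial_deriv s (f + g) = partial_deriv s f + partial_deriv s g"
  using Poly_Mapping.keys_add[of f g]
  by (simp add: partial_deriv_superset[of "keys f \<union> keys g"]
      lookup_add distrib_left single_add sum.distrib)

lemma partial_deriv_sum: "partial_deriv s (\<Sum>i\<in>A. f i) = (\<Sum>i\<in>A. partial_deriv s (f i))"
  by (induction A rule: infinite_finite_induct) (auto simp: partial_deriv_add, auto simp: partial_deriv_def)

lemma partial_deriv_single: "partial_deriv s (single m c)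
    = single (m - single s 1) (of_nat (lookup m s) * c)"
  by (subst partial_deriv_superset[of "{m}"]) auto

lemma partial_deriv_var_mult:
  "partial_deriv s (var a * f) = var a * partial_deriv s f + (if a = s then f else 0)"
proof -
  let ?t = "\<lambda>m. single m (lookup f m)"
  have single: "partial_deriv s (var a * single m c)
      = var a * partial_deriv s (single m c) + (if a = s then single m c else 0)" for m c
  proof (cases "lookup m s = 0")
    case True
    then show ?thesis
      by (auto simp: var_def mult_single partial_deriv_single lookup_add lookup_single when_def)
  next
    case False
    then have "single a 1 + m - single s 1
        = single a 1 + (m - single s 1)"
      by (intro poly_mapping_eqI) (auto simp: lookup_add lookup_minus lookup_single when_def)
    moreover have "single s 1 + (m - single s 1) = m"
      using False by (intro poly_mapping_eqI) (auto simp: lookup_add lookup_minus lookup_single when_def)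
    ultimately show ?thesis
      by (auto simp: var_def mult_single partial_deriv_single lookup_add lookup_single when_def
          single_add[symmetric] algebra_simps)
  qed
  have f: "f = (\<Sum>m\<in>keys f. ?t m)"
    by (subst (1) poly_eq_sum_mon) (simp add: const_def mult_single)
  have "partial_deriv s (var a * (\<Sum>m\<in>keys f. ?t m))
      = var a * partial_deriv s (\<Sum>m\<in>keys f. ?t m) + (if a = s then (\<Sum>m\<in>keys f. ?t m) else 0)"
    by (simp add: sum_distrib_left partial_deriv_sum single sum.distrib)
  then show ?thesis using f by simp
qed

lemma partial_deriv_hc_notin:
  assumes "s \<notin># M"
  shows "partial_deriv s (hc d (image_mset var M)) = 0"
  using assms
proof (induction M arbitrary: d)
  case empty then show ?case by (cases d) (auto simp: partial_deriv_def)
next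
  case (add a M)
  show ?case
  proof (induction d)
    case 0 then show ?case by (auto simp: partial_deriv_def)
  next
    case (Suc d)
    then show ?case using add by (auto simp: hc_Suc_add partial_deriv_add partial_deriv_var_mult)
  qed
qed

text \<open>Differentiation by x_s doubles the node x_s: in the recursion for h_{d+2}, the product
  rule contributes h_{d+1} with x_s taken once, which is the term missing from the recursion with
  x_s taken twice.\<close>

lemma partial_deriv_hc:
  assumes "s \<notin># M"
  shows "partial_deriv s (hc (Suc d) (image_mset var (add_mset s M)))
    = hc d (add_mset (var s) (image_mset var (add_mset s M)))"
proof (induction d)
  case 0
  have 1: "partial_deriv s 1 = 0" by (simp add: partial_deriv_def)
  then have "partial_deriv s (var s) = 1" using partial_deriv_var_mult[of s s 1] by simp
  then show ?case
    using 1 partial_deriv_hc_notin[OF assms] by (simp add: hc_Suc_add partial_deriv_add partial_deriv_var_mult)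
next
  case (Suc d)
  then show ?case
    using partial_deriv_hc_notin[OF assms]
    by (simp add: hc_Suc_add[of "Suc d" "var s" "image_mset var M"] partial_deriv_add partial_deriv_var_mult)
      (simp add: hc_Suc_add[of d "var s" "add_mset (var s) (image_mset var M)"])
qed

lemma p_poly_below:
  assumes "J \<subseteq> {1..n}" "i \<in> {1..n}" "J = {} \<or> i < Min J"
  shows "p_poly n J i = p_gen n J i"
proof -
  have "finite J" using assms finite_subset by blast
  have "i < j" if j: "j \<in> J" for j
  proof -
    have "i < Min J" using assms(3) j by blast
    also have "Min J \<le> j" using \<open>finite J\<close> j by (rule Min_le)
    finally show ?thesis .
  qed
  then have "{v\<in>{1..n}. i < v \<or> v \<in> J} = {Suc i..n}" "{i..n} = insert i {Suc i..n}"
    using assms(1,2) by (auto simp: Suc_le_eq)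
  moreover have "p_poly n J i = hc i (image_mset var (mset_set {i..n}))"
    using assms(3) by (auto simp: p_poly_def complete_homogeneous_hc)
  ultimately show ?thesis using assms(2) by (simp add: p_gen_def dd_def)
qed

text \<open>The derivative doubles the node x_s in T, and n - card T is the degree of the divided
  difference of u^n at card T + 1 nodes.\<close>

lemma p_poly_above:
  assumes J: "J \<subseteq> {1..n}" and i: "i \<in> {1..n}" and m: "J \<noteq> {}" "Min J \<le> i"
  defines "s \<equiv> Max (J \<inter> {1..i})"
  shows "p_poly n J i = dd n (add_mset (var s) (image_mset var (mset_set {v\<in>{1..n}. i < v \<or> v \<in> J})))"
    and "s \<in> J" "s \<le> i" "\<And>j. j \<in> J \<Longrightarrow> j \<le> i \<Longrightarrow> j \<le> s"
proof -
  have fin: "finite J" using J finite_subset by blast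
  have "Min J \<in> J \<inter> {1..i}" using m fin J Min_in[OF fin m(1)] by auto
  then have ne: "J \<inter> {1..i} \<noteq> {}" by blast
  have s: "s \<in> J \<inter> {1..i}" unfolding s_def by (intro Max_in) (use ne in auto)
  then show "s \<in> J" "s \<le> i" by auto
  show "j \<le> s" if "j \<in> J" "j \<le> i" for j
    unfolding s_def using that J by (intro Max_ge) auto
  define T where "T = J \<union> {i+1..n}"
  have T: "{v\<in>{1..n}. i < v \<or> v \<in> J} = T" "T \<subseteq> {1..n}" "finite T" "s \<in> T"
    using J s fin by (auto simp: T_def)
  have cT: "card T \<le> n" using card_mono[OF _ T(2)] by simp
  have "p_poly n J i = partial_deriv s (hc (Suc (n - card T)) (image_mset var (mset_set T)))"
  proof -
    have "\<not> (J = {} \<or> i < Min J)" using m(1) leD[OF m(2)] by blast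
    then show ?thesis
      unfolding p_poly_def if_not_P Let_def s_def[symmetric] T_def[symmetric] complete_homogeneous_hc[OF T(3)]
      by (simp only: Suc_eq_plus1 if_False)
  qed
  also have "mset_set T = add_mset s (mset_set (T - {s}))"
    using T by (subst mset_set.remove[of _ s]) auto
  also have "partial_deriv s (hc (Suc (n - card T)) (image_mset var (add_mset s (mset_set (T - {s})))))
      = hc (n - card T) (add_mset (var s) (image_mset var (add_mset s (mset_set (T - {s})))))"
    using T by (intro partial_deriv_hc) auto
  also have "add_mset s (mset_set (T - {s})) = mset_set T"
    using T by (subst (2) mset_set.remove[of _ s]) auto
  also have "hc (n - card T) (add_mset (var s) (image_mset var (mset_set T)))
      = dd n (add_mset (var s) (image_mset var (mset_set T)))"
    using cT T by (simp add: dd_def)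
  finally show "p_poly n J i = dd n (add_mset (var s) (image_mset var (mset_set {v\<in>{1..n}. i < v \<or> v \<in> J})))"
    unfolding T(1) .
qed

text \<open>The two generators differ in one node, x_i against x_s, so their difference is x_i - x_s
  times a divided difference with both nodes. For i outside J that one is
  \<open>p_poly n J (i - 1)\<close>, since s is the same for i - 1 and position i - 1 has the node
  x_i in addition. This is the triangular change of generators.\<close>

lemma p_poly_p_gen:
  assumes J: "J \<subseteq> {1..n}" and i: "i \<in> {1..n}"
  shows "p_poly n J i = p_gen n J i \<or>
    (\<exists>a b. a \<in> {1..n} \<and> b \<in> {1..n} \<and> i - 1 \<in> {1..n} \<and> p_gen n J i - p_poly n J i = (var a - var b) * p_poly n J (i - 1))"
proof (cases "J = {} \<or> i < Min J")
  case True
  then show ?thesis using p_poly_below[OF J i] by blast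
next
  case False
  have fin: "finite J" using J finite_subset by blast
  define s where "s = Max (J \<inter> {1..i})"
  let ?S = "\<lambda>i. {v\<in>{1..n}. i < v \<or> v \<in> J}"
  have m: "J \<noteq> {}" "Min J \<le> i" using False by auto
  note P = p_poly_above[OF J i m, folded s_def]
  show ?thesis
  proof (cases "i \<in> J")
    case True
    then have "s = i" using P(3) P(4)[of i] by simp
    then show ?thesis using P(1) by (simp add: p_gen_def)
  next
    case iJ: False
    have "Min J \<noteq> i" using Min_in[OF fin m(1)] iJ by metis
    then have m': "Min J \<le> i - 1" using m by simp
    have "1 \<le> Min J" using Min_in[OF fin m(1)] J by auto
    then have i': "i - 1 \<in> {1..n}" using m' i by auto
    have Ji: "J \<inter> {1..i - 1} = J \<inter> {1..i}"
    proof (intro subset_antisym subsetI)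
      fix x assume "x \<in> J \<inter> {1..i}"
      moreover then have "x \<noteq> i" using iJ by blast
      ultimately show "x \<in> J \<inter> {1..i - 1}" by auto
    qed auto
    have "?S (i - 1) = insert i (?S i)" "i \<notin> ?S i" using i i' iJ by auto
    then have "mset_set (?S (i - 1)) = add_mset i (mset_set (?S i))" by simp
    then have "p_poly n J (i - 1) = dd n (add_mset (var s) (add_mset (var i) (image_mset var (mset_set (?S i)))))"
      using p_poly_above(1)[OF J i' m(1) m', unfolded Ji, folded s_def] by simp
    then have "p_gen n J i - p_poly n J i = (var i - var s) * p_poly n J (i - 1)"
      unfolding P(1) p_gen_def by (simp add: dd_diff add_mset_commute)
    then show ?thesis using i i' P(2) J by blast
  qed
qed

lemma p_poly_polys_in:
  assumes J: "J \<subseteq> {1..n}" and i: "i \<in> {1..n}"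
  shows "p_poly n J i \<in> polys_in {1..n}"
proof (cases "J = {} \<or> i < Min J")
  case True
  then show ?thesis using p_poly_below[OF J i] p_gen_polys_in[OF i] by simp
next
  case False
  then have m: "J \<noteq> {}" "Min J \<le> i" by auto
  show ?thesis
    unfolding p_poly_above(1)[OF J i m] using p_poly_above(2)[OF J i m] J
    by (intro polys_in_dd) (auto intro!: polys_in_var)
qed

lemma p_gen_in_p:
  assumes I: "ideal I (poly_ring n)" and J: "J \<subseteq> {1..n}" and i: "i \<in> {1..n}"
    and p: "\<And>k. k \<in> {1..n} \<Longrightarrow> p_poly n J k \<in> I"
  shows "p_gen n J i \<in> I"
proof -
  note I = ideal_poly_ringD[OF I]
  from p_poly_p_gen[OF J i] show ?thesis
  proof (elim disjE exE conjE)
    fix a b assume ab: "a \<in> {1..n}" "b \<in> {1..n}" "i - 1 \<in> {1..n}"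
      and eq: "p_gen n J i - p_poly n J i = (var a - var b) * p_poly n J (i - 1)"
    have "p_poly n J i + (var a - var b) * p_poly n J (i - 1) \<in> I"
      using ab p i by (intro I(3,4)) (auto intro!: polys_in_diff polys_in_var)
    then show ?thesis unfolding eq[symmetric] by simp
  qed (use p[OF i] in simp)
qed

lemma p_in_p_gen:
  assumes I: "ideal I (poly_ring n)" and J: "J \<subseteq> {1..n}" and i: "i \<in> {1..n}"
    and r: "\<And>k. k \<in> {1..n} \<Longrightarrow> p_gen n J k \<in> I"
  shows "p_poly n J i \<in> I"
proof -
  note I = ideal_poly_ringD[OF I]
  show ?thesis using i
  proof (induction i)
    case (Suc i)
    from p_poly_p_gen[OF J Suc.prems] show ?case
    proof (elim disjE exE conjE)
      fix a b assume ab: "a \<in> {1..n}" "b \<in> {1..n}" "Suc i - 1 \<in> {1..n}"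
        and eq: "p_gen n J (Suc i) - p_poly n J (Suc i) = (var a - var b) * p_poly n J (Suc i - 1)"
      have "p_gen n J (Suc i) + (var b - var a) * p_poly n J i \<in> I"
        using ab r[OF Suc.prems] Suc.IH by (intro I(3,4)) (auto intro!: polys_in_diff polys_in_var)
      moreover have "p_poly n J (Suc i) = p_gen n J (Suc i) + (var b - var a) * p_poly n J i"
        using eq by (simp add: algebra_simps)
      ultimately show ?thesis by simp
    qed (use r[OF Suc.prems] in simp)
  qed simp
qed

section \<open>The Hilbert series of the quotient ring\<close>

lemma coset_eq_iff:
  assumes "ideal I (poly_ring n)"
  shows "I +>\<^bsub>poly_ring n\<^esub> f = I +>\<^bsub>poly_ring n\<^esub> g \<longleftrightarrow> f - g \<in> I"
proof -
  note I = ideal_poly_ringD[OF assms]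
  have neg: "- h \<in> I" if "h \<in> I" for h using I(4)[OF that, of "- 1"] by (simp add: polys_in_uminus)
  have c: "I +>\<^bsub>poly_ring n\<^esub> f = (\<lambda>h. h + f) ` I" for f
    by (auto simp: a_r_coset_def')
  show ?thesis
    unfolding c
  proof
    assume "(\<lambda>h. h + f) ` I = (\<lambda>h. h + g) ` I"
    then have "0 + f \<in> (\<lambda>h. h + g) ` I" using I(2) by blast
    then show "f - g \<in> I" by auto
  next
    assume fg: "f - g \<in> I"
    have "h + f \<in> (\<lambda>h. h + g) ` I" if "h \<in> I" for h
      using I(3)[OF that fg] by (intro image_eqI[of _ _ "h + (f - g)"]) auto
    moreover have "h + g \<in> (\<lambda>h. h + f) ` I" if "h \<in> I" for h
      using I(3)[OF that neg[OF fg]] by (intro image_eqI[of _ _ "h + - (f - g)"]) auto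
    ultimately show "(\<lambda>h. h + f) ` I = (\<lambda>h. h + g) ` I" by blast
  qed
qed

lemma subfield_const: "subfield (range const) (poly_ring n)"
proof -
  interpret R: cring "poly_ring n" by (rule cring_poly_ring)
  have sub: "range const \<subseteq> carrier (poly_ring n)" by (auto simp: carrier_poly_ring)
  have one: "1 \<in> range const" using const_1 by (metis rangeI)
  have "subring (range const) (poly_ring n)"
  proof (rule R.subringI[OF sub])
    fix h assume h: "h \<in> range const"
    then obtain c where c: "h = const c" by blast
    have "\<ominus>\<^bsub>poly_ring n\<^esub> h = const (- c)"
      unfolding c by (rule R.minus_equality) (auto simp: carrier_poly_ring const_add[symmetric])
    then show "\<ominus>\<^bsub>poly_ring n\<^esub> h \<in> range const" by simp
  qed (use one in \<open>auto simp: const_add[symmetric] const_mult[symmetric]\<close>)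
  then have "cring (poly_ring n\<lparr>carrier := range const\<rparr>)"
    using R.subcring_iff[OF sub] R.subcringI' by blast
  moreover have "\<exists>b\<in>range const. a * b = 1" if a: "a \<in> range const" "a \<noteq> 0" for a
  proof -
    obtain c where c: "a = const c" using a(1) by blast
    moreover have "c \<noteq> 0" using a(2) unfolding c by auto
    ultimately
    have "a * const (inverse c) = 1" by (simp add: const_mult[symmetric])
    then show ?thesis by blast
  qed
  ultimately have "field (poly_ring n\<lparr>carrier := range const\<rparr>)"
    by (intro cring.cring_fieldI2) auto
  then show ?thesis by (rule R.subfield_iff(1)[OF _ sub])
qed

lemma homogeneous_polys_eq: "homogeneous_polys n d = polys_in {1..n} \<inter> homog d"
  by (auto simp: homogeneous_polys_def homog_def carrier_poly_ring)

lemma span_restr: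
  assumes "b \<in> cp.span B"
  shows "restr n b \<in> cp.span (restr n ` B)"
  using assms
proof (induction rule: cp.span_induct_alt)
  case base
  have "restr n 0 = 0" by (simp add: restr_id)
  then show ?case by (simp add: cp.span_zero)
next
  case (step c x y)
  have "restr n (const c * x + y) = const c * restr n x + restr n y"
    by (simp add: restr_def eval_simps)
  then show ?case using step by (simp add: cp.span_add cp.span_scale cp.span_base)
qed

lemma spans_restr:
  assumes I: "ideal I (poly_ring n)" and B: "spans (ext n I) d B"
  shows "spans (ext n I) d (restr n ` B)"
  unfolding spans_def
proof (intro conjI ballI)
  show "finite (restr n ` B)" using B by (simp add: spans_def)
  have "hcomp d (restr n b) = restr n (hcomp d b)" for b
    unfolding restr_def by (rule eval_hcomp[symmetric]) auto
  then have "hcomp d (restr n b) = restr n b" if "b \<in> B" for b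
    using B that by (auto simp: spans_def)
  then show "restr n ` B \<subseteq> homog d" using hcomp_in_homog by (metis image_subsetI)
  fix f assume "f \<in> homog d"
  then obtain b where b: "b \<in> cp.span B" "f - b \<in> ext n I" using B by (auto simp: spans_def)
  have "restr n (f - restr n b) = restr n (f - b)"
    using restr_id[OF restr_polys_in, of n b] by (simp add: restr_def eval_simps)
  then have "f - restr n b \<in> ext n I" using b(2) by (simp add: ext_def)
  then show "\<exists>b\<in>cp.span (restr n ` B). f - b \<in> ext n I" using span_restr[OF b(1)] by blast
qed

lemma span_polys_in: "B \<subseteq> polys_in V \<Longrightarrow> cp.span B \<subseteq> polys_in V"
  by (rule cp.span_minimal) (auto simp: cp.subspace_def intro: polys_in_add polys_in_mult)

lemma dim_quotient_piece:
  assumes I: "ideal I (poly_ring n)" and h: "\<And>f d. f \<in> I \<Longrightarrow> hcomp d f \<in> I" and one: "1 \<notin> I"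
  shows "ring.dim (poly_ring n Quot I) (quotient_scalars n I) (quotient_piece n I d) = qdim (ext n I) d"
proof -
  let ?Q = "poly_ring n Quot I" and ?cos = "\<lambda>f. I +>\<^bsub>poly_ring n\<^esub> f" and ?E = "ext n I"
  interpret Q: ring ?Q by (rule ideal.quotient_is_ring[OF I])
  interpret H: ring_hom_ring "poly_ring n" ?Q ?cos by (rule ideal.rcos_ring_hom_ring[OF I])
  have E: "hideal n ?E" by (rule hideal_ext[OF I h])
  define K where "K = quotient_scalars n I"
  have K: "K = ?cos ` range const" by (simp add: K_def quotient_scalars_def image_image)
  have zero: "\<zero>\<^bsub>?Q\<^esub> = ?cos 0" using H.hom_zero by simp
  have one': "\<one>\<^bsub>?Q\<^esub> = ?cos 1" using H.hom_one by simp
  have "\<one>\<^bsub>?Q\<^esub> \<noteq> \<zero>\<^bsub>?Q\<^esub>"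
    unfolding zero one' coset_eq_iff[OF I] using one by simp
  then have subK: "subfield K ?Q"
    unfolding K by (rule H.img_is_subfield(2)[OF subfield_const])
  obtain B0 where B0: "spans ?E d B0" "card B0 = qdim ?E d" using ex_qdim[OF E] .
  define B where "B = restr n ` B0"
  have B: "spans ?E d B" unfolding B_def by (rule spans_restr[OF I B0(1)])
  have fin: "finite B" using B by (simp add: spans_def)
  have BPV: "B \<subseteq> polys_in {1..n}" using restr_polys_in by (auto simp: B_def)
  have "card B \<le> card B0" unfolding B_def using B0(1) by (intro card_image_le) (simp add: spans_def)
  then have cB: "card B = qdim ?E d" using qdim_le[OF B] B0(2) by simp
  \<comment> \<open>Extending a span of cosets by one vector is matched with
    \<open>cp.span_insert\<close> on representatives, so that the induction over the list identifies
    the two notions of span.\<close>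
  have line: "Q.line_extension K (?cos x) (?cos ` S) = ?cos ` {y. \<exists>k. y - const k * x \<in> S}"
    if x: "x \<in> polys_in {1..n}" and S: "S \<subseteq> polys_in {1..n}" for x S
  proof -
    have op: "?cos (const k) \<otimes>\<^bsub>?Q\<^esub> ?cos x \<oplus>\<^bsub>?Q\<^esub> ?cos v = ?cos (const k * x + v)" if "v \<in> S" for k v
    proof -
      have "const k \<in> carrier (poly_ring n)" "x \<in> carrier (poly_ring n)" "v \<in> carrier (poly_ring n)"
        "const k * x \<in> carrier (poly_ring n)"
        using x S that by (auto simp: carrier_poly_ring intro: polys_in_mult)
      then show ?thesis
        using H.hom_add[of "const k * x" v] H.hom_mult[of "const k" x] by simp
    qed
    show ?thesis
    proof (intro subset_antisym subsetI)
      fix u assume "u \<in> Q.line_extension K (?cos x) (?cos ` S)"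
      then obtain k v where "v \<in> S" "u = ?cos (const k) \<otimes>\<^bsub>?Q\<^esub> ?cos x \<oplus>\<^bsub>?Q\<^esub> ?cos v"
        unfolding Q.line_extension_mem_iff K by blast
      then have "v \<in> S" "u = ?cos (const k * x + v)" using op by auto
      then show "u \<in> ?cos ` {y. \<exists>k. y - const k * x \<in> S}"
        by (intro image_eqI[of _ _ "const k * x + v"]) (auto intro!: exI[of _ k])
    next
      fix u assume "u \<in> ?cos ` {y. \<exists>k. y - const k * x \<in> S}"
      then obtain y k where y: "u = ?cos y" "y - const k * x \<in> S" by blast
      have "u = ?cos (const k) \<otimes>\<^bsub>?Q\<^esub> ?cos x \<oplus>\<^bsub>?Q\<^esub> ?cos (y - const k * x)"
        unfolding op[OF y(2)] y(1) by simp
      then show "u \<in> Q.line_extension K (?cos x) (?cos ` S)"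
        unfolding Q.line_extension_mem_iff K using y(2) by blast
    qed
  qed
  have Span: "Q.Span K (map ?cos xs) = ?cos ` cp.span (set xs)" if "set xs \<subseteq> polys_in {1..n}" for xs
    using that
  proof (induction xs)
    case Nil
    then show ?case using zero by simp
  next
    case (Cons x xs)
    have "Q.Span K (map ?cos (x # xs)) = Q.line_extension K (?cos x) (Q.Span K (map ?cos xs))"
      by simp
    also have "Q.Span K (map ?cos xs) = ?cos ` cp.span (set xs)" using Cons by simp
    also have "Q.line_extension K (?cos x) (?cos ` cp.span (set xs))
        = ?cos ` {y. \<exists>k. y - const k * x \<in> cp.span (set xs)}"
      using Cons.prems span_polys_in[of "set xs"] by (intro line) auto
    also have "{y. \<exists>k. y - const k * x \<in> cp.span (set xs)} = cp.span (set (x # xs))"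
      by (simp add: cp.span_insert)
    finally show ?case .
  qed
  have minimal: "x - v \<notin> I" if x: "x \<in> B" and v: "v \<in> cp.span (B - {x})" for x v
  proof
    assume xv: "x - v \<in> I"
    have "v \<in> polys_in {1..n}" using v span_polys_in[of "B - {x}" "{1..n}"] BPV by blast
    then have "x - v \<in> polys_in {1..n}" using x BPV by (auto intro: polys_in_diff)
    then have xv': "x - v \<in> ?E" using xv ext_inter by blast
    have "spans ?E d (B - {x})"
      unfolding spans_def
    proof (intro conjI ballI)
      show "finite (B - {x})" "B - {x} \<subseteq> homog d" using B by (auto simp: spans_def)
      fix f assume "f \<in> homog d"
      then obtain b where b: "b \<in> cp.span B" "f - b \<in> ?E" using B by (auto simp: spans_def)
      have "\<exists>y\<in>cp.span (B - {x}). b - y \<in> ?E"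
      proof (rule span_mod[OF E _ b(1)])
        fix z assume z: "z \<in> B"
        show "\<exists>y\<in>cp.span (B - {x}). z - y \<in> ?E"
        proof (cases "z = x")
          case False
          then have "z \<in> cp.span (B - {x})" using z by (intro cp.span_base) simp
          moreover have "z - z \<in> ?E" using hideal_0[OF E] by simp
          ultimately show ?thesis by blast
        qed (use v xv' in blast)
      qed
      then obtain y where y: "y \<in> cp.span (B - {x})" "b - y \<in> ?E" by blast
      have "f - y \<in> ?E" using hideal_add[OF E b(2) y(2)] by simp
      then show "\<exists>b\<in>cp.span (B - {x}). f - b \<in> ?E" using y(1) by blast
    qed
    then have "card B \<le> card (B - {x})" using qdim_le cB by metis
    then show False using card_Diff1_less[OF fin x] by simp
  qed
  have ind: "Q.independent K (map ?cos xs)" if "distinct xs" "set xs \<subseteq> B" for xs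
    using that
  proof (induction xs)
    case (Cons x xs)
    have x: "x \<in> B" "x \<notin> set xs" "set xs \<subseteq> B - {x}" using Cons.prems by auto
    have "?cos x \<in> carrier ?Q"
      using x(1) BPV by (intro H.hom_closed) (auto simp: carrier_poly_ring)
    moreover have "?cos x \<notin> Q.Span K (map ?cos xs)"
    proof
      assume "?cos x \<in> Q.Span K (map ?cos xs)"
      then obtain v where "v \<in> cp.span (set xs)" "?cos x = ?cos v"
        using Span[of xs] x(3) BPV by auto
      then have "v \<in> cp.span (B - {x})" "x - v \<in> I"
        using cp.span_mono[OF x(3)] coset_eq_iff[OF I] by auto
      then show False using minimal[OF x(1)] by blast
    qed
    ultimately show ?case using Cons.IH Cons.prems by (auto intro: Q.li_Cons)
  qed simp
  obtain xs where xs: "set xs = B" "distinct xs" using finite_distinct_list[OF fin] by blast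
  have "quotient_piece n I d = ?cos ` cp.span B"
    unfolding quotient_piece_def homogeneous_polys_eq
  proof (intro subset_antisym subsetI)
    fix u assume "u \<in> ?cos ` (polys_in {1..n} \<inter> homog d)"
    then obtain f where f: "u = ?cos f" "f \<in> polys_in {1..n}" "f \<in> homog d" by blast
    obtain b where b: "b \<in> cp.span B" "f - b \<in> ?E" using B f by (auto simp: spans_def)
    have "b \<in> polys_in {1..n}" using b(1) span_polys_in[OF BPV] by blast
    then have "f - b \<in> I" using ext_inter[OF polys_in_diff[OF f(2)]] b(2) by blast
    then have "u = ?cos b" unfolding f(1) coset_eq_iff[OF I] .
    then show "u \<in> ?cos ` cp.span B" using b(1) by blast
  next
    fix u assume "u \<in> ?cos ` cp.span B"
    moreover have "cp.span B \<subseteq> polys_in {1..n} \<inter> homog d"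
      using span_polys_in[OF BPV] span_homog[of B d] B by (auto simp: spans_def)
    ultimately show "u \<in> ?cos ` (polys_in {1..n} \<inter> homog d)" by blast
  qed
  then have "quotient_piece n I d = Q.Span K (map ?cos xs)"
    using Span[of xs] xs BPV by simp
  moreover have "Q.dimension (length (map ?cos xs)) K (Q.Span K (map ?cos xs))"
    using ind[OF xs(2)] xs(1) by (intro Q.dimension_independent) simp
  ultimately have "(Q.dim over K) (quotient_piece n I d) = length xs"
    using Q.dimI[OF subK] by simp
  then show ?thesis
    using xs cB by (simp add: over_def K_def distinct_card[symmetric])
qed

text \<open>In the zero ring no vector lies outside a subspace, so 0 is the only dimension that can
  be derived.\<close>

lemma dim_quotient_piece_zero:
  assumes I: "ideal I (poly_ring n)" and one: "1 \<in> I"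
  shows "ring.dim (poly_ring n Quot I) K (quotient_piece n I d) = 0"
proof -
  let ?Q = "poly_ring n Quot I" and ?cos = "\<lambda>f. I +>\<^bsub>poly_ring n\<^esub> f"
  interpret Q: ring ?Q by (rule ideal.quotient_is_ring[OF I])
  interpret H: ring_hom_ring "poly_ring n" ?Q ?cos by (rule ideal.rcos_ring_hom_ring[OF I])
  note I' = ideal_poly_ringD[OF I]
  have zero: "\<zero>\<^bsub>?Q\<^esub> = ?cos 0" using H.hom_zero by simp
  have cos: "?cos f = \<zero>\<^bsub>?Q\<^esub>" if "f \<in> polys_in {1..n}" for f
    unfolding zero coset_eq_iff[OF I] using I'(4)[OF one that] by simp
  have carr: "carrier ?Q = {\<zero>\<^bsub>?Q\<^esub>}"
  proof -
    have "\<one>\<^bsub>?Q\<^esub> = \<zero>\<^bsub>?Q\<^esub>" using H.hom_one cos[OF polys_in_1] by simp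
    then show ?thesis using Q.one_zeroD by blast
  qed
  have piece: "quotient_piece n I d = {\<zero>\<^bsub>?Q\<^esub>}"
  proof -
    have "quotient_piece n I d = (\<lambda>f. \<zero>\<^bsub>?Q\<^esub>) ` homogeneous_polys n d"
      unfolding quotient_piece_def using cos by (intro image_cong) (auto simp only: homogeneous_polys_eq)
    moreover have "0 \<in> homogeneous_polys n d" by (simp add: homogeneous_polys_eq)
    ultimately show ?thesis using image_constant by metis
  qed
  have dim0: "m = 0 \<and> E = {\<zero>\<^bsub>?Q\<^esub>}" if "Q.dimension m K E" for m E
    using that
  proof (induction rule: Q.dimension.induct)
    case (Suc_dim v E m K)
    then show ?case using carr by blast
  qed simp
  show ?thesis
    unfolding Q.dim_def piece by (rule the_equality) (use dim0 in auto)
qed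

lemma hilbert_series_eq:
  assumes I: "ideal I (poly_ring n)" and h: "\<And>f d. f \<in> I \<Longrightarrow> hcomp d f \<in> I"
  shows "hilbert_series n I = hser (ext n I)"
proof (cases "1 \<in> I")
  case True
  have "hideal n (ext n I)" by (rule hideal_ext[OF I h])
  moreover have "1 \<in> ext n I" using ext_inter[OF polys_in_1] True by blast
  ultimately have "hser (ext n I) = 0" by (rule hser_eq_0)
  then show ?thesis
    using dim_quotient_piece_zero[OF I True] by (simp add: hilbert_series_def fps_eq_iff)
next
  case False
  then show ?thesis
    using dim_quotient_piece[OF I h False] by (simp add: hilbert_series_def hser_def)
qed

theorem theorem4p12:
  fixes n :: nat and J :: "nat set"
  assumes "J \<subseteq> {1..n}"
  shows "colon_ideal n (coinvariant_ideal n) (f_poly n J)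
           = Idl\<^bsub>poly_ring n\<^esub> (p_poly n J ` {1..n})
       \<and> Idl\<^bsub>poly_ring n\<^esub> (p_poly n J ` {1..n})
           = gr_ideal n (vanishing_ideal n (nietzschean_locus n J))
       \<and> hilbert_series n (colon_ideal n (coinvariant_ideal n) (f_poly n J))
           = (\<Prod>i = 1..n. q_number (staircase J i))"
proof -
  let ?C = "colon_ideal n (coinvariant_ideal n) (f_poly n J)"
  let ?P = "Idl\<^bsub>poly_ring n\<^esub> (p_gen n J ` {1..n})"
  let ?P' = "Idl\<^bsub>poly_ring n\<^esub> (p_poly n J ` {1..n})"
  let ?G = "gr_ideal n (vanishing_ideal n (nietzschean_locus n J))"
  have rPV: "p_gen n J ` {1..n} \<subseteq> polys_in {1..n}" using p_gen_polys_in by blast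
  have pPV: "p_poly n J ` {1..n} \<subseteq> polys_in {1..n}" using p_poly_polys_in[OF assms] by blast
  have P: "ideal ?P (poly_ring n)" by (rule Idl_ideal[OF rPV])
  have P': "ideal ?P' (poly_ring n)" by (rule Idl_ideal[OF pPV])
  have r: "p_gen n J k \<in> ?P" if "k \<in> {1..n}" for k using Idl_self[OF rPV] that by blast
  have "?P \<subseteq> ?P'"
    using p_gen_in_p[OF P' assms] Idl_self[OF pPV] by (intro Idl_least[OF P']) blast
  moreover have "?P' \<subseteq> ?P"
    using p_in_p_gen[OF P assms] r by (intro Idl_least[OF P]) blast
  ultimately have PP': "?P' = ?P" by blast
  have C: "ideal ?C (poly_ring n)" by (rule ideal_colon[OF assms])
  have extC: "ext n ?C = colon (ext n (coinvariant_ideal n)) (f_poly n J)"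
    by (rule ext_colon_ideal[OF f_poly_polys_in[OF assms]])
  have hC: "hideal n (ext n ?C)"
    unfolding extC by (rule hideal_colon[OF hideal_coinvariant f_poly_homog])
  have CPV: "?C \<subseteq> polys_in {1..n}" by (rule ideal_poly_ringD(1)[OF C])
  have compC: "hcomp d f \<in> ?C" if "f \<in> ?C" for f d
    using hideal_hcomp[OF hC, of f d] ext_inter[of f n ?C] ext_inter[of "hcomp d f" n ?C] polys_in_hcomp that CPV
    by blast
  have compP: "hcomp d f \<in> ?P" if "f \<in> ?P" for f d
  proof (rule Idl_hcomp[OF rPV _ that])
    fix g e assume g: "g \<in> p_gen n J ` {1..n}"
    have "\<exists>d. p_gen n J k \<in> homog d" for k
      unfolding p_gen_def by (rule exI, rule dd_homog) auto
    then obtain d where "g \<in> homog d" using g by blast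
    moreover have "g \<in> ?P" using g r by blast
    ultimately show "hcomp e g \<in> ?P"
      using ideal_poly_ringD(2)[OF P] by simp
  qed
  have hP: "hideal n (ext n ?P)" by (rule hideal_ext[OF P compP])
  have PC: "?P \<subseteq> ?G" "?G \<subseteq> ?C"
  proof -
    show "?P \<subseteq> ?G"
      using p_gen_in_gr[OF assms] Idl_ideal[OF gr_gens_polys_in] unfolding gr_ideal_eq
      by (intro Idl_least) auto
    show "?G \<subseteq> ?C" by (rule gr_le_colon[OF assms])
  qed
  have le: "hser (ext n ?P) \<preceq> stair_series n J"
    using r ext_inter[OF p_gen_polys_in] by (intro hser_le_stair[OF hP _ assms]) blast
  have ge: "stair_series n J \<preceq> hser (ext n ?C)"
    unfolding extC
    using colon_f_poly[OF hideal_coinvariant p_gen_coinvariant stair_le_coinvariant assms] by blast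
  have sub: "ext n ?P \<subseteq> ext n ?C" using PC by (auto simp: ext_def)
  \<comment> \<open>The series of the smallest ideal is at most the product and that of the largest
    at least the product. The reverse of the inclusion \<open>sub\<close> follows, and the ideal of
    leading forms is squeezed in between.\<close>
  have "qdim (ext n ?P) d \<le> qdim (ext n ?C) d" for d
    using fps_le_trans[OF le ge] by (simp add: fps_le_def hser_def)
  then have eq: "ext n ?P = ext n ?C" by (rule hideal_eqI[OF hP hC sub])
  then have "?P = ?C"
    using ext_eq_iff[OF ideal_poly_ringD(1)[OF P] CPV] by blast
  moreover have "hilbert_series n ?C = hser (ext n ?C)"
    by (rule hilbert_series_eq[OF C compC])
  then have "hilbert_series n ?C = stair_series n J"
    using fps_le_antisym[OF le[unfolded eq] ge] by simp
  ultimately show ?thesis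
    using PC unfolding PP' stair_series_def by blast
qed

end
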